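(* For every $\epsilon>0$ there is a constant $\delta(\epsilon)>0$ depending only on $\epsilon$ such that for all $g,n$ with $3g+n\ge5$ and every $X\in\mathcal{M}^n_g$ with $\ell_{sys}(X)\leq\delta(\epsilon)$, for every finite-area holomorphic quadratic differential $\phi$ on $X$ and every $z\in X$, \[\|\phi(z)\|\leq(1+\epsilon)\sqrt{\frac{2}{\pi}}\,\frac{\|\phi\|_2}{\sqrt{\ell_{sys}(X)}}.\]
   Context: $\mathcal{M}^n_g$ is the moduli space of finite-area hyperbolic surfaces $X=(S,\sigma|dz|^2)$ of genus $g$ with $n$ punctures. $\|\phi(z)\|=|\phi(z)|/\sigma(z)$ and $\|\phi\|_2^2=\int_X\|\phi\|^2dA$. $\ell_{sys}(X)$ is the length of the shortest closed geodesic. *)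

theory Defs
  imports "HOL-Complex_Analysis.Complex_Analysis"
begin

(* Uniformization model: a finite-area hyperbolic surface X = H / Gamma,
   Gamma a torsion-free Fuchsian group of finite covolume.
   Elements of SL(2,R) are quadruples (a,b,c,d) with ad - bc = 1. *)

type_synonym mat2 = "real \<times> real \<times> real \<times> real"

definition uhp :: "complex set" where
  "uhp = {z. Im z > 0}"

definition SL2 :: "mat2 set" where
  "SL2 = {(a,b,c,d). a*d - b*c = 1}"

definition mat_id :: mat2 where "mat_id = (1,0,0,1)"
definition mat_negid :: mat2 where "mat_negid = (-1,0,0,-1)"

fun mat_mult :: "mat2 \<Rightarrow> mat2 \<Rightarrow> mat2" where
  "mat_mult (a,b,c,d) (a',b',c',d') =
     (a*a' + b*c', a*b' + b*d', c*a' + d*c', c*b' + d*d')"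

fun mat_inv :: "mat2 \<Rightarrow> mat2" where
  "mat_inv (a,b,c,d) = (d, -b, -c, a)"

fun tr :: "mat2 \<Rightarrow> real" where
  "tr (a,b,c,d) = a + d"

fun mat_bound :: "mat2 \<Rightarrow> real" where
  "mat_bound (a,b,c,d) = max (max \<bar>a\<bar> \<bar>b\<bar>) (max \<bar>c\<bar> \<bar>d\<bar>)"

fun mob :: "mat2 \<Rightarrow> complex \<Rightarrow> complex" where
  "mob (a,b,c,d) z = (of_real a * z + of_real b) / (of_real c * z + of_real d)"

fun mob_deriv :: "mat2 \<Rightarrow> complex \<Rightarrow> complex" where
  "mob_deriv (a,b,c,d) z = 1 / (of_real c * z + of_real d)\<^sup>2"

(* action on the boundary R \<union> {\<infinity>}; None = \<infinity> *)
fun bmob :: "mat2 \<Rightarrow> real option \<Rightarrow> real option" where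
  "bmob (a,b,c,d) None = (if c = 0 then None else Some (a / c))"
| "bmob (a,b,c,d) (Some x) =
     (if c*x + d = 0 then None else Some ((a*x + b) / (c*x + d)))"

fun par_fix :: "mat2 \<Rightarrow> real option" where
  "par_fix (a,b,c,d) = (if c = 0 then None else Some ((a - d) / (2*c)))"

definition parabolic :: "mat2 \<Rightarrow> bool" where
  "parabolic g \<longleftrightarrow> \<bar>tr g\<bar> = 2 \<and> g \<noteq> mat_id \<and> g \<noteq> mat_negid"

definition hyperbolic :: "mat2 \<Rightarrow> bool" where
  "hyperbolic g \<longleftrightarrow> \<bar>tr g\<bar> > 2"

definition fuchsian :: "mat2 set \<Rightarrow> bool" where
  "fuchsian G \<longleftrightarrow> G \<subseteq> SL2 \<and> mat_id \<in> G \<and>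
     (\<forall>g\<in>G. \<forall>h\<in>G. mat_mult g h \<in> G) \<and> (\<forall>g\<in>G. mat_inv g \<in> G) \<and>
     (\<forall>R. finite {g\<in>G. mat_bound g \<le> R})"

(* no elliptic elements (acts freely on H) *)
definition torsion_free :: "mat2 set \<Rightarrow> bool" where
  "torsion_free G \<longleftrightarrow> (\<forall>g\<in>G. g \<noteq> mat_id \<and> g \<noteq> mat_negid \<longrightarrow> \<bar>tr g\<bar> \<ge> 2)"

definition fundamental_set :: "mat2 set \<Rightarrow> complex set \<Rightarrow> bool" where
  "fundamental_set G F \<longleftrightarrow> F \<in> sets lborel \<and> F \<subseteq> uhp \<and>
     (\<forall>z\<in>uhp. \<exists>!w\<in>F. \<exists>g\<in>G. mob g z = w)"

definition hyp_area :: "complex set \<Rightarrow> ennreal" where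
  "hyp_area F = (\<integral>\<^sup>+ z\<in>F. ennreal (1 / (Im z)\<^sup>2) \<partial>lborel)"

definition cusp_points :: "mat2 set \<Rightarrow> real option set" where
  "cusp_points G = {p. \<exists>g\<in>G. parabolic g \<and> p = par_fix g}"

definition cusp_classes :: "mat2 set \<Rightarrow> real option set set" where
  "cusp_classes G = (\<lambda>p. (\<lambda>g. bmob g p) ` G) ` cusp_points G"

definition in_moduli :: "nat \<Rightarrow> nat \<Rightarrow> mat2 set \<Rightarrow> complex set \<Rightarrow> bool" where
  "in_moduli g n G F \<longleftrightarrow> fuchsian G \<and> torsion_free G \<and> fundamental_set G F \<and>
     hyp_area F < \<infinity> \<and>
     finite (cusp_classes G) \<and> card (cusp_classes G) = n \<and>
     hyp_area F = ennreal (2 * pi * (2 * real g - 2 + real n))"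

definition systole :: "mat2 set \<Rightarrow> real" where
  "systole G = Inf {2 * arcosh (\<bar>tr g\<bar> / 2) | g. g \<in> G \<and> hyperbolic g}"

definition fin_area_hqd :: "mat2 set \<Rightarrow> complex set \<Rightarrow> (complex \<Rightarrow> complex) \<Rightarrow> bool" where
  "fin_area_hqd G F \<phi> \<longleftrightarrow> \<phi> holomorphic_on uhp \<and>
     (\<forall>g\<in>G. \<forall>z\<in>uhp. \<phi> (mob g z) * (mob_deriv g z)\<^sup>2 = \<phi> z) \<and>
     (\<integral>\<^sup>+ z\<in>F. ennreal (cmod (\<phi> z)) \<partial>lborel) < \<infinity>"

(* pointwise norm |phi|/sigma with sigma = 1/(Im z)^2 *)
definition pt_norm :: "(complex \<Rightarrow> complex) \<Rightarrow> complex \<Rightarrow> real" where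
  "pt_norm \<phi> z = cmod (\<phi> z) * (Im z)\<^sup>2"

(* ||phi||_2 = sqrt (\<integral>_X ||phi||^2 dA), dA = dx dy / (Im z)^2 *)
definition L2_norm :: "complex set \<Rightarrow> (complex \<Rightarrow> complex) \<Rightarrow> real" where
  "L2_norm F \<phi> = sqrt (enn2real (\<integral>\<^sup>+ z\<in>F. ennreal ((pt_norm \<phi> z)\<^sup>2 / (Im z)\<^sup>2) \<partial>lborel))"

end

(*
  Let z have small displacement under some element of G. If that element is hyperbolic, z lies deep
  in the collar of a geodesic of length t >= systole; in the coordinate \<zeta> = log z the lifted
  differential becomes a t-periodic holomorphic function f on a strip 0 < Im \<zeta> < pi, with
  ||\<phi>|| = |f| sin^2(Im \<zeta>). Its mean c over a period does not depend on Im \<zeta>, and comparing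
  L^2 norms over the collar gives |c|^2 t (pi/2 - o(1)) <= ||\<phi>||_2^2, which is the main term.
  The remainder f - c is at most t sup |f'|, and the Cauchy estimate on discs of radius comparable
  to sin(Im \<zeta>) bounds its contribution by a universal multiple of ||\<phi>||_2. The same argument
  bounds ||\<phi>|| in cusp neighbourhoods, where c = 0 because \<phi> is integrable, and the mean value
  property bounds it where the displacement is large. With L^1 in place of L^2 these estimates show
  that ||\<phi>|| is bounded, hence ||\<phi>||_2 is finite. The systole is positive because each short
  geodesic has a collar of area bounded below inside the set of points moved little by elements of
  trace close to 2, and these sets decrease to the empty set.
*)
theory Submission
  imports Defs
begin

text \<open>The bound has to stay sharp as the period t tends to 0, so only the mean c may cost a
  factor 1/sqrt t. A disc of radius about \<tau> = sin(Im \<zeta>) meets about \<tau>/t periods, so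
  the mean value property alone controls \<tau>^2 |f| only by sqrt(\<tau>/t) ||\<phi>||_2. But f - c
  gains a factor t/\<tau> over f, and the product sqrt(t/\<tau>) is bounded. The constant sqrt(2/pi)
  is thus the inverse square root of the integral of sin^2 over (0, pi), the weight with which c
  enters the L^2 norm. Collars and cusp neighbourhoods embed for one algebraic reason: every trace
  in the group has absolute value at least 2, and this is applied to words in two elements. After a
  conjugation the axis is the imaginary axis, or the cusp is infinity, and one abstract periodic
  chart serves both cases. Two encodings demand extra proofs. \<open>systole\<close> is an infimum
  of reals, so its set must be shown nonempty and bounded away from 0. \<open>L2_norm\<close> passes
  through \<open>enn2real\<close>, which sends infinity to 0, so finiteness must be known before the
  norm can bound anything.\<close>

abbreviation mat_conj :: "mat2 \<Rightarrow> mat2 \<Rightarrow> mat2" where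
  "mat_conj m g \<equiv> mat_mult (mat_mult m g) (mat_inv m)"

abbreviation period_box :: "real \<Rightarrow> real \<Rightarrow> real set \<Rightarrow> complex set" where
  "period_box x t I \<equiv> {\<zeta>. x \<le> Re \<zeta> \<and> Re \<zeta> < x + t \<and> Im \<zeta> \<in> I}"

abbreviation hyp_integral :: "(complex \<Rightarrow> ennreal) \<Rightarrow> complex set \<Rightarrow> ennreal" where
  "hyp_integral \<kappa> A \<equiv> (\<integral>\<^sup>+z\<in>A. \<kappa> z * ennreal (1 / (Im z)\<^sup>2) \<partial>lborel)"

subsection \<open>Change of variables under injective holomorphic maps\<close>

text \<open>The differentiable change of variables used below is stated for maps of
  \<open>real^2\<close>; this pair of inverse linear isometries carries it over to
  \<open>complex\<close>.\<close>

definition complex_of_vec :: "real^2 \<Rightarrow> complex" where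
  "complex_of_vec v = Complex (v $ 1) (v $ 2)"

definition vec_of_complex :: "complex \<Rightarrow> real^2" where
  "vec_of_complex z = vector [Re z, Im z]"

lemma complex_of_vec_inverse [simp]:
  "complex_of_vec (vec_of_complex z) = z" "vec_of_complex (complex_of_vec v) = v"
  by (auto simp: complex_of_vec_def vec_of_complex_def vec_eq_iff forall_2)

lemma linear_complex_of_vec: "linear complex_of_vec"
  by (rule linearI) (auto simp: complex_of_vec_def complex_eq_iff)

lemma linear_vec_of_complex: "linear vec_of_complex"
  by (rule linearI) (auto simp: vec_of_complex_def vec_eq_iff forall_2)

lemma measurable_complex_of_vec [measurable]: "complex_of_vec \<in> borel_measurable borel"
  by (intro borel_measurable_continuous_onI linear_continuous_on
      linear_conv_bounded_linear[THEN iffD1] linear_complex_of_vec)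

lemma emeasure_lborel_complex_box:
  assumes "\<And>b. b \<in> Basis \<Longrightarrow> l \<bullet> b \<le> u \<bullet> (b::complex)"
  shows "(\<Prod>b\<in>Basis. (u - l) \<bullet> b) = (Re u - Re l) * (Im u - Im l)" "Re l \<le> Re u" "Im l \<le> Im u"
  using assms[of 1] assms[of \<i>] by (auto simp: Basis_complex_def inner_complex_def)

lemma distr_lborel_complex_of_vec:
  "distr lborel borel complex_of_vec = lborel"
proof (rule lborel_eqI[symmetric])
  fix l u :: complex assume lu: "\<And>b. b \<in> Basis \<Longrightarrow> l \<bullet> b \<le> u \<bullet> b"
  note le = emeasure_lborel_complex_box[OF lu]
  have *: "complex_of_vec -` box l u = box (vec_of_complex l) (vec_of_complex u)"
    by (auto simp: box_def complex_of_vec_def vec_of_complex_def Basis_complex_def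
        inner_complex_def Basis_vec_def inner_axis forall_2)
  have B: "(Basis :: (real^2) set) = {axis 1 1, axis 2 1}"
    by (auto simp: Basis_vec_def UNIV_2)
  have ne: "axis 1 (1::real) \<noteq> (axis 2 1 :: real^2)"
    by (simp add: axis_eq_axis)
  have "emeasure (distr lborel borel complex_of_vec) (box l u) =
      emeasure lborel (box (vec_of_complex l) (vec_of_complex u))"
    by (subst emeasure_distr) (auto simp: *)
  also have "\<dots> = ennreal (\<Prod>b\<in>Basis. (vec_of_complex u - vec_of_complex l) \<bullet> b)"
    by (rule emeasure_lborel_box) (use le in \<open>auto simp: B vec_of_complex_def inner_axis\<close>)
  also have "(\<Prod>b\<in>Basis. (vec_of_complex u - vec_of_complex l) \<bullet> b) = (Re u - Re l) * (Im u - Im l)"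
    unfolding B using ne by (simp add: vec_of_complex_def inner_axis)
  finally show "emeasure (distr lborel borel complex_of_vec) (box l u) =
    ennreal (\<Prod>b\<in>Basis. (u - l) \<bullet> b)" by (simp add: le(1))
qed auto

lemma distr_lborel_Complex:
  "distr (lborel \<Otimes>\<^sub>M lborel) borel (\<lambda>(x, y). Complex x y) = lborel"
proof (rule lborel_eqI[symmetric])
  have [measurable]: "(\<lambda>(x, y). Complex x y) \<in> borel_measurable (borel \<Otimes>\<^sub>M borel)"
    unfolding Complex_eq by measurable
  fix l u :: complex assume lu: "\<And>b. b \<in> Basis \<Longrightarrow> l \<bullet> b \<le> u \<bullet> b"
  note le = emeasure_lborel_complex_box[OF lu]
  have *: "(\<lambda>(x, y). Complex x y) -` box l u = box (Re l) (Re u) \<times> box (Im l) (Im u)"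
    by (auto simp: box_def Basis_complex_def inner_complex_def)
  have "emeasure (distr (lborel \<Otimes>\<^sub>M lborel) borel (\<lambda>(x, y). Complex x y)) (box l u) =
      emeasure (lborel \<Otimes>\<^sub>M lborel) (box (Re l) (Re u) \<times> box (Im l) (Im u))"
    by (subst emeasure_distr) (auto simp: * space_pair_measure)
  also have "\<dots> = ennreal ((Re u - Re l) * (Im u - Im l))"
    using le by (subst lborel.emeasure_pair_measure_Times) (auto simp: ennreal_mult)
  finally show "emeasure (distr (lborel \<Otimes>\<^sub>M lborel) borel (\<lambda>(x, y). Complex x y)) (box l u) =
    ennreal (\<Prod>b\<in>Basis. (u - l) \<bullet> b)" by (simp add: le)
qed auto

text \<open>The imaginary part is the outer variable, because the strip estimates integrate over one
  horizontal period first and over heights afterwards.\<close>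

lemma nn_integral_lborel_complex:
  assumes [measurable]: "f \<in> borel_measurable borel"
  shows "(\<integral>\<^sup>+z. f z \<partial>lborel) = (\<integral>\<^sup>+y. \<integral>\<^sup>+x. f (Complex x y) \<partial>lborel \<partial>lborel)"
proof -
  have [measurable]: "(\<lambda>(x, y). Complex x y) \<in> borel_measurable (borel \<Otimes>\<^sub>M borel)"
    unfolding Complex_eq by measurable
  have "(\<integral>\<^sup>+z. f z \<partial>lborel) = (\<integral>\<^sup>+p. f (case p of (x, y) \<Rightarrow> Complex x y) \<partial>(lborel \<Otimes>\<^sub>M lborel))"
    by (subst distr_lborel_Complex[symmetric], subst nn_integral_distr) auto
  also have "\<dots> = (\<integral>\<^sup>+y. \<integral>\<^sup>+x. f (Complex x y) \<partial>lborel \<partial>lborel)"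
    by (subst lborel_pair.nn_integral_snd[symmetric]) auto
  finally show ?thesis .
qed

text \<open>Nothing is known about a holomorphic function outside its domain. Cutting it off by 0
  gives a Borel function on the whole plane; the auxiliary functions \<open>F\<close>,
  \<open>P\<close> and \<open>\<psi>\<close> in later proofs are all of this kind.\<close>

lemma borel_measurable_holomorphic_extension:
  assumes "f holomorphic_on A" "open A"
  shows "(\<lambda>z. if z \<in> A then f z else 0) \<in> borel_measurable borel"
  by (rule borel_measurable_continuous_on_if)
     (use assms in \<open>auto intro!: holomorphic_on_imp_continuous_on\<close>)

lemma open_strip: "open A \<Longrightarrow> open {\<zeta>. Im \<zeta> \<in> A}"
  using open_vimage[of A Im] by (simp add: vimage_def continuous_intros)

text \<open>The image is the preimage of \<open>B\<close> under the holomorphic inverse of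
  \<open>p\<close>, and preimages of Borel sets are Borel.\<close>

lemma borel_image_holomorphic_inj:
  assumes p: "p holomorphic_on T" "open T" "inj_on p T" and B: "B \<in> sets borel" "B \<subseteq> T"
  shows "p ` B \<in> sets borel"
proof -
  obtain q where q: "q holomorphic_on (p ` T)" "\<And>z. z \<in> T \<Longrightarrow> q (p z) = z"
    using holomorphic_has_inverse[OF p] by metis
  have op: "open (p ` T)" using open_mapping_thm3[OF p] .
  have "(\<lambda>w. if w \<in> p ` T then q w else 0) \<in> borel_measurable borel"
    by (rule borel_measurable_holomorphic_extension[OF q(1) op])
  then have "(\<lambda>w. if w \<in> p ` T then q w else 0) -` B \<inter> space borel \<in> sets borel"
    by (rule measurable_sets) (rule B(1))
  then have "((\<lambda>w. if w \<in> p ` T then q w else 0) -` B) \<inter> p ` T \<in> sets borel"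
    using op by auto
  also have "((\<lambda>w. if w \<in> p ` T then q w else 0) -` B) \<inter> p ` T = p ` B"
  proof (intro set_eqI iffI)
    fix x assume "x \<in> ((\<lambda>w. if w \<in> p ` T then q w else 0) -` B) \<inter> p ` T"
    then have "x \<in> p ` T" "q x \<in> B" by auto
    then show "x \<in> p ` B" using q(2) by (metis imageE imageI)
  next
    fix x assume "x \<in> p ` B"
    then obtain y where "y \<in> B" "x = p y" by auto
    then show "x \<in> ((\<lambda>w. if w \<in> p ` T then q w else 0) -` B) \<inter> p ` T"
      using q(2)[of y] B by auto
  qed
  finally show ?thesis .
qed

text \<open>By the Cauchy-Riemann equations the real Jacobian determinant of \<open>p\<close> is the
  square of |p'|. The real theorem speaks of sets of finite measure and of real integrals, so the
  two values of the extended integral \<open>I\<close>, finite and infinite, are treated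
  separately.\<close>

lemma emeasure_holomorphic_image:
  assumes p: "p holomorphic_on T" "open T" "inj_on p T" and B: "B \<in> sets borel" "B \<subseteq> T"
  shows "emeasure lborel (p ` B) = (\<integral>\<^sup>+z\<in>B. ennreal ((cmod (deriv p z))\<^sup>2) \<partial>lborel)"
proof -
  define S where "S = complex_of_vec -` B"
  define g where "g = vec_of_complex \<circ> p \<circ> complex_of_vec"
  define g' where "g' v = vec_of_complex \<circ> (\<lambda>h. deriv p (complex_of_vec v) * h) \<circ> complex_of_vec" for v
  have pB [measurable]: "p ` B \<in> sets borel" by (rule borel_image_holomorphic_inj[OF p B])
  have Sb [measurable]: "S \<in> sets borel" 
    using measurable_sets[OF measurable_complex_of_vec B(1)] by (simp add: S_def)
  have S: "S \<in> sets lebesgue" using Sb by simp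
  have gS: "g ` S = complex_of_vec -` (p ` B)"
    unfolding g_def S_def by (auto simp: image_iff) (metis complex_of_vec_inverse vimageI)
  have gSb: "g ` S \<in> sets borel"
    using measurable_sets[OF measurable_complex_of_vec pB] by (simp add: gS)
  have der: "(g has_derivative g' v) (at v within S)" if "v \<in> S" for v
  proof -
    have "complex_of_vec v \<in> T" using that B by (auto simp: S_def)
    then have "(p has_field_derivative deriv p (complex_of_vec v)) (at (complex_of_vec v))"
      using p holomorphic_derivI by blast
    then have 1: "(p has_derivative (\<lambda>h. deriv p (complex_of_vec v) * h)) (at (complex_of_vec v))"
      by (simp add: has_field_derivative_def)
    have 2: "(complex_of_vec has_derivative complex_of_vec) (at v within S)"
      using linear_complex_of_vec by (simp add: linear_imp_has_derivative)
    have 3: "(vec_of_complex has_derivative vec_of_complex) (at (p (complex_of_vec v)))"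
      using linear_vec_of_complex by (simp add: linear_imp_has_derivative)
    show ?thesis unfolding g_def g'_def
      using has_derivative_compose[OF has_derivative_compose[OF 2 1] 3] by (simp add: comp_def)
  qed
  have inj: "inj_on g S"
    using p(3) B(2) unfolding inj_on_def g_def S_def
    by (metis complex_of_vec_inverse comp_apply subsetD vimageD)
  have det: "\<bar>det (matrix (g' v))\<bar> = (cmod (deriv p (complex_of_vec v)))\<^sup>2" for v
    unfolding cmod_power2
    by (simp add: det_2 matrix_def g'_def complex_of_vec_def vec_of_complex_def axis_def
        power2_eq_square)
  have [measurable]: "(\<lambda>z. ennreal ((cmod (deriv p z))\<^sup>2) * indicator B z) \<in> borel_measurable borel"
  proof -
    have "(\<lambda>z. if z \<in> T then deriv p z else 0) \<in> borel_measurable borel"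
      by (rule borel_measurable_holomorphic_extension[OF holomorphic_deriv[OF p(1,2)] p(2)])
    then have "(\<lambda>z. ennreal ((cmod (if z \<in> T then deriv p z else 0))\<^sup>2) * indicator B z) \<in> borel_measurable borel"
      using B by measurable
    also have "(\<lambda>z. ennreal ((cmod (if z \<in> T then deriv p z else 0))\<^sup>2) * indicator B z) =
      (\<lambda>z. ennreal ((cmod (deriv p z))\<^sup>2) * indicator B z)"
      using B by (auto simp: fun_eq_iff indicator_def)
    finally show ?thesis .
  qed
  have int_eq: "(\<integral>\<^sup>+z\<in>B. ennreal ((cmod (deriv p z))\<^sup>2) \<partial>lborel) = 
     (\<integral>\<^sup>+v. ennreal (\<bar>det (matrix (g' v))\<bar> * indicator S v) \<partial>lborel)"
    by (subst distr_lborel_complex_of_vec[symmetric], subst nn_integral_distr)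
       (simp_all, auto simp: det S_def indicator_def intro!: nn_integral_cong)
  have [measurable]: "(\<lambda>v. \<bar>det (matrix (g' v))\<bar> * indicator S v) \<in> borel_measurable borel"
  proof -
    have "(\<lambda>v. enn2real (ennreal ((cmod (deriv p (complex_of_vec v)))\<^sup>2) * indicator B (complex_of_vec v))) \<in> borel_measurable borel"
      using measurable_compose[OF measurable_complex_of_vec, of "\<lambda>z. ennreal ((cmod (deriv p z))\<^sup>2) * indicator B z" borel] by measurable
    also have "(\<lambda>v. enn2real (ennreal ((cmod (deriv p (complex_of_vec v)))\<^sup>2) * indicator B (complex_of_vec v))) =
        (\<lambda>v. \<bar>det (matrix (g' v))\<bar> * indicator S v)"
      by (auto simp: det S_def indicator_def fun_eq_iff)
    finally show ?thesis .
  qed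
  have ind: "(\<lambda>v. \<bar>det (matrix (g' v))\<bar> * indicator S v) = (\<lambda>v. if v \<in> S then \<bar>det (matrix (g' v))\<bar> else 0)"
    by auto
  have em: "emeasure lborel (p ` B) = emeasure lborel (g ` S)"
    by (subst distr_lborel_complex_of_vec[symmetric], subst emeasure_distr) (auto simp: gS)
  have iff: "g ` S \<in> lmeasurable \<and> measure lebesgue (g ` S) = m
     \<longleftrightarrow> ((\<lambda>x. \<bar>det (matrix (g' x))\<bar>) has_integral m) S" for m
    by (rule has_measure_differentiable_image[OF S der inj])
  define I where "I = (\<integral>\<^sup>+v. ennreal (\<bar>det (matrix (g' v))\<bar> * indicator S v) \<partial>lborel)"
  have "emeasure lborel (g ` S) = I"
  proof (cases I)
    case (real m)
    have "((\<lambda>v. \<bar>det (matrix (g' v))\<bar> * indicator S v) has_integral m) UNIV"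
      by (rule nn_integral_has_integral) (use real in \<open>auto simp: I_def\<close>)
    then have "((\<lambda>x. \<bar>det (matrix (g' x))\<bar>) has_integral m) S"
      unfolding ind by (simp only: has_integral_restrict_UNIV)
    then have "g ` S \<in> lmeasurable \<and> measure lebesgue (g ` S) = m" by (rule iff[THEN iffD2])
    then have "emeasure lebesgue (g ` S) = ennreal m"
      using emeasure_eq_measure2[of "g ` S" lebesgue] by simp
    moreover have "emeasure lebesgue (g ` S) = emeasure lborel (g ` S)" using gSb by simp
    ultimately show ?thesis using real by simp
  next
    case top
    \<comment> \<open>An image of finite measure would, by the equivalence \<open>iff\<close> read
      from left to right, make the integral \<open>I\<close> finite.\<close>
    have "emeasure lborel (g ` S) = \<infinity>"
    proof (rule ccontr)
      assume "emeasure lborel (g ` S) \<noteq> \<infinity>"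
      then have "emeasure lebesgue (g ` S) < \<infinity>" using gSb
        by (simp add: top.not_eq_extremum)
      then have "g ` S \<in> lmeasurable" using gSb by (intro fmeasurableI) auto
      then have hi: "((\<lambda>x. \<bar>det (matrix (g' x))\<bar>) has_integral measure lebesgue (g ` S)) S"
        by (intro iff[THEN iffD1]) simp
      then have "((\<lambda>v. \<bar>det (matrix (g' v))\<bar> * indicator S v) has_integral measure lebesgue (g ` S)) UNIV"
        unfolding ind by (simp only: has_integral_restrict_UNIV)
      then have "I = ennreal (measure lebesgue (g ` S))"
        unfolding I_def by (intro nn_integral_has_integral_lborel) auto
      then show False using top by simp
    qed
    then show ?thesis using top by simp
  qed
  then show ?thesis using em int_eq by (simp add: I_def)
qed

text \<open>Both sides integrate \<open>k\<close> against the same measure: Lebesgue measure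
  restricted to the image is the push-forward of |p'|^2 times Lebesgue measure on \<open>B\<close>.
  Equality on sets is the preceding lemma.\<close>

lemma nn_integral_holomorphic_image:
  assumes p: "p holomorphic_on T" "open T" "inj_on p T" and B: "B \<in> sets borel" "B \<subseteq> T"
    and k: "k \<in> borel_measurable borel"
  shows "(\<integral>\<^sup>+w\<in>p ` B. k w \<partial>lborel) = (\<integral>\<^sup>+z\<in>B. k (p z) * ennreal ((cmod (deriv p z))\<^sup>2) \<partial>lborel)"
proof -
  define d where "d z = ennreal ((cmod (if z \<in> T then deriv p z else 0))\<^sup>2) * indicator B z" for z
  define P where "P z = (if z \<in> T then p z else 0)" for z
  have [measurable]: "(\<lambda>z. if z \<in> T then deriv p z else 0) \<in> borel_measurable borel"
    by (rule borel_measurable_holomorphic_extension[OF holomorphic_deriv[OF p(1,2)] p(2)])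
  have [measurable]: "P \<in> borel_measurable borel" unfolding P_def
    by (rule borel_measurable_holomorphic_extension[OF p(1,2)])
  have [measurable]: "B \<in> sets borel" "k \<in> borel_measurable borel" by fact+
  have d [measurable]: "d \<in> borel_measurable borel" unfolding d_def by measurable
  have pB [measurable]: "p ` B \<in> sets borel" by (rule borel_image_holomorphic_inj[OF p B])
  have "density lborel (indicator (p ` B)) = distr (density lborel d) borel P"
  proof (rule measure_eqI)
    fix A assume "A \<in> sets (density lborel (indicator (p ` B)) :: complex measure)"
    then have [measurable]: "A \<in> sets borel" by simp
    have PA0 [measurable]: "P -` A \<in> sets borel" by (rule measurable_sets_borel) measurable
    then have PA: "P -` A \<inter> B \<in> sets borel" using B by auto
    have im: "p ` (P -` A \<inter> B) = A \<inter> p ` B" using B by (auto simp: P_def)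
    have "emeasure (density lborel (indicator (p ` B))) A = emeasure lborel (A \<inter> p ` B)"
      by (subst emeasure_density) (auto simp: indicator_inter_arith[symmetric] mult.commute)
    also have "\<dots> = (\<integral>\<^sup>+z\<in>P -` A \<inter> B. ennreal ((cmod (deriv p z))\<^sup>2) \<partial>lborel)"
      unfolding im[symmetric] by (rule emeasure_holomorphic_image[OF p PA]) (use B in auto)
    also have "\<dots> = emeasure (distr (density lborel d) borel P) A"
      by (subst emeasure_distr, simp, simp, subst emeasure_density)
         (use B PA0 in \<open>auto simp: d_def indicator_def intro!: nn_integral_cong\<close>)
    finally show "emeasure (density lborel (indicator (p ` B))) A = emeasure (distr (density lborel d) borel P) A" .
  qed auto
  then have "(\<integral>\<^sup>+w. k w \<partial>density lborel (indicator (p ` B))) = (\<integral>\<^sup>+w. k w \<partial>distr (density lborel d) borel P)"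
    by simp
  also have "\<dots> = (\<integral>\<^sup>+z. d z * k (P z) \<partial>lborel)"
    by (simp add: nn_integral_distr nn_integral_density)
  also have "\<dots> = (\<integral>\<^sup>+z\<in>B. k (p z) * ennreal ((cmod (deriv p z))\<^sup>2) \<partial>lborel)"
    using B by (intro nn_integral_cong) (auto simp: d_def P_def indicator_def mult.commute)
  also have "(\<integral>\<^sup>+w. k w \<partial>density lborel (indicator (p ` B))) = (\<integral>\<^sup>+w\<in>p ` B. k w \<partial>lborel)"
    by (simp add: nn_integral_density mult.commute)
  finally show ?thesis .
qed

subsection \<open>Mean value inequalities\<close>

lemma norm_has_integral_le_nn_integral:
  fixes g :: "real \<Rightarrow> complex"
  assumes "(g has_integral I) {a..b}" "continuous_on {a..b} g"
  shows "ennreal (cmod I) \<le> (\<integral>\<^sup>+x\<in>{a..b}. ennreal (cmod (g x)) \<partial>lborel)"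
proof -
  have ni: "(\<lambda>x. cmod (g x)) integrable_on {a..b}"
    using assms(2) by (intro integrable_continuous_real continuous_intros)
  then have hi: "((\<lambda>x. cmod (g x)) has_integral integral {a..b} (\<lambda>x. cmod (g x))) {a..b}"
    by (rule integrable_integral)
  have "I = integral {a..b} g" "g integrable_on {a..b}" using assms(1) by (auto simp: has_integral_iff)
  then have "cmod I \<le> integral {a..b} (\<lambda>x. cmod (g x))"
    using integral_norm_bound_integral[of g "{a..b}" "\<lambda>x. cmod (g x)"] ni by simp
  then show ?thesis
    using nn_integral_has_integral_lebesgue'[OF _ hi] by (simp add: ennreal_leI)
qed

lemma nn_integral_Icc_AE_Ioo:
  fixes f :: "real \<Rightarrow> ennreal"
  shows "(\<integral>\<^sup>+x\<in>{a..b}. f x \<partial>lborel) = (\<integral>\<^sup>+x\<in>{a<..<b}. f x \<partial>lborel)"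
    "(\<integral>\<^sup>+x\<in>{a..b}. f x \<partial>lborel) = (\<integral>\<^sup>+x\<in>{a..<b}. f x \<partial>lborel)"
  by (intro nn_integral_cong_AE eventually_mono[OF AE_conjI[OF AE_lborel_singleton[of a] AE_lborel_singleton[of b]]],
      auto simp: indicator_def)+

text \<open>Cauchy's formula on the circle of radius \<open>\<rho>\<close>, parametrized by [0, 1].
  The endpoints are dropped so that the range of angles agrees with the open strip on which polar
  coordinates are injective.\<close>

lemma holomorphic_circle_mean_le:
  assumes f: "f holomorphic_on ball z r" and \<rho>: "0 < \<rho>" "\<rho> < r"
  shows "ennreal (cmod (f z)) \<le>
    (\<integral>\<^sup>+x\<in>{0<..<1}. ennreal (cmod (f (z + of_real \<rho> * exp (2 * of_real pi * \<i> * of_real x)))) \<partial>lborel)"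
proof -
  define g where "g x = f (z + of_real \<rho> * exp (2 * of_real pi * \<i> * of_real x))" for x :: real
  have "f holomorphic_on cball z \<rho>"
    using f by (rule holomorphic_on_subset) (use \<rho> in auto)
  then have "((\<lambda>u. f u / (u - z)) has_contour_integral 2 * of_real pi * \<i> * f z) (circlepath z \<rho>)"
    using \<rho> Cauchy_integral_circlepath_simple[of f z \<rho> z] by simp
  then have "((\<lambda>x. 2 * of_real pi * \<i> * g x) has_integral 2 * of_real pi * \<i> * f z) {0..1}"
    unfolding has_contour_integral_def
  proof (rule has_integral_eq[rotated])
    fix x :: real assume "x \<in> {0..1}"
    then have "vector_derivative (circlepath z \<rho>) (at x within {0..1}) =
        2 * pi * \<i> * \<rho> * exp (2 * of_real pi * \<i> * x)"
      by (intro vector_derivative_circlepath01) auto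
    then show "f (circlepath z \<rho> x) / (circlepath z \<rho> x - z) * vector_derivative (circlepath z \<rho>) (at x within {0..1}) =
        2 * of_real pi * \<i> * g x"
      using \<rho> by (simp add: g_def circlepath)
  qed
  then have I: "(g has_integral f z) {0..1}"
    by (subst (asm) has_integral_mult_right_iff) auto
  have "continuous_on {0..1} g" unfolding g_def
    by (rule continuous_on_compose2[OF holomorphic_on_imp_continuous_on[OF f]])
       (use \<rho> in \<open>auto intro!: continuous_intros simp: dist_norm norm_mult\<close>)
  from norm_has_integral_le_nn_integral[OF I this] show ?thesis
    by (simp add: g_def nn_integral_Icc_AE_Ioo(1))
qed

text \<open>Circle means are integrated over the radius. Polar coordinates are written
  holomorphically as w = z + exp(2 pi i \<zeta>), with angle Re \<zeta> in (0, 1) and radius exp(-2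
  pi Im \<zeta>), so the holomorphic change of variables applies. The image misses a slit of the
  disc, which does no harm since only an inequality is claimed.\<close>

lemma holomorphic_area_mean_le:
  assumes f: "f holomorphic_on ball z r" and r: "0 < r"
  shows "ennreal (pi * r\<^sup>2 * cmod (f z)) \<le> (\<integral>\<^sup>+w\<in>ball z r. ennreal (cmod (f w)) \<partial>lborel)"
proof -
  \<comment> \<open>At height \<open>a\<close> the radius exp(-2 pi Im \<zeta>) equals
    \<open>r\<close>. The Jacobian 4 pi^2 exp(-4 pi y), integrated over y \<ge> a, gives pi exp(-4
    pi a) = pi r^2.\<close>
  define a where "a = - ln r / (2 * pi)"
  define p where "p \<zeta> = z + exp (2 * of_real pi * \<i> * \<zeta>)" for \<zeta> :: complex
  define T where "T = {\<zeta>. 0 < Re \<zeta> \<and> Re \<zeta> < 1}"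
  define B where "B = T \<inter> {\<zeta>. a < Im \<zeta>}"
  define F where "F w = (if w \<in> ball z r then f w else 0)" for w
  have Fm [measurable]: "F \<in> borel_measurable borel" unfolding F_def
    by (rule borel_measurable_holomorphic_extension[OF f open_ball])
  have opT: "open T" unfolding T_def
    by (intro open_Collect_conj open_Collect_less continuous_intros)
  have opB: "open B" unfolding B_def
    by (intro open_Int opT open_Collect_less continuous_intros)
  have pd: "(p has_field_derivative 2 * of_real pi * \<i> * exp (2 * of_real pi * \<i> * \<zeta>)) (at \<zeta>)" for \<zeta>
    unfolding p_def by (auto intro!: derivative_eq_intros)
  then have p: "p holomorphic_on T" by (meson field_differentiable_at_within field_differentiable_def holomorphic_onI)
  have dp: "deriv p \<zeta> = 2 * of_real pi * \<i> * exp (2 * of_real pi * \<i> * \<zeta>)" for \<zeta>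
    using pd by (rule DERIV_imp_deriv)
  have inj: "inj_on p T"
  proof (rule inj_onI)
    fix x y assume xy: "x \<in> T" "y \<in> T" "p x = p y"
    then have "exp (2 * of_real pi * \<i> * x) = exp (2 * of_real pi * \<i> * y)" by (simp add: p_def)
    then obtain n :: int where "2 * of_real pi * \<i> * x = 2 * of_real pi * \<i> * y + of_int (2 * n) * pi * \<i>"
      unfolding exp_eq by blast
    then have "(2 * of_real pi * \<i>) * (x - y - of_int n) = 0" by (simp add: algebra_simps)
    then have "x - y - of_int n = 0" by (simp only: mult_eq_0_iff) simp
    then have n: "x = y + of_int n" by (simp add: algebra_simps)
    with xy have "\<bar>of_int n :: real\<bar> < 1" by (auto simp: T_def)
    then have "n = 0" by linarith
    with n show "x = y" by simp
  qed
  have Bb: "B \<in> sets borel" "B \<subseteq> T" using opB by (auto simp: B_def)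
  have sub: "p ` B \<subseteq> ball z r"
  proof
    fix w assume "w \<in> p ` B"
    then obtain \<zeta> where \<zeta>: "\<zeta> \<in> B" "w = p \<zeta>" by auto
    have "dist z w = exp (- (2 * pi * Im \<zeta>))" by (simp add: \<zeta> p_def dist_norm norm_minus_commute)
    also have "\<dots> < exp (- (2 * pi * a))" using \<zeta> by (simp add: B_def)
    also have "\<dots> = r" using r by (simp add: a_def)
    finally show "w \<in> ball z r" by simp
  qed
  have inner: "ennreal (4 * pi\<^sup>2 * exp (- 4 * pi * y)) * ennreal (cmod (f z)) \<le>
     (\<integral>\<^sup>+x. ennreal (cmod (F (p (Complex x y))) * (cmod (deriv p (Complex x y)))\<^sup>2) * indicator B (Complex x y) \<partial>lborel)"
    if y: "y > a" for y
  proof -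
    define \<rho> where "\<rho> = exp (- (2 * pi * y))"
    have "\<rho> < exp (- (2 * pi * a))" using y by (simp add: \<rho>_def)
    also have "\<dots> = r" using r by (simp add: a_def)
    finally have \<rho>: "0 < \<rho>" "\<rho> < r" by (auto simp: \<rho>_def)
    have pe: "p (Complex x y) = z + of_real \<rho> * exp (2 * of_real pi * \<i> * of_real x)" for x
    proof -
      have "2 * of_real pi * \<i> * Complex x y = of_real (- (2 * pi * y)) + 2 * of_real pi * \<i> * of_real x"
        by (simp add: Complex_eq algebra_simps)
      then show ?thesis unfolding p_def \<rho>_def by (simp only: exp_add exp_of_real)
    qed
    have nd: "(cmod (deriv p (Complex x y)))\<^sup>2 = 4 * pi\<^sup>2 * exp (- 4 * pi * y)" for x
      by (simp add: dp norm_mult power_mult_distrib exp_double[symmetric] algebra_simps)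
    have "ennreal (4 * pi\<^sup>2 * exp (- 4 * pi * y)) * ennreal (cmod (f z)) \<le> 
      ennreal (4 * pi\<^sup>2 * exp (- 4 * pi * y)) *
      (\<integral>\<^sup>+x\<in>{0<..<1}. ennreal (cmod (f (z + of_real \<rho> * exp (2 * of_real pi * \<i> * of_real x)))) \<partial>lborel)"
      by (intro mult_left_mono holomorphic_circle_mean_le[OF f \<rho>]) auto
    also have "(\<integral>\<^sup>+x\<in>{0<..<1}. ennreal (cmod (f (z + of_real \<rho> * exp (2 * of_real pi * \<i> * of_real x)))) \<partial>lborel)
      = (\<integral>\<^sup>+x\<in>{0<..<1}. ennreal (cmod (F (p (Complex x y)))) \<partial>lborel)"
      using \<rho> by (intro nn_integral_cong) (auto simp: F_def pe dist_norm norm_mult)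
    also have "ennreal (4 * pi\<^sup>2 * exp (- 4 * pi * y)) * \<dots> = 
      (\<integral>\<^sup>+x. ennreal (4 * pi\<^sup>2 * exp (- 4 * pi * y)) * (ennreal (cmod (F (p (Complex x y)))) * indicator {0<..<1} x) \<partial>lborel)"
      by (rule nn_integral_cmult[symmetric]) (unfold pe, measurable)
    also have "\<dots> = (\<integral>\<^sup>+x. ennreal (cmod (F (p (Complex x y))) * (cmod (deriv p (Complex x y)))\<^sup>2) * indicator B (Complex x y) \<partial>lborel)"
      unfolding nd using y
      by (intro nn_integral_cong) (auto simp: B_def T_def indicator_def ennreal_mult' mult.commute split: if_splits)
    finally show ?thesis .
  qed
  have "((\<lambda>y. - (pi * exp (- 4 * pi * y))) \<longlongrightarrow> - (pi * 0)) at_top"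
  proof (intro tendsto_minus tendsto_mult tendsto_const filterlim_compose[OF exp_at_bot])
    show "filterlim (\<lambda>y. - 4 * pi * y) at_bot at_top"
      by (rule filterlim_tendsto_neg_mult_at_bot[OF tendsto_const]) (auto simp: filterlim_ident)
  qed
  then have lim: "((\<lambda>y. - (pi * exp (- 4 * pi * y))) \<longlongrightarrow> 0) at_top" by simp
  have "(\<integral>\<^sup>+y. ennreal (4 * pi\<^sup>2 * exp (- 4 * pi * y)) * indicator {a..} y \<partial>lborel) =
      0 - (- (pi * exp (- 4 * pi * a)))"
    by (rule nn_integral_FTC_atLeast[OF _ _ _ lim])
       (auto intro!: derivative_eq_intros simp: power2_eq_square)
  also have "exp (- 4 * pi * a) = r\<^sup>2"
  proof -
    have "- 4 * pi * a = 2 * ln r" by (simp add: a_def)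
    then have "exp (- 4 * pi * a) = exp (2 * ln r)" by (rule arg_cong)
    then show ?thesis using r by (simp only: exp_double exp_ln)
  qed
  finally have int: "(\<integral>\<^sup>+y. ennreal (4 * pi\<^sup>2 * exp (- 4 * pi * y)) * indicator {a..} y \<partial>lborel) = ennreal (pi * r\<^sup>2)"
    by simp
  have [measurable]: "p \<in> borel_measurable borel" unfolding p_def by measurable
  have [measurable]: "deriv p \<in> borel_measurable borel" unfolding dp[abs_def] by measurable
  have [measurable]: "B \<in> sets borel" by fact
  have "ennreal (pi * r\<^sup>2 * cmod (f z)) = (\<integral>\<^sup>+y. ennreal (4 * pi\<^sup>2 * exp (- 4 * pi * y)) * indicator {a..} y \<partial>lborel) * ennreal (cmod (f z))"
    unfolding int by (simp add: ennreal_mult')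
  also have "\<dots> = (\<integral>\<^sup>+y. ennreal (4 * pi\<^sup>2 * exp (- 4 * pi * y)) * indicator {a..} y * ennreal (cmod (f z)) \<partial>lborel)"
    by (rule nn_integral_multc[symmetric]) measurable
  also have "\<dots> \<le> (\<integral>\<^sup>+y. \<integral>\<^sup>+x. ennreal (cmod (F (p (Complex x y))) * (cmod (deriv p (Complex x y)))\<^sup>2) * indicator B (Complex x y) \<partial>lborel \<partial>lborel)"
  proof (rule nn_integral_mono_AE, rule eventually_mono[OF AE_lborel_singleton[of a]])
    fix y assume "y \<noteq> a"
    then show "ennreal (4 * pi\<^sup>2 * exp (- 4 * pi * y)) * indicator {a..} y * ennreal (cmod (f z)) \<le>
       (\<integral>\<^sup>+x. ennreal (cmod (F (p (Complex x y))) * (cmod (deriv p (Complex x y)))\<^sup>2) * indicator B (Complex x y) \<partial>lborel)"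
      using inner[of y] by (cases "a < y") auto
  qed
  also have "\<dots> = (\<integral>\<^sup>+\<zeta>\<in>B. ennreal (cmod (F (p \<zeta>)) * (cmod (deriv p \<zeta>))\<^sup>2) \<partial>lborel)"
    by (rule nn_integral_lborel_complex[symmetric]) measurable
  also have "\<dots> = (\<integral>\<^sup>+\<zeta>\<in>B. ennreal (cmod (F (p \<zeta>))) * ennreal ((cmod (deriv p \<zeta>))\<^sup>2) \<partial>lborel)"
    by (simp add: ennreal_mult)
  also have "\<dots> = (\<integral>\<^sup>+w\<in>p ` B. ennreal (cmod (F w)) \<partial>lborel)"
    by (rule nn_integral_holomorphic_image[OF p opT inj Bb, symmetric]) measurable
  also have "\<dots> \<le> (\<integral>\<^sup>+w\<in>ball z r. ennreal (cmod (f w)) \<partial>lborel)"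
    using sub by (intro nn_integral_mono) (auto simp: F_def indicator_def)
  finally show ?thesis .
qed

text \<open>Powers of a holomorphic function are holomorphic. Exponents 1 and 2 yield the L^1 and
  L^2 versions of every later pointwise estimate.\<close>

corollary holomorphic_power_area_mean_le:
  assumes f: "f holomorphic_on ball z r" and r: "0 < r"
  shows "ennreal (pi * r\<^sup>2 * cmod (f z) ^ k) \<le> (\<integral>\<^sup>+w\<in>ball z r. ennreal (cmod (f w) ^ k) \<partial>lborel)"
  using holomorphic_area_mean_le[of "\<lambda>w. f w ^ k" z r] assms
  by (simp add: norm_power holomorphic_intros)

subsection \<open>Moebius transformations and fundamental sets\<close>

lemma uhp_denom_nonzero:
  assumes "(a, b, c, d) \<in> SL2" "z \<in> uhp"
  shows "of_real c * z + of_real d \<noteq> (0 :: complex)"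
proof
  assume eq: "of_real c * z + of_real d = (0 :: complex)"
  have "Im (of_real c * z + of_real d) = c * Im z" by simp
  with eq assms have "c = 0" by (auto simp: uhp_def)
  with eq have "d = 0" by simp
  with \<open>c = 0\<close> assms show False by (simp add: SL2_def)
qed

lemma SL2_mat_mult: "g \<in> SL2 \<Longrightarrow> h \<in> SL2 \<Longrightarrow> mat_mult g h \<in> SL2"
proof (cases g; cases h)
  fix a b c d a' b' c' d'
  assume *: "g \<in> SL2" "h \<in> SL2" "g = (a, b, c, d)" "h = (a', b', c', d')"
  have "(a * a' + b * c') * (c * b' + d * d') - (a * b' + b * d') * (c * a' + d * c') =
      (a * d - b * c) * (a' * d' - b' * c')" by algebra
  with * show "mat_mult g h \<in> SL2" by (simp add: SL2_def)
qed

lemma SL2_mat_inv: "g \<in> SL2 \<Longrightarrow> mat_inv g \<in> SL2"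
  by (cases g; simp add: SL2_def algebra_simps)

lemma SL2_mat_id: "mat_id \<in> SL2"
  by (simp add: SL2_def mat_id_def)

lemma mat_mult_assoc: "mat_mult (mat_mult f g) h = mat_mult f (mat_mult g h)"
  by (cases f; cases g; cases h; simp add: algebra_simps)

lemma mat_mult_id [simp]: "mat_mult mat_id g = g" "mat_mult g mat_id = g"
  by (cases g; simp add: mat_id_def)+

lemma mat_mult_inv:
  assumes "g \<in> SL2"
  shows "mat_mult (mat_inv g) g = mat_id" "mat_mult g (mat_inv g) = mat_id"
  using assms by (cases g; simp add: mat_id_def SL2_def algebra_simps)+

lemma mat_inv_mat_inv [simp]: "mat_inv (mat_inv g) = g"
  by (cases g; simp)

lemma mat_inv_mult: "mat_inv (mat_mult g h) = mat_mult (mat_inv h) (mat_inv g)"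
  by (cases g; cases h; simp add: algebra_simps)

lemma tr_mat_mult_commute: "tr (mat_mult g h) = tr (mat_mult h g)"
  by (cases g; cases h; simp add: algebra_simps)

lemma mob_id [simp]: "mob mat_id z = z"
  by (simp add: mat_id_def)

lemma Im_mob:
  assumes "g \<in> SL2" "z \<in> uhp"
  shows "Im (mob g z) = Im z * cmod (mob_deriv g z)"
proof -
  obtain a b c d where g: "g = (a, b, c, d)" by (cases g)
  have det: "a * d - b * c = 1" using assms g by (simp add: SL2_def)
  have "Im (mob g z) = ((a * Im z) * (c * Re z + d) - (a * Re z + b) * (c * Im z)) / ((c * Re z + d)\<^sup>2 + (c * Im z)\<^sup>2)"
    by (simp add: g Im_divide)
  also have "(a * Im z) * (c * Re z + d) - (a * Re z + b) * (c * Im z) = Im z * (a * d - b * c)"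
    by (simp add: algebra_simps)
  also have "(c * Re z + d)\<^sup>2 + (c * Im z)\<^sup>2 = (cmod (of_real c * z + of_real d))\<^sup>2"
    by (simp add: cmod_power2)
  finally show ?thesis by (simp add: g det norm_divide norm_power)
qed

lemma mob_deriv_nonzero:
  assumes "g \<in> SL2" "z \<in> uhp" shows "mob_deriv g z \<noteq> 0"
  using assms uhp_denom_nonzero by (cases g) auto

lemma mob_uhp:
  assumes "g \<in> SL2" "z \<in> uhp" shows "mob g z \<in> uhp"
  using assms Im_mob[OF assms] mob_deriv_nonzero[OF assms] by (simp add: uhp_def)

lemma mob_mat_mult:
  assumes "h \<in> SL2" "z \<in> uhp"
  shows "mob (mat_mult g h) z = mob g (mob h z)"
proof -
  obtain a b c d where h: "h = (a, b, c, d)" by (cases h)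
  obtain a' b' c' d' where g: "g = (a', b', c', d')" by (cases g)
  have nz: "of_real c * z + of_real d \<noteq> 0" using uhp_denom_nonzero assms h by blast
  have *: "(A * (N / D) + B) / (C * (N / D) + E) = (A * N + B * D) / (C * N + E * D)"
    if "D \<noteq> 0" for A B C N D E :: complex
  proof -
    have "(A * (N / D) + B) = (A * N + B * D) / D" "(C * (N / D) + E) = (C * N + E * D) / D"
      using that by (simp_all add: field_simps)
    then show ?thesis using that by simp
  qed
  show ?thesis
    unfolding g h mob.simps mat_mult.simps *[OF nz] by (simp add: algebra_simps)
qed

lemma mob_mat_inv:
  assumes "g \<in> SL2" "z \<in> uhp"
  shows "mob (mat_inv g) (mob g z) = z" "mob g (mob (mat_inv g) z) = z"
  using assms by (metis mat_mult_inv mob_id mob_mat_mult SL2_mat_inv)+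

lemma mob_has_field_derivative:
  assumes "g \<in> SL2" "z \<in> uhp"
  shows "(mob g has_field_derivative mob_deriv g z) (at z)"
proof -
  obtain a b c d where g: "g = (a, b, c, d)" by (cases g)
  have nz: "of_real c * z + of_real d \<noteq> 0" using uhp_denom_nonzero assms g by blast
  have det: "complex_of_real a * of_real d - of_real b * of_real c = 1"
    using assms g by (simp add: SL2_def flip: of_real_mult of_real_diff)
  have "((\<lambda>z. (of_real a * z + of_real b) / (of_real c * z + of_real d)) has_field_derivative
      (of_real a * (of_real c * z + of_real d) - (of_real a * z + of_real b) * of_real c) /
      ((of_real c * z + of_real d) * (of_real c * z + of_real d))) (at z)"
    using nz by (auto intro!: derivative_eq_intros)
  also have "of_real a * (of_real c * z + of_real d) - (of_real a * z + of_real b) * of_real c = (1::complex)"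
    using det by (simp add: algebra_simps)
  finally have *: "((\<lambda>z. (of_real a * z + of_real b) / (of_real c * z + of_real d)) has_field_derivative
      mob_deriv g z) (at z)"
    by (simp add: g power2_eq_square)
  have "mob g = (\<lambda>z. (of_real a * z + of_real b) / (of_real c * z + of_real d))"
    by (simp add: g fun_eq_iff)
  with * show ?thesis by simp
qed

lemma deriv_mob: "g \<in> SL2 \<Longrightarrow> z \<in> uhp \<Longrightarrow> deriv (mob g) z = mob_deriv g z"
  using mob_has_field_derivative DERIV_imp_deriv by blast

lemma holomorphic_mob: "g \<in> SL2 \<Longrightarrow> mob g holomorphic_on uhp"
  by (meson field_differentiable_at_within field_differentiable_def holomorphic_onI mob_has_field_derivative)

lemma open_uhp: "open uhp"
  unfolding uhp_def by (intro open_Collect_less continuous_intros)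

lemma inj_on_mob: "g \<in> SL2 \<Longrightarrow> inj_on (mob g) uhp"
  by (metis inj_onI mob_mat_inv(1))

lemma measurable_mob [measurable]: "mob g \<in> borel_measurable borel"
proof -
  obtain a b c d where g: "g = (a, b, c, d)" by (cases g)
  have "(\<lambda>z::complex. (of_real a * z + of_real b) / (of_real c * z + of_real d)) \<in> borel_measurable borel"
    by measurable
  moreover have "mob g = (\<lambda>z. (of_real a * z + of_real b) / (of_real c * z + of_real d))"
    by (simp add: g fun_eq_iff)
  ultimately show ?thesis by simp
qed

text \<open>Equals \<open>4 sinh\<^sup>2 (\<rho>/2)\<close> for the hyperbolic distance \<open>\<rho>\<close> between \<open>z\<close> and \<open>w\<close>.\<close>

definition dsq :: "complex \<Rightarrow> complex \<Rightarrow> real" where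
  "dsq z w = (cmod (z - w))\<^sup>2 / (Im z * Im w)"

lemma dsq_mob:
  assumes "g \<in> SL2" "z \<in> uhp" "w \<in> uhp"
  shows "dsq (mob g z) (mob g w) = dsq z w"
proof -
  obtain a b c d where g: "g = (a, b, c, d)" by (cases g)
  have nz: "of_real c * z + of_real d \<noteq> 0" "of_real c * w + of_real d \<noteq> 0"
    using uhp_denom_nonzero assms g by blast+
  have det: "complex_of_real a * of_real d - of_real b * of_real c = 1"
    using assms g by (simp add: SL2_def flip: of_real_mult of_real_diff)
  have "mob g z - mob g w = (complex_of_real a * of_real d - of_real b * of_real c) * (z - w) /
      ((of_real c * z + of_real d) * (of_real c * w + of_real d))"
    using nz by (simp add: g divide_simps) (simp add: algebra_simps)
  then have "(cmod (mob g z - mob g w))\<^sup>2 = (cmod (z - w))\<^sup>2 * cmod (mob_deriv g z) * cmod (mob_deriv g w)"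
    by (simp add: det g norm_divide norm_mult norm_power power_divide power_mult_distrib)
  then show ?thesis
    using mob_deriv_nonzero[OF assms(1,2)] mob_deriv_nonzero[OF assms(1,3)] assms(2,3)
    by (simp add: dsq_def Im_mob assms uhp_def field_simps)
qed

lemma dsq_commute: "dsq z w = dsq w z"
  by (simp add: dsq_def norm_minus_commute mult.commute)

section \<open>Discrete groups and integration of invariant functions over fundamental sets\<close>

lemma fuchsianD:
  assumes "fuchsian G"
  shows "g \<in> G \<Longrightarrow> g \<in> SL2" "mat_id \<in> G" "g \<in> G \<Longrightarrow> h \<in> G \<Longrightarrow> mat_mult g h \<in> G"
    "g \<in> G \<Longrightarrow> mat_inv g \<in> G" "finite {g\<in>G. mat_bound g \<le> R}"
  using assms by (auto simp: fuchsian_def)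

lemma fuchsian_countable:
  assumes "fuchsian G" shows "countable G"
proof -
  have "G = (\<Union>n::nat. {g\<in>G. mat_bound g \<le> real n})"
    using real_arch_simple by blast
  also have "countable \<dots>"
    using fuchsianD(5)[OF assms] by (intro countable_UN) (simp_all add: countable_finite)
  finally show ?thesis .
qed

lemma nn_integral_mob_image:
  assumes g: "g \<in> SL2" and B: "B \<in> sets borel" "B \<subseteq> uhp"
    and \<kappa>: "\<kappa> \<in> borel_measurable borel" "\<And>z. z \<in> uhp \<Longrightarrow> \<kappa> (mob g z) = \<kappa> z"
  shows "hyp_integral \<kappa> (mob g ` B) = hyp_integral \<kappa> B"
proof -
  have [measurable]: "\<kappa> \<in> borel_measurable borel" by fact
  have "hyp_integral \<kappa> (mob g ` B) =
     (\<integral>\<^sup>+z\<in>B. \<kappa> (mob g z) * ennreal (1 / (Im (mob g z))\<^sup>2) * ennreal ((cmod (deriv (mob g) z))\<^sup>2) \<partial>lborel)"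
    by (rule nn_integral_holomorphic_image[OF holomorphic_mob[OF g] open_uhp inj_on_mob[OF g] B]) measurable
  also have "\<dots> = hyp_integral \<kappa> B"
  proof (rule nn_integral_cong)
    fix z
    have "ennreal (1 / (Im (mob g z))\<^sup>2) * ennreal ((cmod (deriv (mob g) z))\<^sup>2) = ennreal (1 / (Im z)\<^sup>2)" if "z \<in> B"
    proof -
      have z: "z \<in> uhp" using that B by auto
      show ?thesis using mob_deriv_nonzero[OF g z] z
        by (simp add: Im_mob[OF g z] deriv_mob[OF g z] uhp_def power_mult_distrib flip: ennreal_mult)
    qed
    then show "\<kappa> (mob g z) * ennreal (1 / (Im (mob g z))\<^sup>2) * ennreal ((cmod (deriv (mob g) z))\<^sup>2) * indicator B z =
        \<kappa> z * ennreal (1 / (Im z)\<^sup>2) * indicator B z"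
      using B \<kappa>(2)[of z] by (cases "z \<in> B") (auto simp: mult.assoc)
  qed
  finally show ?thesis .
qed

text \<open>\<open>S\<close> is cut into countably many Borel pieces, each carried into
  \<open>F\<close> by a single group element; invariance of the hyperbolic measure preserves the
  integral of each piece. The hypothesis on \<open>S\<close> asks for \<open>mob g z = z\<close>
  rather than for a trivial \<open>g\<close>, because -1 may lie in \<open>G\<close> and acts as the
  identity.\<close>

lemma nn_integral_le_fundamental_set:
  assumes G: "fuchsian G" and F: "fundamental_set G F"
    and \<kappa>: "\<kappa> \<in> borel_measurable borel" "\<And>g z. g \<in> G \<Longrightarrow> z \<in> uhp \<Longrightarrow> \<kappa> (mob g z) = \<kappa> z"
    and S: "S \<in> sets borel" "S \<subseteq> uhp"
    and inj: "\<And>z g. z \<in> S \<Longrightarrow> g \<in> G \<Longrightarrow> mob g z \<in> S \<Longrightarrow> mob g z = z"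
  shows "hyp_integral \<kappa> S \<le> hyp_integral \<kappa> F"
proof -
  have [measurable]: "\<kappa> \<in> borel_measurable borel" "S \<in> sets borel" by fact+
  have [measurable]: "F \<in> sets borel" using F by (simp add: fundamental_set_def)
  note GD = fuchsianD[OF G]
  define e where "e = from_nat_into G"
  have rng: "range e = G"
    unfolding e_def by (rule range_from_nat_into[OF _ fuchsian_countable[OF G]]) (use GD in auto)
  then have eG: "e i \<in> G" for i by auto
  define A where "A i = S \<inter> mob (e i) -` F" for i
  have A [measurable]: "A i \<in> sets borel" for i
    unfolding A_def by (intro sets.Int S measurable_sets_borel[OF measurable_mob]) simp
  define D where "D = disjointed A"
  have rD: "range D \<subseteq> sets borel" unfolding D_def
    by (rule sets.range_disjointed_sets) (use A in auto)
  have DA: "D i \<subseteq> A i" for i unfolding D_def by (rule disjointed_subset)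
  have UD: "(\<Union>i. D i) = S"
  proof -
    have "(\<Union>i. D i) = (\<Union>i. A i)" unfolding D_def by (rule UN_disjointed_eq)
    also have "\<dots> = S"
    proof (intro equalityI subsetI)
      fix z assume z: "z \<in> S"
      then have "z \<in> uhp" using S by auto
      then have "\<exists>w\<in>F. \<exists>g\<in>G. mob g z = w" using F unfolding fundamental_set_def by blast
      then obtain g where "g \<in> G" "mob g z \<in> F" by blast
      moreover from this obtain i where "g = e i" using rng by (metis imageE)
      ultimately show "z \<in> (\<Union>i. A i)" using z by (auto simp: A_def)
    qed (auto simp: A_def)
    finally show ?thesis .
  qed
  define \<nu> where "\<nu> = density lborel (\<lambda>z. \<kappa> z * ennreal (1 / (Im z)\<^sup>2))"
  have em: "emeasure \<nu> B = hyp_integral \<kappa> B" if "B \<in> sets borel" for B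
    unfolding \<nu>_def by (rule emeasure_density) (use that in auto)
  have s\<nu>: "sets \<nu> = sets borel" by (simp add: \<nu>_def)
  define E where "E i = mob (e i) ` D i" for i
  have Du: "D i \<subseteq> uhp" for i using DA[of i] S by (auto simp: A_def)
  have Db: "D i \<in> sets borel" for i using rD by auto
  have Eb: "E i \<in> sets borel" for i unfolding E_def
    by (rule borel_image_holomorphic_inj[OF holomorphic_mob open_uhp inj_on_mob Db Du]) (auto simp: eG GD)
  have "E i \<subseteq> F" for i using DA[of i] by (auto simp: E_def A_def)
  then have EF: "(\<Union>i. E i) \<subseteq> F" by blast
  \<comment> \<open>If two moved pieces met, they would contain images of orbit-equivalent points of
    \<open>S\<close>. These points coincide by injectivity, although the pieces \<open>D\<close> are
    disjoint.\<close>
  have Ed: "disjoint_family E"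
    unfolding disjoint_family_on_def
  proof (intro ballI impI, rule ccontr)
    fix i j :: nat assume ij: "i \<noteq> j" and "E i \<inter> E j \<noteq> {}"
    then obtain z w where zw: "z \<in> D i" "w \<in> D j" "mob (e i) z = mob (e j) w"
      unfolding E_def by auto
    have u: "z \<in> uhp" "w \<in> uhp" using zw Du by auto
    have "w = mob (mat_inv (e j)) (mob (e i) z)" 
      unfolding zw(3) by (rule mob_mat_inv(1)[OF GD(1)[OF eG] u(2), symmetric])
    then have w: "w = mob (mat_mult (mat_inv (e j)) (e i)) z"
      by (simp only: mob_mat_mult[OF GD(1)[OF eG] u(1)])
    have "z \<in> A i" "w \<in> A j" using zw DA by blast+
    then have "z \<in> S" "w \<in> S" by (simp_all add: A_def)
    with inj[of z "mat_mult (mat_inv (e j)) (e i)"] w have "w = z" 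
      using GD(3)[OF GD(4)[OF eG] eG] by simp
    moreover have "D i \<inter> D j = {}" using ij unfolding D_def
      by (meson disjoint_family_disjointed disjoint_family_onD UNIV_I)
    ultimately show False using zw by auto
  qed
  have "hyp_integral \<kappa> S = emeasure \<nu> (\<Union>i. D i)"
    using em[OF S(1)] UD by simp
  also have "\<dots> = (\<Sum>i. emeasure \<nu> (D i))"
    by (rule suminf_emeasure[symmetric]) (use rD s\<nu> in \<open>auto simp: D_def disjoint_family_disjointed\<close>)
  also have "\<dots> = (\<Sum>i. emeasure \<nu> (E i))"
  proof (rule arg_cong[where f = suminf], rule ext)
    fix i
    show "emeasure \<nu> (D i) = emeasure \<nu> (E i)"
      unfolding em[OF Db] em[OF Eb] unfolding E_def
      by (rule nn_integral_mob_image[OF GD(1)[OF eG] Db Du \<kappa>(1) \<kappa>(2)[OF eG], symmetric])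
  qed
  also have "\<dots> = emeasure \<nu> (\<Union>i. E i)"
    by (rule suminf_emeasure) (use Eb s\<nu> Ed in auto)
  also have "\<dots> \<le> emeasure \<nu> F"
    by (rule emeasure_mono[OF EF]) (simp add: s\<nu>)
  also have "\<dots> = hyp_integral \<kappa> F" by (rule em) simp
  finally show ?thesis .
qed

text \<open>The hypothesis on \<open>\<tau>\<close> says that the hyperbolic metric pulls back to
  |d\<zeta>|/\<tau>(\<zeta>), so the area density in the chart is 1/\<tau>^2. An integral over a
  region that embeds in the quotient is then at most the integral over \<open>F\<close>.\<close>

lemma nn_integral_chart_le:
  assumes G: "fuchsian G" and F: "fundamental_set G F"
    and \<kappa>: "\<kappa> \<in> borel_measurable borel" "\<And>g z. g \<in> G \<Longrightarrow> z \<in> uhp \<Longrightarrow> \<kappa> (mob g z) = \<kappa> z"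
    and p: "p holomorphic_on T" "open T" "inj_on p T" "p ` T \<subseteq> uhp"
    and \<tau>: "\<And>\<zeta>. \<zeta> \<in> T \<Longrightarrow> Im (p \<zeta>) = \<tau> \<zeta> * cmod (deriv p \<zeta>)"
    and R: "R \<in> sets borel" "R \<subseteq> T"
    and inj: "\<And>\<zeta> \<zeta>' g. \<zeta> \<in> R \<Longrightarrow> \<zeta>' \<in> R \<Longrightarrow> g \<in> G \<Longrightarrow> mob g (p \<zeta>) = p \<zeta>' \<Longrightarrow> \<zeta> = \<zeta>'"
  shows "(\<integral>\<^sup>+\<zeta>\<in>R. \<kappa> (p \<zeta>) * ennreal (1 / (\<tau> \<zeta>)\<^sup>2) \<partial>lborel) \<le> hyp_integral \<kappa> F"
proof -
  have [measurable]: "\<kappa> \<in> borel_measurable borel" by fact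
  have "(\<integral>\<^sup>+\<zeta>\<in>R. \<kappa> (p \<zeta>) * ennreal (1 / (\<tau> \<zeta>)\<^sup>2) \<partial>lborel) =
     (\<integral>\<^sup>+\<zeta>\<in>R. \<kappa> (p \<zeta>) * ennreal (1 / (Im (p \<zeta>))\<^sup>2) * ennreal ((cmod (deriv p \<zeta>))\<^sup>2) \<partial>lborel)"
  proof (rule nn_integral_cong)
    fix \<zeta>
    have "ennreal (1 / (\<tau> \<zeta>)\<^sup>2) = ennreal (1 / (Im (p \<zeta>))\<^sup>2) * ennreal ((cmod (deriv p \<zeta>))\<^sup>2)" if "\<zeta> \<in> R"
    proof -
      have "\<zeta> \<in> T" using that R by auto
      then have "Im (p \<zeta>) > 0" using p(4) by (auto simp: uhp_def)
      then have "deriv p \<zeta> \<noteq> 0" using \<tau>[OF \<open>\<zeta> \<in> T\<close>] by auto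
      then show ?thesis using \<tau>[OF \<open>\<zeta> \<in> T\<close>] by (simp add: power_mult_distrib flip: ennreal_mult)
    qed
    then show "\<kappa> (p \<zeta>) * ennreal (1 / (\<tau> \<zeta>)\<^sup>2) * indicator R \<zeta> =
      \<kappa> (p \<zeta>) * ennreal (1 / (Im (p \<zeta>))\<^sup>2) * ennreal ((cmod (deriv p \<zeta>))\<^sup>2) * indicator R \<zeta>"
      by (cases "\<zeta> \<in> R") (auto simp: mult.assoc)
  qed
  also have "\<dots> = hyp_integral \<kappa> (p ` R)"
    by (rule nn_integral_holomorphic_image[OF p(1-3) R, symmetric]) measurable
  also have "\<dots> \<le> hyp_integral \<kappa> F"
  proof (rule nn_integral_le_fundamental_set[OF G F \<kappa> borel_image_holomorphic_inj[OF p(1-3) R]])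
    show "p ` R \<subseteq> uhp" using p(4) R by blast
    fix z g assume "z \<in> p ` R" and g: "g \<in> G" and "mob g z \<in> p ` R"
    then obtain \<zeta> \<zeta>' where \<zeta>: "\<zeta> \<in> R" "z = p \<zeta>" "\<zeta>' \<in> R" "mob g z = p \<zeta>'" by blast
    then have "\<zeta> = \<zeta>'" using inj g by blast
    then show "mob g z = z" using \<zeta> by simp
  qed
  finally show ?thesis .
qed

subsection \<open>Periodic holomorphic functions on strips\<close>

text \<open>The mean value property on the disc of radius \<tau>0/4 about \<open>\<xi>\<close>,
  which is covered by at most \<tau>0/t period boxes with integral at most \<open>L\<close> each;
  this is the origin of the factor \<open>\<tau>0 / t\<close>. On the disc \<tau> is at least
  \<tau>0/2, which costs \<open>4 ^ j\<close>, and the 6 is an upper bound for 16/pi.\<close>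

lemma strip_pointwise_bound:
  fixes f :: "complex \<Rightarrow> complex" and \<tau> :: "real \<Rightarrow> real"
  assumes f: "f holomorphic_on {\<zeta>. Im \<zeta> \<in> I}" and I: "open I"
    and \<tau>: "\<tau> \<in> borel_measurable borel"
    and L: "0 \<le> L" "\<And>x. (\<integral>\<^sup>+\<zeta>\<in>(period_box x t I).
        ennreal ((cmod (f \<zeta>) * (\<tau> (Im \<zeta>))\<^sup>2) ^ Suc j) * ennreal (1 / (\<tau> (Im \<zeta>))\<^sup>2) \<partial>lborel) \<le> ennreal L"
    and t: "0 < t" "t \<le> \<tau>0 / 2"
    and near: "\<And>y. \<bar>y - y0\<bar> < \<tau>0 / 2 \<Longrightarrow> y \<in> I \<and> \<tau>0 / 2 \<le> \<tau> y"
    and \<xi>: "\<bar>Im \<xi> - y0\<bar> \<le> \<tau>0 / 4"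
  shows "(cmod (f \<xi>) * \<tau>0\<^sup>2) ^ Suc j \<le> 6 * 4 ^ j * (\<tau>0 / t) * L"
proof -
  have \<tau>0: "\<tau>0 > 0" using t by linarith
  define V where "V = {\<zeta>. Im \<zeta> \<in> I}"
  define F where "F w = (if w \<in> V then f w else 0)" for w
  have opV: "open V" unfolding V_def by (rule open_strip[OF I])
  have [measurable]: "F \<in> borel_measurable borel" unfolding F_def
    by (rule borel_measurable_holomorphic_extension[OF f[folded V_def] opV])
  have [measurable]: "\<tau> \<in> borel_measurable borel" "I \<in> sets borel" using \<tau> I by auto
  \<comment> \<open>The disc has width \<tau>0/2, hence this number of boxes. Rounding up adds at
    most 1, and 1 \<le> \<tau>0/(2t) by the assumption on \<open>t\<close>.\<close>
  define N where "N = nat \<lceil>\<tau>0 / (2 * t)\<rceil>"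
  have "\<tau>0 / (2 * t) \<le> real N" using t \<tau>0 by (simp add: N_def)
  then have N1: "\<tau>0 / 2 \<le> real N * t" using t by (simp add: field_simps)
  have "real N \<le> \<tau>0 / (2 * t) + 1" using t \<tau>0 by (simp add: N_def)
  also have "1 \<le> \<tau>0 / (2 * t)" using t by (simp add: field_simps)
  finally have N2: "real N \<le> \<tau>0 / t" by simp
  define R where "R x = period_box x t I" for x
  have Rm [measurable]: "R x \<in> sets borel" for x unfolding R_def by measurable
  define X where "X i = Re \<xi> - \<tau>0 / 4 + real i * t" for i :: nat
  define H where "H w = ennreal ((cmod (F w) * (\<tau> (Im w))\<^sup>2) ^ Suc j) * ennreal (1 / (\<tau> (Im w))\<^sup>2)" for w
  have [measurable]: "H \<in> borel_measurable borel" unfolding H_def by measurable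
  have ballV: "w \<in> V \<and> \<tau>0 / 2 \<le> \<tau> (Im w)" if "w \<in> ball \<xi> (\<tau>0 / 4)" for w
  proof -
    have "\<bar>Im \<xi> - Im w\<bar> < \<tau>0 / 4" using that abs_Im_le_cmod[of "\<xi> - w"] by (simp add: dist_norm)
    moreover have "\<bar>Im w - y0\<bar> \<le> \<bar>Im \<xi> - Im w\<bar> + \<bar>Im \<xi> - y0\<bar>" by arith
    ultimately have "\<bar>Im w - y0\<bar> < \<tau>0 / 2" using \<xi> by linarith
    then show ?thesis using near by (simp add: V_def)
  qed
  have cover: "\<exists>i<N. w \<in> R (X i)" if "w \<in> ball \<xi> (\<tau>0 / 4)" for w
  proof -
    have "\<bar>Re \<xi> - Re w\<bar> < \<tau>0 / 4" using that abs_Re_le_cmod[of "\<xi> - w"] by (simp add: dist_norm)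
    then have 1: "Re \<xi> - \<tau>0 / 4 < Re w" "Re w < Re \<xi> + \<tau>0 / 4" by linarith+
    define u where "u = (Re w - (Re \<xi> - \<tau>0 / 4)) / t"
    have u0: "0 \<le> u" using 1 t by (auto simp: u_def intro!: divide_nonneg_pos)
    have "Re w - (Re \<xi> - \<tau>0 / 4) < real N * t" using 1 N1 by linarith
    then have uN: "u < real N" using t by (simp add: u_def field_simps)
    define i where "i = nat \<lfloor>u\<rfloor>"
    have i: "real i \<le> u" "u < real i + 1" using u0 by (simp_all add: i_def)
    then have "i < N" using uN by linarith
    have "real i * t \<le> u * t" "u * t < (real i + 1) * t" using i t by auto
    moreover have "u * t = Re w - (Re \<xi> - \<tau>0 / 4)" using t by (simp add: u_def)
    ultimately have "X i \<le> Re w \<and> Re w < X i + t" by (simp add: X_def algebra_simps)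
    with \<open>i < N\<close> show ?thesis using ballV[OF that] by (auto simp: R_def V_def)
  qed
  have pt: "ennreal (cmod (f w) ^ Suc j) * indicator (ball \<xi> (\<tau>0 / 4)) w \<le>
      ennreal ((4 / \<tau>0\<^sup>2) ^ j) * (\<Sum>i<N. H w * indicator (R (X i)) w)" for w
  proof (cases "w \<in> ball \<xi> (\<tau>0 / 4)")
    case True
    obtain i where i: "i < N" "w \<in> R (X i)" using cover True by blast
    define s where "s = \<tau> (Im w)"
    have s: "\<tau>0 / 2 \<le> s" "w \<in> V" using ballV[OF True] by (auto simp: s_def)
    have "(cmod (f w) * s\<^sup>2) ^ Suc j * (1 / s\<^sup>2) = cmod (f w) ^ Suc j * (s\<^sup>2) ^ j"
      using s \<tau>0 by (simp add: power_mult_distrib)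
    moreover have "(\<tau>0 / 2)\<^sup>2 ^ j \<le> (s\<^sup>2) ^ j" using s \<tau>0 by (intro power_mono) auto
    then have "1 \<le> (4 / \<tau>0\<^sup>2) ^ j * (s\<^sup>2) ^ j" using \<tau>0
      by (simp add: power_divide field_simps)
    then have "cmod (f w) ^ Suc j * 1 \<le> cmod (f w) ^ Suc j * ((4 / \<tau>0\<^sup>2) ^ j * (s\<^sup>2) ^ j)"
      by (intro mult_left_mono) auto
    then have "cmod (f w) ^ Suc j \<le> (4 / \<tau>0\<^sup>2) ^ j * (cmod (f w) ^ Suc j * (s\<^sup>2) ^ j)"
      by (simp only: mult_ac mult_1_right mult_1_left)
    ultimately have "cmod (f w) ^ Suc j \<le> (4 / \<tau>0\<^sup>2) ^ j * ((cmod (f w) * s\<^sup>2) ^ Suc j * (1 / s\<^sup>2))"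
      by (simp only:)
    then have "ennreal (cmod (f w) ^ Suc j) \<le> ennreal ((4 / \<tau>0\<^sup>2) ^ j) * H w"
      unfolding H_def using s by (simp add: s_def F_def ennreal_leI flip: ennreal_mult)
    also have "H w \<le> (\<Sum>i<N. H w * indicator (R (X i)) w)"
      using member_le_sum[of i "{..<N}" "\<lambda>i. H w * indicator (R (X i)) w"] i by simp
    finally show ?thesis using True by (simp add: mult_left_mono)
  qed auto
  have "ennreal (pi * (\<tau>0 / 4)\<^sup>2 * cmod (f \<xi>) ^ Suc j) \<le> (\<integral>\<^sup>+w\<in>ball \<xi> (\<tau>0 / 4). ennreal (cmod (f w) ^ Suc j) \<partial>lborel)"
  proof (rule holomorphic_power_area_mean_le)
    show "f holomorphic_on ball \<xi> (\<tau>0 / 4)"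
      by (rule holomorphic_on_subset[OF f]) (use ballV in \<open>auto simp: V_def\<close>)
  qed (use \<tau>0 in auto)
  also have "\<dots> \<le> (\<integral>\<^sup>+w. ennreal ((4 / \<tau>0\<^sup>2) ^ j) * (\<Sum>i<N. H w * indicator (R (X i)) w) \<partial>lborel)"
    by (intro nn_integral_mono pt)
  also have "\<dots> = ennreal ((4 / \<tau>0\<^sup>2) ^ j) * (\<Sum>i<N. \<integral>\<^sup>+w\<in>R (X i). H w \<partial>lborel)"
    by (subst nn_integral_cmult, measurable, subst nn_integral_sum) auto
  also have "\<dots> \<le> ennreal ((4 / \<tau>0\<^sup>2) ^ j) * (\<Sum>i<N. ennreal L)"
  proof (intro mult_left_mono sum_mono)
    fix i
    have "(\<integral>\<^sup>+w\<in>R (X i). H w \<partial>lborel) = (\<integral>\<^sup>+\<zeta>\<in>(period_box (X i) t I).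
        ennreal ((cmod (f \<zeta>) * (\<tau> (Im \<zeta>))\<^sup>2) ^ Suc j) * ennreal (1 / (\<tau> (Im \<zeta>))\<^sup>2) \<partial>lborel)"
      by (intro nn_integral_cong) (auto simp: H_def F_def V_def R_def indicator_def)
    then show "(\<integral>\<^sup>+w\<in>R (X i). H w \<partial>lborel) \<le> ennreal L" using L(2)[of "X i"] by simp
  qed simp
  also have "\<dots> = ennreal ((4 / \<tau>0\<^sup>2) ^ j * (real N * L))"
    using L by (simp add: ennreal_mult ennreal_of_nat_eq_real_of_nat)
  finally have "pi * (\<tau>0 / 4)\<^sup>2 * cmod (f \<xi>) ^ Suc j \<le> (4 / \<tau>0\<^sup>2) ^ j * (real N * L)"
    using L by (subst (asm) ennreal_le_iff) auto
  also have "\<dots> \<le> (4 / \<tau>0\<^sup>2) ^ j * (\<tau>0 / t * L)"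
    using N2 L by (intro mult_left_mono mult_right_mono) auto
  finally have main: "pi * (\<tau>0 / 4)\<^sup>2 * cmod (f \<xi>) ^ Suc j \<le> (4 / \<tau>0\<^sup>2) ^ j * (\<tau>0 / t * L)" .
  have "(cmod (f \<xi>) * \<tau>0\<^sup>2) ^ Suc j = cmod (f \<xi>) ^ Suc j * (\<tau>0\<^sup>2 * (\<tau>0\<^sup>2) ^ j)"
    by (simp add: power_mult_distrib)
  also have "\<dots> = (16 / pi) * (\<tau>0\<^sup>2) ^ j * (pi * (\<tau>0 / 4)\<^sup>2 * cmod (f \<xi>) ^ Suc j)"
    by (simp add: power_divide)
  also have "\<dots> \<le> (16 / pi) * (\<tau>0\<^sup>2) ^ j * ((4 / \<tau>0\<^sup>2) ^ j * (\<tau>0 / t * L))"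
    by (intro mult_left_mono main) auto
  also have "\<dots> = (16 / pi) * (4 ^ j * (\<tau>0 / t * L))"
    using \<tau>0 by (simp add: power_divide)
  also have "\<dots> \<le> 6 * (4 ^ j * (\<tau>0 / t * L))"
    using L t \<tau>0 pi_gt3 by (intro mult_right_mono) (auto simp: field_simps)
  finally show ?thesis by (simp add: mult.assoc)
qed

text \<open>For a primitive \<Phi> of \<open>f\<close> on the convex strip, \<Phi>(\<zeta> + t) -
  \<Phi>(\<zeta>) has derivative f(\<zeta> + t) - f(\<zeta>) = 0. It is therefore constant, and it
  is the integral of \<open>f\<close> over a period from any starting point at any height.\<close>

lemma periodic_strip_mean:
  fixes f :: "complex \<Rightarrow> complex"
  assumes f: "f holomorphic_on {\<zeta>. Im \<zeta> \<in> I}" and I: "open I" "convex I"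
    and t: "0 < t" and per: "\<And>\<zeta>. Im \<zeta> \<in> I \<Longrightarrow> f (\<zeta> + of_real t) = f \<zeta>"
  obtains c where "\<And>x y. y \<in> I \<Longrightarrow> ((\<lambda>u. f (Complex u y)) has_integral of_real t * c) {x..x + t}"
proof -
  define V where "V = {\<zeta>. Im \<zeta> \<in> I}"
  have opV: "open V" unfolding V_def by (rule open_strip[OF I(1)])
  have cvV: "convex V"
  proof -
    have "V = Im -` I" by (auto simp: V_def)
    then show ?thesis using convex_linear_vimage[of Im I] I(2) bounded_linear_Im bounded_linear.linear by auto
  qed
  obtain \<Phi> where \<Phi>: "\<And>\<zeta>. \<zeta> \<in> V \<Longrightarrow> (\<Phi> has_field_derivative f \<zeta>) (at \<zeta>)"
    using holomorphic_convex_primitive'[OF cvV opV f[folded V_def]] opV by (metis at_within_open)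
  have shift: "\<zeta> + of_real t \<in> V" if "\<zeta> \<in> V" for \<zeta> using that by (simp add: V_def)
  define D where "D \<zeta> = \<Phi> (\<zeta> + of_real t) - \<Phi> \<zeta>" for \<zeta>
  have "(D has_field_derivative 0) (at \<zeta> within V)" if "\<zeta> \<in> V" for \<zeta>
  proof -
    have "(\<Phi> has_field_derivative f (\<zeta> + of_real t)) (at (\<zeta> + of_real t))" by (intro \<Phi> shift that)
    then have "((\<lambda>\<zeta>. \<Phi> (\<zeta> + of_real t)) has_field_derivative f (\<zeta> + of_real t)) (at \<zeta>)"
      by (simp add: DERIV_shift)
    from DERIV_diff[OF this \<Phi>[OF that]] show ?thesis
      using per that by (simp add: D_def[abs_def] V_def has_field_derivative_at_within)
  qed
  then obtain C where C: "\<And>\<zeta>. \<zeta> \<in> V \<Longrightarrow> D \<zeta> = C"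
    using has_field_derivative_zero_constant[OF cvV] by blast
  show ?thesis
  proof
    fix x y :: real assume y: "y \<in> I"
    have "((\<lambda>u. f (Complex u y)) has_integral \<Phi> (Complex (x + t) y) - \<Phi> (Complex x y)) {x..x + t}"
    proof (rule fundamental_theorem_of_calculus)
      fix u assume "u \<in> {x..x + t}"
      have "Complex u y \<in> V" using y by (simp add: V_def)
      then have 1: "(\<Phi> has_field_derivative f (Complex u y)) (at (Complex u y))" by (rule \<Phi>)
      have 2: "((\<lambda>u. Complex u y) has_vector_derivative 1) (at u within {x..x + t})"
        unfolding Complex_eq by (auto intro!: derivative_eq_intros)
      show "((\<lambda>u. \<Phi> (Complex u y)) has_vector_derivative f (Complex u y)) (at u within {x..x + t})"
        using field_vector_diff_chain_within[OF 2 has_field_derivative_at_within[OF 1]] by (simp add: o_def)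
    qed (use t in simp)
    also have "\<Phi> (Complex (x + t) y) - \<Phi> (Complex x y) = D (Complex x y)"
      by (simp add: D_def Complex_eq algebra_simps)
    also have "\<dots> = of_real t * (C / of_real t)" using C y t by (simp add: V_def)
    finally show "((\<lambda>u. f (Complex u y)) has_integral of_real t * (C / of_real t)) {x..x + t}" .
  qed
qed

text \<open>The difference c - f(\<zeta>) is the average of f(u) - f(\<zeta>) over one period. The
  bound \<open>A\<close> has to hold on a full horizontal band, since the derivative is estimated
  along the whole segment.\<close>

lemma periodic_strip_deviation:
  fixes f :: "complex \<Rightarrow> complex"
  assumes f: "f holomorphic_on {\<zeta>. Im \<zeta> \<in> I}" and t: "0 < t"
    and c: "((\<lambda>u. f (Complex u (Im \<zeta>))) has_integral of_real t * c) {Re \<zeta>..Re \<zeta> + t}"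
    and r: "0 < r" "\<And>y. \<bar>y - Im \<zeta>\<bar> \<le> r \<Longrightarrow> y \<in> I"
    and A: "\<And>\<xi>. \<bar>Im \<xi> - Im \<zeta>\<bar> \<le> r \<Longrightarrow> cmod (f \<xi>) \<le> A"
  shows "cmod (f \<zeta> - c) \<le> t * A / r"
proof -
  define V where "V = {\<zeta>. Im \<zeta> \<in> I}"
  have A0: "0 \<le> A" using order_trans[OF norm_ge_zero A[of \<zeta>]] r by simp
  have cbV: "cball \<xi> r \<subseteq> V" if "Im \<xi> = Im \<zeta>" for \<xi>
  proof
    fix w assume "w \<in> cball \<xi> r"
    then have "\<bar>Im (\<xi> - w)\<bar> \<le> r" using abs_Im_le_cmod[of "\<xi> - w"] by (simp add: dist_norm)
    then show "w \<in> V" using r(2)[of "Im w"] that by (simp add: V_def abs_minus_commute)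
  qed
  have d: "cmod (deriv f \<xi>) \<le> A / r" if "Im \<xi> = Im \<zeta>" for \<xi>
  proof -
    have "cmod ((deriv ^^ 1) f \<xi>) \<le> fact 1 * A / r ^ 1"
    proof (rule Cauchy_inequality)
      have "f holomorphic_on cball \<xi> r" using f cbV[OF that] holomorphic_on_subset by (auto simp: V_def)
      then show "f holomorphic_on ball \<xi> r" "continuous_on (cball \<xi> r) f"
        by (auto intro: holomorphic_on_subset holomorphic_on_imp_continuous_on)
      fix x assume "cmod (\<xi> - x) = r"
      then have "\<bar>Im (\<xi> - x)\<bar> \<le> r" using abs_Im_le_cmod[of "\<xi> - x"] by simp
      then show "cmod (f x) \<le> A" using A[of x] that by (simp add: abs_minus_commute)
    qed (use r in auto)
    then show ?thesis by simp
  qed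
  define S where "S = closed_segment \<zeta> (\<zeta> + of_real t)"
  have SIm: "Im \<xi> = Im \<zeta>" if "\<xi> \<in> S" for \<xi> using that by (auto simp: S_def in_segment algebra_simps)
  have fd: "(f has_field_derivative deriv f \<xi>) (at \<xi> within S)" if "\<xi> \<in> S" for \<xi>
  proof -
    have "ball \<xi> r \<subseteq> {\<zeta>. Im \<zeta> \<in> I}" using cbV[OF SIm[OF that]] ball_subset_cball V_def by blast
    with f have "f holomorphic_on ball \<xi> r" by (rule holomorphic_on_subset)
    then have "(f has_field_derivative deriv f \<xi>) (at \<xi>)"
      by (rule holomorphic_derivI) (use r in auto)
    then show ?thesis by (rule has_field_derivative_at_within)
  qed
  have lip: "cmod (f (Complex u (Im \<zeta>)) - f \<zeta>) \<le> A / r * t" if u: "u \<in> {Re \<zeta>..Re \<zeta> + t}" for u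
  proof -
    have uS: "Complex u (Im \<zeta>) \<in> S"
    proof -
      have "Complex u (Im \<zeta>) = (1 - (u - Re \<zeta>) / t) *\<^sub>R \<zeta> + ((u - Re \<zeta>) / t) *\<^sub>R (\<zeta> + of_real t)"
        using t by (simp add: complex_eq_iff field_simps)
      moreover have "0 \<le> (u - Re \<zeta>) / t" "(u - Re \<zeta>) / t \<le> 1" using u t by auto
      ultimately show ?thesis unfolding S_def in_segment by blast
    qed
    have "cmod (f (Complex u (Im \<zeta>)) - f \<zeta>) \<le> A / r * cmod (Complex u (Im \<zeta>) - \<zeta>)"
    proof (rule field_differentiable_bound[of S f "deriv f"])
      show "convex S" "\<zeta> \<in> S" by (auto simp: S_def)
    qed (fact fd d[OF SIm] uS)+
    also have "cmod (Complex u (Im \<zeta>) - \<zeta>) = \<bar>u - Re \<zeta>\<bar>"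
      by (simp add: cmod_def)
    also have "A / r * \<dots> \<le> A / r * t" using u A0 r by (intro mult_left_mono) auto
    finally show ?thesis .
  qed
  have "((\<lambda>u. f (Complex u (Im \<zeta>)) - f \<zeta>) has_integral of_real t * c - of_real t * f \<zeta>) {Re \<zeta>..Re \<zeta> + t}"
    using has_integral_diff[OF c has_integral_const_real[of "f \<zeta>" "Re \<zeta>" "Re \<zeta> + t"]] t
    by (simp add: scaleR_conv_of_real)
  then have "cmod (of_real t * c - of_real t * f \<zeta>) \<le> A / r * t * measure lborel {Re \<zeta>..Re \<zeta> + t}"
    by (intro has_integral_bound_real[where f = "\<lambda>u. f (Complex u (Im \<zeta>)) - f \<zeta>" and S = "{}"])
       (use A0 r t lip in auto)
  also have "of_real t * c - of_real t * f \<zeta> = of_real t * (c - f \<zeta>)" by (simp add: algebra_simps)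
  finally have "t * cmod (f \<zeta> - c) \<le> t * (t * A / r)"
    using t by (simp add: norm_mult norm_minus_commute mult_ac)
  then show ?thesis using t by (simp only: mult_le_cancel_left_pos)
qed

text \<open>For exponent 2 the Cauchy-Schwarz inequality is obtained by integrating 2|c||g| \<le>
  |g|^2 + |c|^2. The left side is at least 2t|c|^2, and one finite term t|c|^2 cancels.\<close>

lemma line_mean_le:
  fixes g :: "real \<Rightarrow> complex"
  assumes I: "(g has_integral of_real t * c) {x..x + t}" and g: "continuous_on {x..x + t} g"
    and t: "0 < t" and k: "k = 1 \<or> k = (2::nat)"
  shows "ennreal (t * cmod c ^ k) \<le> (\<integral>\<^sup>+u\<in>{x..<x + t}. ennreal (cmod (g u) ^ k) \<partial>lborel)"
proof -
  have 1: "ennreal (t * cmod c) \<le> (\<integral>\<^sup>+u\<in>{x..<x + t}. ennreal (cmod (g u)) \<partial>lborel)"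
    using norm_has_integral_le_nn_integral[OF I g] t by (simp add: norm_mult nn_integral_Icc_AE_Ioo(2))
  have [measurable]: "(\<lambda>u. if u \<in> {x..x + t} then g u else 0) \<in> borel_measurable borel"
    by (rule borel_measurable_continuous_on_if) (use g in auto)
  have [measurable]: "(\<lambda>u. ennreal (cmod (g u) ^ k) * indicator {x..<x + t} u) \<in> borel_measurable borel" for k
  proof -
    have "(\<lambda>u. ennreal (cmod (if u \<in> {x..x + t} then g u else 0) ^ k) * indicator {x..<x + t} u) \<in> borel_measurable borel"
      by measurable
    also have "(\<lambda>u. ennreal (cmod (if u \<in> {x..x + t} then g u else 0) ^ k) * indicator {x..<x + t} u) =
      (\<lambda>u. ennreal (cmod (g u) ^ k) * indicator {x..<x + t} u)" by (auto simp: fun_eq_iff indicator_def)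
    finally show ?thesis .
  qed
  show ?thesis
  proof (cases "k = 1")
    case True with 1 show ?thesis by simp
  next
    case False
    then have k: "k = 2" using k by simp
    have [measurable]: "(\<lambda>u. ennreal (cmod (g u)) * indicator {x..<x + t} u) \<in> borel_measurable borel"
      using \<open>\<And>k. (\<lambda>u. ennreal (cmod (g u) ^ k) * indicator {x..<x + t} u) \<in> borel_measurable borel\<close>[of 1] by simp
    have "ennreal (2 * cmod c) * ennreal (t * cmod c) \<le>
      ennreal (2 * cmod c) * (\<integral>\<^sup>+u\<in>{x..<x + t}. ennreal (cmod (g u)) \<partial>lborel)"
      by (intro mult_left_mono 1) auto
    also have "\<dots> = (\<integral>\<^sup>+u. ennreal (2 * cmod c) * (ennreal (cmod (g u)) * indicator {x..<x + t} u) \<partial>lborel)"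
      by (rule nn_integral_cmult[symmetric]) measurable
    also have "\<dots> \<le> (\<integral>\<^sup>+u. ennreal (cmod (g u) ^ 2) * indicator {x..<x + t} u + ennreal ((cmod c)\<^sup>2) * indicator {x..<x + t} u \<partial>lborel)"
    proof (rule nn_integral_mono)
      fix u
      have "2 * cmod c * cmod (g u) \<le> cmod (g u) ^ 2 + (cmod c)\<^sup>2"
        using sum_squares_bound[of "cmod c" "cmod (g u)"] by simp
      then show "ennreal (2 * cmod c) * (ennreal (cmod (g u)) * indicator {x..<x + t} u) \<le>
          ennreal (cmod (g u) ^ 2) * indicator {x..<x + t} u + ennreal ((cmod c)\<^sup>2) * indicator {x..<x + t} u"
        by (auto simp: indicator_def ennreal_leI simp flip: ennreal_mult ennreal_plus)
    qed
    also have "\<dots> = (\<integral>\<^sup>+u\<in>{x..<x + t}. ennreal (cmod (g u) ^ 2) \<partial>lborel) + ennreal ((cmod c)\<^sup>2) * ennreal t"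
      using t by (subst nn_integral_add) (auto simp: nn_integral_cmult_indicator)
    finally have "ennreal (t * cmod c ^ 2) + ennreal ((cmod c)\<^sup>2 * t) \<le>
        (\<integral>\<^sup>+u\<in>{x..<x + t}. ennreal (cmod (g u) ^ 2) \<partial>lborel) + ennreal ((cmod c)\<^sup>2 * t)"
      using t by (simp add: ennreal_mult[symmetric] ennreal_plus[symmetric] power2_eq_square algebra_simps del: ennreal_plus)
    then show ?thesis unfolding k
      by (subst (asm) (1 2) add.commute) (simp add: ennreal_add_left_cancel_le)
  qed
qed

text \<open>In the density (|f| \<tau>^2)^(j+1) / \<tau>^2 the weight of |f|^(j+1) is \<tau>^(2j).
  For j = 0 the weight is 1, which makes the left side infinite at a cusp unless c = 0; for j = 1 it
  is \<tau>^2, which on a collar integrates to nearly pi/2.\<close>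

lemma periodic_strip_mean_le:
  fixes f :: "complex \<Rightarrow> complex" and \<tau> :: "real \<Rightarrow> real"
  assumes f: "f holomorphic_on {\<zeta>. Im \<zeta> \<in> I}" and I: "open I"
    and \<tau>: "\<tau> \<in> borel_measurable borel" "\<And>y. y \<in> I \<Longrightarrow> \<tau> y > 0"
    and t: "0 < t" and c: "\<And>y. y \<in> I \<Longrightarrow> ((\<lambda>u. f (Complex u y)) has_integral of_real t * c) {x..x + t}"
    and j: "j = 0 \<or> j = (1::nat)"
  shows "(\<integral>\<^sup>+y\<in>I. ennreal (t * cmod c ^ Suc j) * ennreal ((\<tau> y)\<^sup>2 ^ j) \<partial>lborel) \<le>
    (\<integral>\<^sup>+\<zeta>\<in>(period_box x t I).
        ennreal ((cmod (f \<zeta>) * (\<tau> (Im \<zeta>))\<^sup>2) ^ Suc j) * ennreal (1 / (\<tau> (Im \<zeta>))\<^sup>2) \<partial>lborel)"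
proof -
  define V where "V = {\<zeta>. Im \<zeta> \<in> I}"
  define F where "F w = (if w \<in> V then f w else 0)" for w
  have opV: "open V" unfolding V_def by (rule open_strip[OF I])
  have [measurable]: "F \<in> borel_measurable borel" unfolding F_def
    by (rule borel_measurable_holomorphic_extension[OF f[folded V_def] opV])
  have [measurable]: "\<tau> \<in> borel_measurable borel" "I \<in> sets borel" using \<tau> I by auto
  define R where "R = period_box x t I"
  have [measurable]: "R \<in> sets borel" unfolding R_def by measurable
  define H where "H w = ennreal (cmod (F w) ^ Suc j) * ennreal ((\<tau> (Im w))\<^sup>2 ^ j) * indicator R w" for w
  have [measurable]: "H \<in> borel_measurable borel" unfolding H_def by measurable
  have [measurable]: "(\<lambda>u. Complex u y) \<in> borel_measurable borel" for y
    unfolding Complex_eq by measurable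
  have "(\<integral>\<^sup>+y\<in>I. ennreal (t * cmod c ^ Suc j) * ennreal ((\<tau> y)\<^sup>2 ^ j) \<partial>lborel) \<le>
     (\<integral>\<^sup>+y. \<integral>\<^sup>+u. H (Complex u y) \<partial>lborel \<partial>lborel)"
  proof (rule nn_integral_mono)
    fix y
    show "ennreal (t * cmod c ^ Suc j) * ennreal ((\<tau> y)\<^sup>2 ^ j) * indicator I y \<le> (\<integral>\<^sup>+u. H (Complex u y) \<partial>lborel)"
    proof (cases "y \<in> I")
      case True
      have "continuous_on {x..x + t} (\<lambda>u. f (Complex u y))"
        by (rule continuous_on_compose2[OF holomorphic_on_imp_continuous_on[OF f]])
           (use True in \<open>auto intro!: continuous_intros simp: Complex_eq\<close>)
      from line_mean_le[OF c[OF True] this t, of "Suc j"] j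
      have "ennreal (t * cmod c ^ Suc j) * ennreal ((\<tau> y)\<^sup>2 ^ j) \<le>
          (\<integral>\<^sup>+u\<in>{x..<x + t}. ennreal (cmod (f (Complex u y)) ^ Suc j) \<partial>lborel) * ennreal ((\<tau> y)\<^sup>2 ^ j)"
        by (intro mult_right_mono) auto
      also have "(\<integral>\<^sup>+u\<in>{x..<x + t}. ennreal (cmod (f (Complex u y)) ^ Suc j) \<partial>lborel) = 
          (\<integral>\<^sup>+u\<in>{x..<x + t}. ennreal (cmod (F (Complex u y)) ^ Suc j) \<partial>lborel)"
        using True by (simp add: F_def V_def)
      also have "\<dots> * ennreal ((\<tau> y)\<^sup>2 ^ j) = 
          (\<integral>\<^sup>+u. ennreal (cmod (F (Complex u y)) ^ Suc j) * indicator {x..<x + t} u * ennreal ((\<tau> y)\<^sup>2 ^ j) \<partial>lborel)"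
        by (rule nn_integral_multc[symmetric]) measurable
      also have "\<dots> = (\<integral>\<^sup>+u. H (Complex u y) \<partial>lborel)"
        using True by (intro nn_integral_cong) (auto simp: H_def R_def indicator_def)
      finally show ?thesis using True by simp
    qed simp
  qed
  also have "\<dots> = (\<integral>\<^sup>+\<zeta>. H \<zeta> \<partial>lborel)"
    by (rule nn_integral_lborel_complex[symmetric]) measurable
  also have "\<dots> = (\<integral>\<^sup>+\<zeta>\<in>R.
        ennreal ((cmod (f \<zeta>) * (\<tau> (Im \<zeta>))\<^sup>2) ^ Suc j) * ennreal (1 / (\<tau> (Im \<zeta>))\<^sup>2) \<partial>lborel)"
  proof (rule nn_integral_cong)
    fix \<zeta>
    show "H \<zeta> = ennreal ((cmod (f \<zeta>) * (\<tau> (Im \<zeta>))\<^sup>2) ^ Suc j) * ennreal (1 / (\<tau> (Im \<zeta>))\<^sup>2) * indicator R \<zeta>"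
    proof (cases "\<zeta> \<in> R")
      case True
      then have "\<tau> (Im \<zeta>) > 0" using \<tau> by (auto simp: R_def)
      then have "(cmod (f \<zeta>) * (\<tau> (Im \<zeta>))\<^sup>2) ^ Suc j * (1 / (\<tau> (Im \<zeta>))\<^sup>2) = cmod (f \<zeta>) ^ Suc j * (\<tau> (Im \<zeta>))\<^sup>2 ^ j"
        by (simp add: power_mult_distrib)
      then show ?thesis using True by (simp add: H_def F_def V_def R_def flip: ennreal_mult)
    qed (simp add: H_def)
  qed
  finally show ?thesis by (simp add: R_def)
qed

subsection \<open>Trace inequalities in torsion-free Fuchsian groups\<close>

lemma torsion_free_abs_tr_ge:
  assumes "torsion_free G" "g \<in> G"
  shows "2 \<le> \<bar>tr g\<bar>"
  using assms unfolding torsion_free_def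
  by (cases "g = mat_id \<or> g = mat_negid") (auto simp: mat_id_def mat_negid_def)

text \<open>The form in which discreteness is applied: infinitely many distinct elements cannot have
  bounded entries.\<close>

lemma fuchsian_not_injective_bounded:
  assumes G: "fuchsian G" and X: "\<And>n::nat. X n \<in> G" "\<And>n. mat_bound (X n) \<le> R"
  shows "\<not> inj X"
proof
  assume "inj X"
  then have "infinite (range X)" by (rule range_inj_infinite)
  moreover have "range X \<subseteq> {g\<in>G. mat_bound g \<le> R}" using X by auto
  ultimately show False using fuchsianD(5)[OF G, of R] finite_subset by blast
qed

lemma inj_mult_power:
  fixes q b :: real
  assumes "0 < q" "q < 1" "b \<noteq> 0"
  shows "inj (\<lambda>n. b * q ^ n)"
proof (rule injI)
  fix m n assume "b * q ^ m = b * q ^ n"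
  then have "q ^ m = q ^ n" using assms by simp
  then show "m = n" using power_strict_decreasing[of m n q] power_strict_decreasing[of n m q] assms
    by (cases m n rule: linorder_cases) auto
qed

lemma fuchsian_diagonal_conjugates:
  assumes G: "fuchsian G" and g: "(l, 0, 0, 1 / l) \<in> G" "l \<noteq> 0" and h: "(a, b, c, d) \<in> G"
  shows "(a, b * (1 / l\<^sup>2) ^ n, c * (l\<^sup>2) ^ n, d) \<in> G" "(a, b * (l\<^sup>2) ^ n, c * (1 / l\<^sup>2) ^ n, d) \<in> G"
proof -
  have gi: "(1 / l, 0, 0, l) \<in> G" using fuchsianD(4)[OF G g(1)] by simp
  show "(a, b * (1 / l\<^sup>2) ^ n, c * (l\<^sup>2) ^ n, d) \<in> G"
  proof (induction n)
    case (Suc n)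
    from fuchsianD(3)[OF G fuchsianD(3)[OF G gi Suc] g(1)] show ?case
      using g(2) by (simp add: power2_eq_square field_simps)
  qed (use h in simp)
  show "(a, b * (l\<^sup>2) ^ n, c * (1 / l\<^sup>2) ^ n, d) \<in> G"
  proof (induction n)
    case (Suc n)
    from fuchsianD(3)[OF G fuchsianD(3)[OF G g(1) Suc] gi] show ?case
      using g(2) by (simp add: power2_eq_square field_simps)
  qed (use h in simp)
qed

text \<open>\<open>c = 0\<close> means that the element fixes infinity, \<open>b = 0\<close> that it
  fixes 0. If it shared exactly one fixed point with the diagonal element, conjugation by powers of
  the latter would shrink its single off-diagonal entry through infinitely many values and
  contradict discreteness.\<close>

lemma fuchsian_diagonal_shared_fixpoint:
  assumes G: "fuchsian G" and g: "(l, 0, 0, 1 / l) \<in> G" "1 < \<bar>l\<bar>" and h: "(a, b, c, d) \<in> G"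
  shows "b = 0 \<longleftrightarrow> c = 0"
proof -
  have "1 < \<bar>l\<bar>\<^sup>2" using g(2) by (intro one_less_power) auto
  then have l2: "1 < l\<^sup>2" by simp
  then have l: "l \<noteq> 0" "0 < 1 / l\<^sup>2" "1 / l\<^sup>2 < 1" by (auto simp: divide_less_eq)
  have le1: "\<bar>x * (1 / l\<^sup>2) ^ n\<bar> \<le> \<bar>x\<bar>" for x n
    using l power_le_one[of "1 / l\<^sup>2" n] by (simp add: abs_mult mult_left_le)
  have 1: "b = 0" if "c = 0"
  proof (rule ccontr)
    assume b: "b \<noteq> 0"
    have "inj (\<lambda>n. (a, b * (1 / l\<^sup>2) ^ n, c * (l\<^sup>2) ^ n, d))"
      using inj_mult_power[OF l(2,3) b] by (auto simp: inj_def)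
    moreover have "mat_bound (a, b * (1 / l\<^sup>2) ^ n, c * (l\<^sup>2) ^ n, d) \<le> mat_bound (a, b, c, d)" for n
      unfolding mat_bound.simps by (intro max.mono order_refl le1) (simp add: that)
    then have "\<not> inj (\<lambda>n. (a, b * (1 / l\<^sup>2) ^ n, c * (l\<^sup>2) ^ n, d))"
      by (rule fuchsian_not_injective_bounded[OF G fuchsian_diagonal_conjugates(1)[OF G g(1) l(1) h]])
    ultimately show False by simp
  qed
  have 2: "c = 0" if "b = 0"
  proof (rule ccontr)
    assume b: "c \<noteq> 0"
    have "inj (\<lambda>n. (a, b * (l\<^sup>2) ^ n, c * (1 / l\<^sup>2) ^ n, d))"
      using inj_mult_power[OF l(2,3) b] by (auto simp: inj_def)
    moreover have "mat_bound (a, b * (l\<^sup>2) ^ n, c * (1 / l\<^sup>2) ^ n, d) \<le> mat_bound (a, b, c, d)" for n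
      unfolding mat_bound.simps by (intro max.mono order_refl le1) (simp add: that)
    then have "\<not> inj (\<lambda>n. (a, b * (l\<^sup>2) ^ n, c * (1 / l\<^sup>2) ^ n, d))"
      by (rule fuchsian_not_injective_bounded[OF G fuchsian_diagonal_conjugates(2)[OF G g(1) l(1) h]])
    ultimately show False by simp
  qed
  from 1 2 show ?thesis by blast
qed

text \<open>Conjugation by an element fixing infinity multiplies the translation length by a^2. If
  |a| < 1, iteration gives infinitely many translations with bounded entries; if |a| > 1, the
  inverse element does. So no hyperbolic element fixes a cusp.\<close>

lemma fuchsian_parabolic_stabilizer:
  assumes G: "fuchsian G" and g: "(e, t, 0, e) \<in> G" "t \<noteq> 0" and h: "(a, b, 0, d) \<in> G"
  shows "\<bar>a\<bar> = 1"
proof -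
  have ns: False if h: "(a, b, 0, d) \<in> G" and a: "\<bar>a\<bar> < 1" for a b d
  proof -
    have ad: "a * d = 1" using fuchsianD(1)[OF G h] by (simp add: SL2_def)
    have a2: "0 < a\<^sup>2" "a\<^sup>2 < 1" using ad a by (auto simp: abs_square_less_1)
    have mem: "(e, t * (a\<^sup>2) ^ n, 0, e) \<in> G" for n
    proof (induction n)
      case (Suc n)
      have ad': "a * (d * x) = x" for x using ad by (metis mult.assoc mult_1)
      from fuchsianD(3)[OF G fuchsianD(3)[OF G h Suc] fuchsianD(4)[OF G h]] show ?case
        using ad ad' by (simp add: power2_eq_square algebra_simps)
    qed (use g in simp)
    have inj: "inj (\<lambda>n. (e, t * (a\<^sup>2) ^ n, 0::real, e))"
      using inj_mult_power[OF a2 g(2)] by (auto simp: inj_def)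
    have "\<bar>t * (a\<^sup>2) ^ n\<bar> \<le> \<bar>t\<bar>" for n
      using a2 power_le_one[of "a\<^sup>2" n] by (simp add: abs_mult mult_left_le)
    then have mb: "mat_bound (e, t * (a\<^sup>2) ^ n, 0, e) \<le> mat_bound (e, t, 0, e)" for n
      unfolding mat_bound.simps by (intro max.mono order_refl)
    show False using fuchsian_not_injective_bounded[OF G mem mb, of "\<lambda>n. n"] inj by blast
  qed
  have ad: "a * d = 1" using fuchsianD(1)[OF G h] by (simp add: SL2_def)
  have "(d, - b, 0, a) \<in> G" using fuchsianD(4)[OF G h] by simp
  with ns have "\<not> \<bar>d\<bar> < 1" by blast
  moreover have "\<not> \<bar>a\<bar> < 1" using ns h by blast
  moreover have "\<bar>a\<bar> * 1 \<le> \<bar>a\<bar> * \<bar>d\<bar>" using \<open>\<not> \<bar>d\<bar> < 1\<close> by (intro mult_left_mono) auto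
  moreover have "\<bar>a\<bar> * \<bar>d\<bar> = 1" using ad by (simp flip: abs_mult)
  ultimately show ?thesis by linarith
qed

text \<open>A Shimizu-type bound: since \<open>tr (g k g k\<inverse>) = 2 - (c t)\<^sup>2\<close>, the absence of elliptic
  elements forces \<open>\<bar>c t\<bar> \<ge> 2\<close>.\<close>

lemma torsion_free_parabolic_lower_left:
  assumes G: "fuchsian G" "torsion_free G" and g: "(e, t, 0, e) \<in> G" and k: "(a, b, c, d) \<in> G" "c * t \<noteq> 0"
  shows "4 \<le> (c * t)\<^sup>2"
    "tr (mat_mult (mat_mult (e, t, 0, e) (a, b, c, d)) (mat_mult (e, t, 0, e) (mat_inv (a, b, c, d)))) = 2 - (c * t)\<^sup>2"
proof -
  have ad: "a * d - b * c = 1" using fuchsianD(1)[OF G(1) k(1)] by (simp add: SL2_def)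
  have e: "e * e = 1" using fuchsianD(1)[OF G(1) g] by (simp add: SL2_def)
  let ?w = "mat_mult (mat_mult (e, t, 0, e) (a, b, c, d)) (mat_mult (e, t, 0, e) (mat_inv (a, b, c, d)))"
  have "tr ?w = 2 * (e * e) * (a * d - b * c) - (c * t)\<^sup>2"
    by (simp add: power2_eq_square algebra_simps)
  then show tr: "tr ?w = 2 - (c * t)\<^sup>2" by (simp add: ad e)
  have "?w \<in> G" by (intro fuchsianD(3)[OF G(1)] fuchsianD(4)[OF G(1)] g k)
  then have "2 \<le> \<bar>2 - (c * t)\<^sup>2\<bar>" using torsion_free_abs_tr_ge[OF G(2), of ?w] tr by (simp only:)
  moreover have "0 < (c * t)\<^sup>2" using k by (simp only: zero_less_power2) simp
  ultimately show "4 \<le> (c * t)\<^sup>2" by linarith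
qed

text \<open>With \<open>D = (l - 1/l)\<^sup>2\<close> the relevant traces are \<open>tr (g k g\<inverse> k\<inverse>) = 2 - b c D\<close> and
  \<open>tr (g k g k\<inverse>) = 2 + D (1 + b c)\<close>. They settle everything except \<open>-1 \<le> b c < 0\<close> (crossing axes),
  which is excluded by applying the first one to \<open>k g k\<inverse>\<close> in place of \<open>k\<close>.\<close>

lemma torsion_free_collar:
  assumes G: "fuchsian G" "torsion_free G" and g: "(l, 0, 0, 1 / l) \<in> G" "1 < \<bar>l\<bar>"
    and D: "(l - 1 / l)\<^sup>2 < 4" and k: "(a, b, c, d) \<in> G"
  shows "b = 0 \<and> c = 0 \<or> 4 \<le> \<bar>b * c\<bar> * (l - 1 / l)\<^sup>2"
proof -
  define D where "D = (l - 1 / l)\<^sup>2"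
  have l: "l \<noteq> 0" using g by auto
  have D0: "0 < D"
  proof -
    have "l * l \<noteq> 1" using g(2) by (metis abs_mult_self_eq less_irrefl less_1_mult)
    then have "l - 1 / l \<noteq> 0" using l by (simp add: field_simps)
    then show ?thesis by (simp add: D_def)
  qed
  have comm: "2 \<le> \<bar>2 - b * c * D\<bar>" if k: "(a, b, c, d) \<in> G" for a b c d
  proof -
    let ?w = "mat_mult (mat_mult (l, 0, 0, 1 / l) (a, b, c, d)) (mat_mult (mat_inv (l, 0, 0, 1 / l)) (mat_inv (a, b, c, d)))"
    have ad: "a * d = 1 + b * c" using fuchsianD(1)[OF G(1) k] by (simp add: SL2_def)
    have "tr ?w = 2 * (a * d) - b * c * (l * l + 1 / (l * l))" using l
      by (simp add: field_simps)
    also have "\<dots> = 2 - b * c * D" using l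
      by (simp add: ad D_def power2_eq_square field_simps)
    finally have "tr ?w = 2 - b * c * D" .
    moreover have "?w \<in> G" by (intro fuchsianD(3)[OF G(1)] fuchsianD(4)[OF G(1)] g k)
    ultimately show ?thesis using torsion_free_abs_tr_ge[OF G(2), of ?w] by (simp only:)
  qed
  have ad: "a * d = 1 + b * c" using fuchsianD(1)[OF G(1) k] by (simp add: SL2_def)
  have two: "2 \<le> \<bar>2 + D * (1 + b * c)\<bar>"
  proof -
    let ?w = "mat_mult (mat_mult (l, 0, 0, 1 / l) (a, b, c, d)) (mat_mult (l, 0, 0, 1 / l) (mat_inv (a, b, c, d)))"
    have "tr ?w = (a * d) * (l * l + 1 / (l * l)) - 2 * (b * c)" using l
      by (simp add: field_simps)
    also have "\<dots> = 2 + D * (1 + b * c)" using l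
      by (simp add: ad D_def power2_eq_square field_simps)
    finally have "tr ?w = 2 + D * (1 + b * c)" .
    moreover have "?w \<in> G" by (intro fuchsianD(3)[OF G(1)] fuchsianD(4)[OF G(1)] g k)
    ultimately show ?thesis using torsion_free_abs_tr_ge[OF G(2), of ?w] by (simp only:)
  qed
  note fixp = fuchsian_diagonal_shared_fixpoint[OF G(1) g]
  define x where "x = b * c"
  have "b = 0 \<and> c = 0 \<or> 4 \<le> \<bar>x\<bar> * D"
  proof -
    consider "x > 0" | "x = 0" | "-1 \<le> x" "x < 0" | "x < -1" by linarith
    then show ?thesis
    proof cases
      case 1
      then have "x * D > 0" using D0 by simp
      then have "4 \<le> x * D" using comm[OF k] unfolding x_def by linarith
      then show ?thesis using 1 by simp
    next
      case 2
      then show ?thesis using fixp[OF k] by (auto simp: x_def)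
    next
      case 4
      have "D * (1 + x) < 0" using D0 4 by (simp add: mult_pos_neg)
      then have "D * (1 + x) \<le> -4" using two by (simp add: x_def)
      then have "4 + D \<le> \<bar>x\<bar> * D" using 4 by (simp add: algebra_simps)
      then show ?thesis using D0 by simp
    next
      case 3
      \<comment> \<open>These are the off-diagonal entries of k g k^(-1). Their product is -(1 + x)
        x D, positive when -1 < x < 0, so the commutator trace inequality gives information
        again.\<close>
      define b' c' where "b' = a * b * (1 / l - l)" and "c' = c * d * (l - 1 / l)"
      have "mat_mult (mat_mult (a, b, c, d) (l, 0, 0, 1 / l)) (mat_inv (a, b, c, d)) \<in> G"
        by (intro fuchsianD(3)[OF G(1)] fuchsianD(4)[OF G(1)] g k)
      then obtain a' d' where k': "(a', b', c', d') \<in> G"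
        by (simp add: b'_def c'_def algebra_simps)
      have "b' * c' = - (a * d) * (b * c) * D" 
        by (simp add: b'_def c'_def D_def power2_eq_square algebra_simps)
      then have bc': "b' * c' = - (1 + x) * x * D" by (simp add: ad x_def)
      have ll: "1 / l - l \<noteq> 0" "l - 1 / l \<noteq> 0" using D0 by (auto simp: D_def)
      show ?thesis
      proof (cases "x = -1")
        case True
        \<comment> \<open>Here \<open>k\<close> interchanges the endpoints 0 and infinity of the
          axis: k g k^(-1) is again diagonal, which forces a = d = 0. Such an element has trace 0,
          hence is elliptic.\<close>
        then have "b' = 0 \<or> c' = 0" using bc' by simp
        then have "b' = 0" "c' = 0" using fixp[OF k'] by auto
        then have "a * b = 0" "c * d = 0" using ll by (auto simp: b'_def c'_def)
        moreover have "b \<noteq> 0" "c \<noteq> 0" using True by (auto simp: x_def)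
        ultimately have "tr (a, b, c, d) = 0" by simp
        then show ?thesis using torsion_free_abs_tr_ge[OF G(2) k] by simp
      next
        case False
        then have "0 < (1 + x) * (- x)" using 3 by (intro mult_pos_pos) auto
        then have "0 < ((1 + x) * (- x)) * (D * D)" using D0 by (metis mult_pos_pos)
        moreover have bD: "b' * c' * D = ((1 + x) * (- x)) * (D * D)" unfolding bc' by algebra
        ultimately have p: "0 < b' * c' * D" by simp
        then have "4 \<le> b' * c' * D" using comm[OF k'] by linarith
        \<comment> \<open>This and D < 4 give (1 + x)(-x) D^2 < 16/4 = 4, against the lower bound 4
          just obtained. It is here that the translation length must be small.\<close>
        moreover have "(1 + x) * (- x) \<le> 1 / 4"
          using zero_le_power2[of "x + 1 / 2"] by (simp add: power2_eq_square algebra_simps)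
        then have "((1 + x) * (- x)) * (D * D) \<le> 1 / 4 * (D * D)" using D0 by (intro mult_right_mono) auto
        moreover note bD
        moreover have "D * D < 4 * 4" using D D0 by (intro mult_strict_mono) (auto simp: D_def)
        ultimately show ?thesis by linarith
      qed
    qed
  qed
  then show ?thesis by (simp add: x_def D_def)
qed

text \<open>Im z / |z| is the sine of the argument of \<open>z\<close>, equal to 1/cosh of the
  distance to the imaginary axis. A large |bc| thus prevents a point and its image from both being
  close to the axis. The two factors of the bound come from |Im((az + b) cnj z)| = |b| Im z and
  |Im(cz + d)| = |c| Im z.\<close>

lemma mob_angle_product_le:
  assumes k: "(a, b, c, d) \<in> SL2" and z: "z \<in> uhp"
  shows "(Im z / cmod z) * (Im (mob (a, b, c, d) z) / cmod (mob (a, b, c, d) z)) * \<bar>b * c\<bar> \<le> 1"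
proof -
  have y: "Im z > 0" using z by (simp add: uhp_def)
  let ?n = "of_real a * z + of_real b" and ?d = "of_real c * z + of_real d"
  have nz: "?d \<noteq> 0" "z \<noteq> 0" using uhp_denom_nonzero[OF k z] y by auto
  have "mob (a, b, c, d) z \<noteq> 0" using mob_uhp[OF k z] by (auto simp: uhp_def)
  then have nn: "?n \<noteq> 0" by auto
  have "\<bar>Im (?n * cnj z)\<bar> \<le> cmod (?n * cnj z)" by (rule abs_Im_le_cmod)
  moreover have "Im (?n * cnj z) = - (b * Im z)" by (simp add: algebra_simps)
  ultimately have 1: "\<bar>b\<bar> * Im z \<le> cmod ?n * cmod z" using y by (simp add: norm_mult abs_mult)
  have "\<bar>Im ?d\<bar> \<le> cmod ?d" by (rule abs_Im_le_cmod)
  then have 2: "\<bar>c\<bar> * Im z \<le> cmod ?d" using y by (simp add: abs_mult)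
  have "(\<bar>b\<bar> * Im z) * (\<bar>c\<bar> * Im z) \<le> (cmod ?n * cmod z) * cmod ?d"
    using y by (intro mult_mono 1 2) simp_all
  moreover have "cmod (mob (a, b, c, d) z) = cmod ?n / cmod ?d" "cmod (mob_deriv (a, b, c, d) z) = 1 / (cmod ?d * cmod ?d)"
    by (simp_all add: norm_divide norm_mult power2_eq_square)
  then have "(Im z / cmod z) * (Im (mob (a, b, c, d) z) / cmod (mob (a, b, c, d) z)) * \<bar>b * c\<bar>
     = (\<bar>b\<bar> * Im z) * (\<bar>c\<bar> * Im z) / ((cmod ?n * cmod z) * cmod ?d)"
    using nz nn unfolding Im_mob[OF k z] by (simp add: abs_mult mult_ac)
  ultimately show ?thesis using nz nn by (simp add: divide_le_eq_1)
qed

text \<open>The horoball counterpart: with \<open>c\<close> bounded below, a point and its image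
  cannot both be high in the half plane.\<close>

lemma mob_Im_product_le:
  assumes k: "(a, b, c, d) \<in> SL2" and z: "z \<in> uhp"
  shows "Im z * Im (mob (a, b, c, d) z) * c\<^sup>2 \<le> 1"
proof -
  have y: "Im z > 0" using z by (simp add: uhp_def)
  let ?d = "of_real c * z + of_real d"
  have nz: "?d \<noteq> 0" using uhp_denom_nonzero[OF k z] .
  have "\<bar>Im ?d\<bar> \<le> cmod ?d" by (rule abs_Im_le_cmod)
  then have "\<bar>c * Im z\<bar>\<^sup>2 \<le> (cmod ?d)\<^sup>2" by (intro power_mono) auto
  then have "(Im z)\<^sup>2 * c\<^sup>2 / (cmod ?d)\<^sup>2 \<le> 1" using nz by (simp add: power_mult_distrib mult.commute)
  moreover have "cmod (mob_deriv (a, b, c, d) z) = 1 / (cmod ?d)\<^sup>2"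
    by (simp add: norm_divide norm_power)
  ultimately show ?thesis unfolding Im_mob[OF k z]
    by (simp add: power2_eq_square mult_ac)
qed

subsection \<open>Normal forms and primitive elements\<close>

text \<open>Passing to m G m^(-1) puts a chosen axis on the imaginary axis or a chosen cusp at
  infinity, where the stabilizer consists of diagonal or upper triangular matrices.\<close>

definition conj_group :: "mat2 \<Rightarrow> mat2 set \<Rightarrow> mat2 set" where
  "conj_group m G = (\<lambda>g. mat_conj m g) ` G"

lemma conj_groupI: "g \<in> G \<Longrightarrow> mat_conj m g \<in> conj_group m G"
  by (auto simp: conj_group_def)

lemma mat_mult_cancel:
  assumes "m \<in> SL2"
  shows "mat_mult (mat_inv m) (mat_mult m h) = h" "mat_mult m (mat_mult (mat_inv m) h) = h"
  using assms by (simp_all add: mat_mult_inv flip: mat_mult_assoc)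

lemma conj_group_inverse:
  assumes "m \<in> SL2" "k \<in> conj_group m G"
  shows "mat_mult (mat_mult (mat_inv m) k) m \<in> G"
  using assms by (auto simp: conj_group_def mat_mult_assoc mat_mult_cancel mat_mult_inv)

lemma tr_conj:
  assumes "m \<in> SL2"
  shows "tr (mat_conj m g) = tr g"
  by (metis assms mat_mult_assoc mat_mult_cancel(1) tr_mat_mult_commute)

lemma mat_bound_nonneg: "0 \<le> mat_bound g"
  by (cases g) (auto simp: le_max_iff_disj)

lemma mat_bound_mult: "mat_bound (mat_mult g h) \<le> 2 * mat_bound g * mat_bound h"
proof -
  obtain a b c d where g: "g = (a, b, c, d)" by (cases g)
  obtain a' b' c' d' where h: "h = (a', b', c', d')" by (cases h)
  define M N where "M = mat_bound g" and "N = mat_bound h"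
  have bd: "\<bar>a\<bar> \<le> M" "\<bar>b\<bar> \<le> M" "\<bar>c\<bar> \<le> M" "\<bar>d\<bar> \<le> M" "\<bar>a'\<bar> \<le> N" "\<bar>b'\<bar> \<le> N" "\<bar>c'\<bar> \<le> N" "\<bar>d'\<bar> \<le> N"
    by (simp_all add: M_def N_def g h le_max_iff_disj)
  have key: "\<bar>x * y + z * w\<bar> \<le> 2 * M * N"
    if "\<bar>x\<bar> \<le> M" "\<bar>y\<bar> \<le> N" "\<bar>z\<bar> \<le> M" "\<bar>w\<bar> \<le> N" for x y z w
  proof -
    have "\<bar>x * y\<bar> \<le> M * N" "\<bar>z * w\<bar> \<le> M * N"
      unfolding abs_mult using that by (auto intro!: mult_mono intro: order_trans[OF abs_ge_zero])
    then show ?thesis by linarith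
  qed
  have "mat_bound (mat_mult g h) \<le> 2 * M * N"
    unfolding g h mat_mult.simps mat_bound.simps by (intro max.boundedI key bd)
  then show ?thesis by (simp add: M_def N_def)
qed

lemma mat_mult_conj:
  assumes "m \<in> SL2"
  shows "mat_mult (mat_conj m g) (mat_conj m h) =
    mat_conj m (mat_mult g h)"
  using assms by (simp add: mat_mult_assoc mat_mult_cancel)

lemma fuchsian_conj_group:
  assumes G: "fuchsian G" and m: "m \<in> SL2"
  shows "fuchsian (conj_group m G)"
  unfolding fuchsian_def
proof (intro conjI ballI allI)
  note GD = fuchsianD[OF G]
  show "conj_group m G \<subseteq> SL2"
    using m GD by (auto simp: conj_group_def intro!: SL2_mat_mult SL2_mat_inv)
  show "mat_id \<in> conj_group m G"
    using conj_groupI[OF GD(2), of m] m by (simp add: mat_mult_inv)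
  fix g assume "g \<in> conj_group m G"
  then obtain g' where g': "g' \<in> G" "g = mat_conj m g'" by (auto simp: conj_group_def)
  show "mat_inv g \<in> conj_group m G"
    using conj_groupI[OF GD(4)[OF g'(1)], of m] by (simp add: g' mat_inv_mult mat_mult_assoc)
  fix h assume "h \<in> conj_group m G"
  then obtain h' where h': "h' \<in> G" "h = mat_mult (mat_mult m h') (mat_inv m)" by (auto simp: conj_group_def)
  show "mat_mult g h \<in> conj_group m G"
    using conj_groupI[OF GD(3)[OF g'(1) h'(1)], of m] m by (simp add: g' h' mat_mult_conj)
next
  fix R
  \<comment> \<open>Undoing the conjugation multiplies by two fixed matrices, and each product at
    most doubles the product of the entry bounds. Bounded elements of the conjugate thus come from
    bounded elements of \<open>G\<close>.\<close>
  define R' where "R' = 2 * (2 * mat_bound (mat_inv m) * R) * mat_bound m"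
  have "{g \<in> conj_group m G. mat_bound g \<le> R} \<subseteq> (\<lambda>g. mat_conj m g) ` {g\<in>G. mat_bound g \<le> R'}"
  proof
    fix k assume k: "k \<in> {g \<in> conj_group m G. mat_bound g \<le> R}"
    then obtain g where g: "g \<in> G" "k = mat_conj m g" by (auto simp: conj_group_def)
    have "g = mat_mult (mat_mult (mat_inv m) k) m"
      using m by (simp add: g mat_mult_assoc mat_mult_cancel mat_mult_inv)
    then have "mat_bound g \<le> 2 * mat_bound (mat_mult (mat_inv m) k) * mat_bound m"
      using mat_bound_mult by simp
    also have "\<dots> \<le> 2 * (2 * mat_bound (mat_inv m) * mat_bound k) * mat_bound m"
      using mat_bound_nonneg by (intro mult_right_mono mult_left_mono mat_bound_mult) auto
    also have "\<dots> \<le> R'" unfolding R'_def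
      using mat_bound_nonneg k by (intro mult_right_mono mult_left_mono) auto
    finally show "k \<in> (\<lambda>g. mat_conj m g) ` {g\<in>G. mat_bound g \<le> R'}"
      using g by blast
  qed
  then show "finite {g \<in> conj_group m G. mat_bound g \<le> R}"
    using fuchsianD(5)[OF G] by (meson finite_imageI finite_subset)
qed

lemma torsion_free_conj_group:
  assumes "torsion_free G" "m \<in> SL2"
  shows "torsion_free (conj_group m G)"
  unfolding torsion_free_def using torsion_free_abs_tr_ge[OF assms(1)] tr_conj[OF assms(2)]
  by (auto simp: conj_group_def)

lemma hyperbolic_normal_form:
  assumes h: "h \<in> SL2" "2 < \<bar>tr h\<bar>"
  obtains m l where "m \<in> SL2" "1 < \<bar>l\<bar>" "mat_conj m h = (l, 0, 0, 1 / l)"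
proof -
  obtain a b c d where h': "h = (a, b, c, d)" by (cases h)
  have det: "a * d - b * c = 1" using h by (simp add: h' SL2_def)
  have "\<exists>m l. m \<in> SL2 \<and> l \<noteq> 0 \<and> mat_conj m h = (l, 0, 0, 1 / l)"
  proof (cases "c = 0")
    case True
    then have ad: "a * d = 1" using det by simp
    have ne: "a \<noteq> d"
    proof
      assume "a = d"
      then have "a\<^sup>2 = 1" using ad by (simp add: power2_eq_square)
      then show False using h \<open>a = d\<close> by (auto simp: h' power2_eq_1_iff)
    qed
    \<comment> \<open>With c = 0 one fixed point is infinity and \<open>x\<close> is the other one;
      translating it to 0 diagonalizes the matrix.\<close>
    define x where "x = b / (d - a)"
    have x: "x * (d - a) = b" using ne by (simp add: x_def)
    have "a \<noteq> 0" using ad by auto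
    then have d: "d = 1 / a" using ad by (simp add: field_simps)
    have "mat_mult (mat_mult (1, -x, 0, 1) h) (mat_inv (1, -x, 0, 1)) = (a, 0, 0, 1 / a)"
      using x by (simp add: h' True d[symmetric] algebra_simps)
    moreover have "(1, -x, 0, 1) \<in> SL2" by (simp add: SL2_def)
    ultimately show ?thesis using \<open>a \<noteq> 0\<close> by blast
  next
    case False
    define \<Delta> where "\<Delta> = (a + d)\<^sup>2 - 4"
    have "2\<^sup>2 < \<bar>a + d\<bar>\<^sup>2" using h by (intro power_strict_mono) (auto simp: h')
    then have \<Delta>: "\<Delta> > 0" by (simp add: \<Delta>_def)
    define r where "r = sqrt \<Delta>"
    have r: "r * r = (a + d)\<^sup>2 - 4" "r > 0" using \<Delta> by (auto simp: r_def \<Delta>_def)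
    \<comment> \<open>The two real fixed points of \<open>h\<close>. The vectors (x, 1) and (y, 1)
      are eigenvectors, with the eigenvalues \<open>l\<close> and \<open>l'\<close> introduced
      next.\<close>
    define x y where "x = (a - d + r) / (2 * c)" and "y = (a - d - r) / (2 * c)"
    define l l' where "l = (a + d + r) / 2" and "l' = (a + d - r) / 2"
    have ll: "l * l' = 1" using r by (simp add: l_def l'_def power2_eq_square field_simps)
    then have l0: "l \<noteq> 0" by auto
    with ll have l: "l \<noteq> 0" "l' = 1 / l" by (simp_all add: eq_divide_eq mult.commute)
    have xc: "c * x + d = l" "c * y + d = l'" using False by (simp_all add: x_def y_def l_def l'_def field_simps)
    have fx: "a * x + b = l * x" "a * y + b = l' * y"
    proof -
      have sq: "4 * (b * c) = r * r - (a - d)\<^sup>2" using r det by (simp add: power2_eq_square algebra_simps)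
      have "(2 * c) * (2 * c) * (a * x + b - (c * x + d) * x) = c * (4 * (b * c) - (r * r - (a - d)\<^sup>2))"
        using False by (simp add: x_def power2_eq_square field_simps)
      then show "a * x + b = l * x" using sq False xc by simp
      have "(2 * c) * (2 * c) * (a * y + b - (c * y + d) * y) = c * (4 * (b * c) - (r * r - (a - d)\<^sup>2))"
        using False by (simp add: y_def power2_eq_square field_simps)
      then show "a * y + b = l' * y" using sq False xc by simp
    qed
    define w where "w = x - y"
    have w: "w \<noteq> 0" using r False by (simp add: w_def x_def y_def field_simps)
    \<comment> \<open>The columns are the two eigenvectors, the second divided by x - y so that the
      determinant is 1.\<close>
    define n :: mat2 where "n = (x, y / w, 1, 1 / w)"
    have n: "n \<in> SL2" using w by (simp add: n_def SL2_def w_def diff_divide_distrib[symmetric])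
    have "mat_mult h n = (l * x, l' * y / w, l, l' / w)"
      using fx xc w by (simp add: h' n_def field_simps)
    also have "\<dots> = mat_mult n (l, 0, 0, 1 / l)"
      using l by (simp add: n_def)
    finally have "mat_mult (mat_mult (mat_inv n) h) (mat_inv (mat_inv n)) = (l, 0, 0, 1 / l)"
      using n by (simp add: mat_mult_assoc mat_mult_cancel)
    then show ?thesis using n SL2_mat_inv l by blast
  qed
  then obtain m l where ml: "m \<in> SL2" "l \<noteq> 0" and eq: "mat_conj m h = (l, 0, 0, 1 / l)" by blast
  have "\<bar>tr h\<bar> = \<bar>l + 1 / l\<bar>" using tr_conj[OF ml(1), of h] by (simp add: eq)
  then have "2 < \<bar>l + 1 / l\<bar>" using h by simp
  then have "\<bar>l\<bar> \<noteq> 1" by (auto simp: abs_if split: if_splits)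
  then consider "1 < \<bar>l\<bar>" | "\<bar>l\<bar> < 1" by linarith
  then show ?thesis
  proof cases
    case 1
    then show ?thesis using that ml eq by blast
  next
    case 2
    \<comment> \<open>z \<mapsto> -1/z exchanges 0 and infinity, and with them the two eigenvalues,
      so that the first one becomes larger than 1 in absolute value.\<close>
    define J :: mat2 where "J = (0, -1, 1, 0)"
    have J: "J \<in> SL2" by (simp add: J_def SL2_def)
    have "mat_mult (mat_mult (mat_mult J m) h) (mat_inv (mat_mult J m)) =
        mat_mult (mat_mult J (mat_conj m h)) (mat_inv J)"
      by (simp only: mat_mult_assoc mat_inv_mult)
    also have "\<dots> = (1 / l, 0, 0, 1 / (1 / l))" unfolding eq by (simp add: J_def)
    finally show ?thesis using that SL2_mat_mult[OF J ml(1)] 2 ml(2)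
      by (metis abs_divide abs_one less_divide_eq_1_pos zero_less_abs_iff)
  qed
qed

lemma parabolic_normal_form:
  assumes h: "h \<in> SL2" "\<bar>tr h\<bar> = 2" "h \<noteq> mat_id" "h \<noteq> mat_negid"
  obtains m e t where "m \<in> SL2" "e * e = 1" "t \<noteq> 0" "mat_conj m h = (e, t, 0, e)"
proof -
  obtain a b c d where h': "h = (a, b, c, d)" by (cases h)
  have det: "a * d - b * c = 1" using h by (simp add: h' SL2_def)
  have "\<bar>a + d\<bar>\<^sup>2 = 2\<^sup>2" using h(2) by (simp add: h')
  then have sq: "(a + d) * (a + d) = 4" by (simp add: power2_eq_square)
  define e where "e = (a + d) / 2"
  have e: "e * e = 1" using sq by (simp add: e_def)
  show ?thesis
  proof (cases "c = 0")
    case True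
    have "(a - d)\<^sup>2 = 0" using sq det True by (simp add: power2_eq_square algebra_simps)
    then have "a = d" by simp
    then have ee: "a = e" "d = e" by (simp_all add: e_def)
    have "e = 1 \<or> e = -1" using e by (metis square_eq_1_iff)
    then have "b \<noteq> 0" using h(3,4) by (auto simp: h' ee True mat_id_def mat_negid_def)
    moreover have "mat_conj mat_id h = (e, b, 0, e)"
      by (simp add: h' True ee mat_id_def)
    ultimately show ?thesis using that SL2_mat_id e by blast
  next
    case False
    define x where "x = (a - d) / (2 * c)"
    have xc: "c * x + d = e" "a - c * x = e" using False by (simp_all add: x_def e_def field_simps)
    have "4 * (b * c) = - (a - d)\<^sup>2" using sq det by (simp add: power2_eq_square algebra_simps)
    moreover have "(2 * c) * (2 * c) * (a * x + b - (c * x + d) * x) = c * (4 * (b * c) + (a - d)\<^sup>2)"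
      using False by (simp add: x_def power2_eq_square field_simps)
    ultimately have fx: "a * x + b = e * x" using False xc by simp
    \<comment> \<open>\<open>n\<close> maps infinity to the double fixed point \<open>x\<close>;
      conjugating by its inverse moves the cusp to infinity.\<close>
    define n :: mat2 where "n = (x, -1, 1, 0)"
    have n: "n \<in> SL2" by (simp add: n_def SL2_def)
    have "a = c * x + e" using xc by simp
    then have "mat_mult h n = mat_mult n (e, - c, 0, e)"
      using fx xc by (simp add: h' n_def algebra_simps)
    then have "mat_mult (mat_mult (mat_inv n) h) (mat_inv (mat_inv n)) = (e, - c, 0, e)"
      using n by (simp add: mat_mult_assoc mat_mult_cancel)
    then show ?thesis using that SL2_mat_inv[OF n] e False by (metis neg_equal_0_iff_equal)
  qed
qed

section \<open>Primitive elements obtained from discreteness\<close>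

lemma finite_attains_min_real:
  fixes f :: "'a \<Rightarrow> real"
  assumes "finite A" "A \<noteq> {}"
  obtains x where "x \<in> A" "\<And>y. y \<in> A \<Longrightarrow> f x \<le> f y"
  using that[OF arg_min_if_finite(1)[OF assms, of f]] arg_min_least[OF assms, of _ f] by blast

lemma hyperbolic_primitive:
  assumes G: "fuchsian G" and l: "(l, 0, 0, 1 / l) \<in> G" "1 < \<bar>l\<bar>"
  obtains l0 where "(l0, 0, 0, 1 / l0) \<in> G" "1 < \<bar>l0\<bar>" "\<bar>l0\<bar> \<le> \<bar>l\<bar>"
    "\<And>\<mu>. (\<mu>, 0, 0, 1 / \<mu>) \<in> G \<Longrightarrow> 1 < \<bar>\<mu>\<bar> \<Longrightarrow> \<bar>l0\<bar> \<le> \<bar>\<mu>\<bar>"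
proof -
  define A where "A = {\<mu>. (\<mu>, 0, 0, 1 / \<mu>) \<in> G \<and> 1 < \<bar>\<mu>\<bar> \<and> \<bar>\<mu>\<bar> \<le> \<bar>l\<bar>}"
  have "(\<lambda>\<mu>. (\<mu>, 0, 0, 1 / \<mu>)) ` A \<subseteq> {g\<in>G. mat_bound g \<le> \<bar>l\<bar>}"
  proof safe
    fix \<mu> assume \<mu>: "\<mu> \<in> A"
    then show "(\<mu>, 0, 0, 1 / \<mu>) \<in> G" by (simp add: A_def)
    have "\<bar>1 / \<mu>\<bar> \<le> 1" using \<mu> by (simp add: A_def divide_le_eq)
    also have "1 \<le> \<bar>l\<bar>" using l by simp
    finally show "mat_bound (\<mu>, 0, 0, 1 / \<mu>) \<le> \<bar>l\<bar>" using \<mu> by (simp add: A_def)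
  qed
  then have "finite ((\<lambda>\<mu>. (\<mu>, 0::real, 0::real, 1 / \<mu>)) ` A)"
    using fuchsianD(5)[OF G] finite_subset by blast
  then have "finite A" by (rule finite_imageD) (auto simp: inj_on_def)
  moreover have "l \<in> A" using l by (simp add: A_def)
  ultimately obtain l0 where l0: "l0 \<in> A" "\<And>\<mu>. \<mu> \<in> A \<Longrightarrow> \<bar>l0\<bar> \<le> \<bar>\<mu>\<bar>"
    using finite_attains_min_real[of A abs] by blast
  show ?thesis
  proof (rule that)
    show "(l0, 0, 0, 1 / l0) \<in> G" "1 < \<bar>l0\<bar>" "\<bar>l0\<bar> \<le> \<bar>l\<bar>" using l0 by (auto simp: A_def)
    fix \<mu> assume "(\<mu>, 0, 0, 1 / \<mu>) \<in> G" "1 < \<bar>\<mu>\<bar>"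
    then show "\<bar>l0\<bar> \<le> \<bar>\<mu>\<bar>" using l0(2)[of \<mu>] \<open>\<bar>l0\<bar> \<le> \<bar>l\<bar>\<close> by (cases "\<bar>\<mu>\<bar> \<le> \<bar>l\<bar>") (auto simp: A_def)
  qed
qed

text \<open>Elements fixing infinity have |a| = |d| = 1 by the stabilizer lemma, so bounding |b|
  bounds the whole matrix and a least nonzero |b| exists. The diagonal of the minimal element may
  carry the other sign, hence the fresh \<open>a0\<close> and \<open>d0\<close>.\<close>

lemma parabolic_primitive:
  assumes G: "fuchsian G" and t: "(e, t, 0, e) \<in> G" "t \<noteq> 0"
  obtains a0 t0 d0 where "(a0, t0, 0, d0) \<in> G" "t0 \<noteq> 0" "\<bar>t0\<bar> \<le> \<bar>t\<bar>"
    "\<And>a b d. (a, b, 0, d) \<in> G \<Longrightarrow> b \<noteq> 0 \<Longrightarrow> \<bar>t0\<bar> \<le> \<bar>b\<bar>"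
proof -
  define A where "A = {g\<in>G. \<exists>a b d. g = (a, b, 0, d) \<and> b \<noteq> 0 \<and> \<bar>b\<bar> \<le> \<bar>t\<bar>}"
  have "A \<subseteq> {g\<in>G. mat_bound g \<le> max 1 \<bar>t\<bar>}"
  proof
    fix g assume "g \<in> A"
    then obtain a b d where g: "g \<in> G" "g = (a, b, 0, d)" "\<bar>b\<bar> \<le> \<bar>t\<bar>" by (auto simp: A_def)
    have a: "\<bar>a\<bar> = 1" using fuchsian_parabolic_stabilizer[OF G t] g by blast
    have "a * d = 1" using fuchsianD(1)[OF G g(1)] by (simp add: g(2) SL2_def)
    then have "\<bar>a\<bar> * \<bar>d\<bar> = 1" by (simp flip: abs_mult)
    then have "\<bar>d\<bar> = 1" using a by simp
    then show "g \<in> {g\<in>G. mat_bound g \<le> max 1 \<bar>t\<bar>}" using a g by auto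
  qed
  then have "finite A" using fuchsianD(5)[OF G] finite_subset by blast
  moreover have "(e, t, 0, e) \<in> A" using t by (simp add: A_def)
  ultimately obtain g where g: "g \<in> A" "\<And>k. k \<in> A \<Longrightarrow> \<bar>fst (snd g)\<bar> \<le> \<bar>fst (snd k)\<bar>"
    using finite_attains_min_real[of A "\<lambda>g. \<bar>fst (snd g)\<bar>"] by blast
  then obtain a0 t0 d0 where g0: "g = (a0, t0, 0, d0)" "t0 \<noteq> 0" "\<bar>t0\<bar> \<le> \<bar>t\<bar>" "g \<in> G" by (auto simp: A_def)
  show ?thesis
  proof (rule that)
    fix a b d assume b: "(a, b, 0, d) \<in> G" "b \<noteq> 0"
    show "\<bar>t0\<bar> \<le> \<bar>b\<bar>"
    proof (cases "\<bar>b\<bar> \<le> \<bar>t\<bar>")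
      case True
      then have "(a, b, 0, d) \<in> A" using b by (auto simp: A_def)
      from g(2)[OF this] show ?thesis by (simp add: g0)
    qed (use g0 in auto)
  qed (use g0 in auto)
qed

subsection \<open>Strip charts\<close>

lemma pt_norm_invariant:
  assumes G: "fuchsian G" and \<phi>: "fin_area_hqd G F \<phi>" and g: "g \<in> G" "z \<in> uhp"
  shows "pt_norm \<phi> (mob g z) = pt_norm \<phi> z"
proof -
  have "\<phi> z = \<phi> (mob g z) * (mob_deriv g z)\<^sup>2" using \<phi> g by (simp add: fin_area_hqd_def)
  then show ?thesis
    by (simp add: pt_norm_def Im_mob[OF fuchsianD(1)[OF G g(1)] g(2)] norm_mult norm_power power_mult_distrib)
qed

text \<open>For k = 1 this is the L^1 norm of the differential, for k = 2 the square of its L^2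
  norm. It is kept in \<open>ennreal\<close> because finiteness for k = 2 is a result, proved
  late.\<close>

definition norm_integral :: "complex set \<Rightarrow> (complex \<Rightarrow> complex) \<Rightarrow> nat \<Rightarrow> ennreal" where
  "norm_integral F \<phi> k = (\<integral>\<^sup>+z\<in>F. ennreal (pt_norm \<phi> z ^ k) * ennreal (1 / (Im z)\<^sup>2) \<partial>lborel)"

text \<open>Supplies a globally Borel density that agrees with the power of \<open>pt_norm\<close>
  on \<open>uhp\<close>, in the form expected by the integration lemmas for invariant
  functions.\<close>

lemma norm_integral_density:
  assumes G: "fuchsian G" and F: "fundamental_set G F" and \<phi>: "fin_area_hqd G F \<phi>"
  obtains \<kappa> where "\<kappa> \<in> borel_measurable borel" "\<And>g z. g \<in> G \<Longrightarrow> z \<in> uhp \<Longrightarrow> \<kappa> (mob g z) = \<kappa> z"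
    "\<And>z. z \<in> uhp \<Longrightarrow> \<kappa> z = ennreal (pt_norm \<phi> z ^ k)"
    "hyp_integral \<kappa> F = norm_integral F \<phi> k"
proof -
  define \<kappa> where "\<kappa> z = ennreal ((cmod (if z \<in> uhp then \<phi> z else 0) * (Im z)\<^sup>2) ^ k)" for z
  have [measurable]: "(\<lambda>z. if z \<in> uhp then \<phi> z else 0) \<in> borel_measurable borel"
    by (rule borel_measurable_holomorphic_extension[OF _ open_uhp]) (use \<phi> in \<open>simp add: fin_area_hqd_def\<close>)
  have m: "\<kappa> \<in> borel_measurable borel" unfolding \<kappa>_def by measurable
  have \<kappa>: "\<kappa> z = ennreal (pt_norm \<phi> z ^ k)" if "z \<in> uhp" for z
    using that by (simp add: \<kappa>_def pt_norm_def)
  have inv: "\<kappa> (mob g z) = \<kappa> z" if "g \<in> G" "z \<in> uhp" for g z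
    using that by (simp only: \<kappa> pt_norm_invariant[OF G \<phi>] mob_uhp fuchsianD(1)[OF G])
  have "hyp_integral \<kappa> F = norm_integral F \<phi> k"
    unfolding norm_integral_def
    using F by (intro nn_integral_cong) (auto simp: indicator_def \<kappa> fundamental_set_def)
  then show ?thesis using that m inv \<kappa> by blast
qed

text \<open>A periodic parametrization of a tube around a short geodesic or of a cusp neighbourhood.
  The hyperbolic metric pulls back to \<open>\<bar>d\<zeta>\<bar>/\<tau>(Im \<zeta>)\<close>, and \<open>I\<close> is the part of the strip that embeds
  in \<open>uhp/G\<close> modulo the period \<open>t\<close>.\<close>

locale strip_chart =
  fixes G :: "mat2 set" and p :: "complex \<Rightarrow> complex" and J I :: "real set"
    and \<tau> :: "real \<Rightarrow> real" and s t :: real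
  assumes fuchsian: "fuchsian G"
    and open_J: "open J" and open_I: "open I" and convex_I: "convex I" and I_sub: "I \<subseteq> J"
    and p_holomorphic: "p holomorphic_on {\<zeta>. Im \<zeta> \<in> J}"
    and p_inj: "inj_on p {\<zeta>. Im \<zeta> \<in> J}"
    and p_uhp: "Im \<zeta> \<in> J \<Longrightarrow> p \<zeta> \<in> uhp"
    and \<tau>_measurable: "\<tau> \<in> borel_measurable borel"
    and \<tau>_pos: "y \<in> J \<Longrightarrow> 0 < \<tau> y"
    and Im_p: "Im \<zeta> \<in> J \<Longrightarrow> Im (p \<zeta>) = \<tau> (Im \<zeta>) * cmod (deriv p \<zeta>)"
    and t_pos: "0 < t"
    and period: "\<exists>g\<in>G. \<forall>\<zeta>. Im \<zeta> \<in> J \<longrightarrow> p (\<zeta> + of_real t) = mob g (p \<zeta>)"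
    and embed: "\<lbrakk>Im \<zeta> \<in> I; Im \<zeta>' \<in> I; \<bar>Re \<zeta> - Re \<zeta>'\<bar> < t; h \<in> G; mob h (p \<zeta>) = p \<zeta>'\<rbrakk> \<Longrightarrow> \<zeta> = \<zeta>'"
    and near: "\<lbrakk>y0 \<in> J; 2 * s \<le> \<tau> y0; \<bar>y - y0\<bar> < \<tau> y0 / 2\<rbrakk> \<Longrightarrow> y \<in> I \<and> \<tau> y0 / 2 \<le> \<tau> y"
begin

lemma nn_integral_strip_le:
  assumes F: "fundamental_set G F"
    and \<kappa>: "\<kappa> \<in> borel_measurable borel" "\<And>g z. g \<in> G \<Longrightarrow> z \<in> uhp \<Longrightarrow> \<kappa> (mob g z) = \<kappa> z"
  shows "(\<integral>\<^sup>+\<zeta>\<in>(period_box x t I). \<kappa> (p \<zeta>) * ennreal (1 / (\<tau> (Im \<zeta>))\<^sup>2) \<partial>lborel)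
    \<le> hyp_integral \<kappa> F"
proof (rule nn_integral_chart_le[OF fuchsian F \<kappa> p_holomorphic open_strip[OF open_J] p_inj])
  have [measurable]: "I \<in> sets borel" using open_I by simp
  show "period_box x t I \<in> sets borel" by measurable
  show "\<zeta> = \<zeta>'" if "\<zeta> \<in> period_box x t I"
      "\<zeta>' \<in> period_box x t I" "g \<in> G" "mob g (p \<zeta>) = p \<zeta>'" for \<zeta> \<zeta>' g
    using that by (intro embed[of \<zeta> \<zeta>' g]) auto
qed (use p_uhp Im_p I_sub in auto)

context
  fixes F :: "complex set" and \<phi> :: "complex \<Rightarrow> complex"
  assumes F: "fundamental_set G F" and \<phi>: "fin_area_hqd G F \<phi>"
begin

definition pullback :: "complex \<Rightarrow> complex" where
  "pullback \<zeta> = \<phi> (p \<zeta>) * (deriv p \<zeta>)\<^sup>2"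

lemma pullback_holomorphic: "pullback holomorphic_on {\<zeta>. Im \<zeta> \<in> J}"
proof -
  have "\<phi> holomorphic_on uhp" using \<phi> by (simp add: fin_area_hqd_def)
  then have "(\<lambda>\<zeta>. \<phi> (p \<zeta>)) holomorphic_on {\<zeta>. Im \<zeta> \<in> J}"
    using holomorphic_on_compose_gen[OF p_holomorphic, of \<phi> uhp] p_uhp by (auto simp: o_def)
  then show ?thesis unfolding pullback_def[abs_def]
    by (intro holomorphic_intros holomorphic_deriv p_holomorphic open_strip open_J)
qed

text \<open>Differentiating p(\<zeta> + t) = g(p(\<zeta>)) produces a factor g', and its square is
  exactly what the automorphy of \<phi> absorbs.\<close>

lemma pullback_periodic:
  assumes "Im \<zeta> \<in> J"
  shows "pullback (\<zeta> + of_real t) = pullback \<zeta>"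
proof -
  obtain g where g: "g \<in> G" "\<And>\<zeta>. Im \<zeta> \<in> J \<Longrightarrow> p (\<zeta> + of_real t) = mob g (p \<zeta>)" using period by blast
  have op: "open {\<zeta>. Im \<zeta> \<in> J}" by (rule open_strip[OF open_J])
  have d: "(p has_field_derivative deriv p w) (at w)" if "Im w \<in> J" for w
    by (rule holomorphic_derivI[OF p_holomorphic op]) (use that in simp)
  have u: "p \<zeta> \<in> uhp" by (rule p_uhp[OF assms])
  have "(p has_field_derivative deriv p (\<zeta> + of_real t)) (at (\<zeta> + of_real t))"
    by (rule d) (use assms in simp)
  then have 1: "((\<lambda>w. p (w + of_real t)) has_field_derivative deriv p (\<zeta> + of_real t)) (at \<zeta>)"
    by (simp add: DERIV_shift)
  have "((\<lambda>w. mob g (p w)) has_field_derivative mob_deriv g (p \<zeta>) * deriv p \<zeta>) (at \<zeta>)"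
    by (rule DERIV_chain2[OF mob_has_field_derivative d]) (use fuchsianD(1)[OF fuchsian g(1)] u assms in auto)
  then have "((\<lambda>w. p (w + of_real t)) has_field_derivative mob_deriv g (p \<zeta>) * deriv p \<zeta>) (at \<zeta>)"
    by (rule has_field_derivative_transform_within_open[OF _ op]) (use assms g in auto)
  then have "deriv p (\<zeta> + of_real t) = mob_deriv g (p \<zeta>) * deriv p \<zeta>" using 1 DERIV_unique by blast
  moreover have "\<phi> (mob g (p \<zeta>)) * (mob_deriv g (p \<zeta>))\<^sup>2 = \<phi> (p \<zeta>)"
    using \<phi> g u by (simp add: fin_area_hqd_def)
  ultimately show ?thesis using g(2)[OF assms]
    by (simp add: pullback_def power_mult_distrib flip: mult.assoc)
qed

lemma pt_norm_pullback:
  assumes "Im \<zeta> \<in> J"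
  shows "pt_norm \<phi> (p \<zeta>) = cmod (pullback \<zeta>) * (\<tau> (Im \<zeta>))\<^sup>2"
  by (simp add: pt_norm_def pullback_def Im_p[OF assms] norm_mult norm_power power_mult_distrib)

lemma pullback_integral_le:
  assumes L: "norm_integral F \<phi> (Suc j) \<le> ennreal L"
  shows "(\<integral>\<^sup>+\<zeta>\<in>(period_box x t I).
        ennreal ((cmod (pullback \<zeta>) * (\<tau> (Im \<zeta>))\<^sup>2) ^ Suc j) * ennreal (1 / (\<tau> (Im \<zeta>))\<^sup>2) \<partial>lborel) \<le> ennreal L"
proof -
  obtain \<kappa> where m: "\<kappa> \<in> borel_measurable borel" and inv: "\<And>g z. g \<in> G \<Longrightarrow> z \<in> uhp \<Longrightarrow> \<kappa> (mob g z) = \<kappa> z"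
    and \<kappa>: "\<And>z. z \<in> uhp \<Longrightarrow> \<kappa> z = ennreal (pt_norm \<phi> z ^ Suc j)"
    and eq: "hyp_integral \<kappa> F = norm_integral F \<phi> (Suc j)"
    by (rule norm_integral_density[OF fuchsian F \<phi>, of "Suc j"]) (rule that)
  have "(\<integral>\<^sup>+\<zeta>\<in>(period_box x t I).
        ennreal ((cmod (pullback \<zeta>) * (\<tau> (Im \<zeta>))\<^sup>2) ^ Suc j) * ennreal (1 / (\<tau> (Im \<zeta>))\<^sup>2) \<partial>lborel) =
     (\<integral>\<^sup>+\<zeta>\<in>(period_box x t I). \<kappa> (p \<zeta>) * ennreal (1 / (\<tau> (Im \<zeta>))\<^sup>2) \<partial>lborel)"
    using I_sub by (intro nn_integral_cong) (auto simp: indicator_def \<kappa> p_uhp pt_norm_pullback)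
  also have "\<dots> \<le> hyp_integral \<kappa> F"
    by (rule nn_integral_strip_le[OF F m inv])
  also note eq
  also note L
  finally show ?thesis .
qed

text \<open>\<open>2 * s \<le> \<tau> y0\<close> keeps heights within \<tau>(y0)/2 of
  \<open>y0\<close> in the embedded range, and \<open>2 * t \<le> \<tau> y0\<close> allows for discs
  wider than a period. Since only the height of \<open>\<xi>\<close> is restricted, the bound holds
  on a whole band, as the Cauchy estimate requires.\<close>

lemma pullback_pointwise:
  assumes L: "0 \<le> L" "norm_integral F \<phi> (Suc j) \<le> ennreal L"
    and y0: "y0 \<in> J" "2 * s \<le> \<tau> y0" "2 * t \<le> \<tau> y0" and \<xi>: "\<bar>Im \<xi> - y0\<bar> \<le> \<tau> y0 / 4"
  shows "(cmod (pullback \<xi>) * (\<tau> y0)\<^sup>2) ^ Suc j \<le> 6 * 4 ^ j * (\<tau> y0 / t) * L"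
proof (rule strip_pointwise_bound[OF _ open_I \<tau>_measurable L(1) pullback_integral_le[OF L(2)] t_pos _ _ \<xi>])
  show "pullback holomorphic_on {\<zeta>. Im \<zeta> \<in> I}"
    by (rule holomorphic_on_subset[OF pullback_holomorphic]) (use I_sub in auto)
  show "t \<le> \<tau> y0 / 2" using y0 by simp
  show "y \<in> I \<and> \<tau> y0 / 2 \<le> \<tau> y" if "\<bar>y - y0\<bar> < \<tau> y0 / 2" for y
    using near[OF y0(1,2) that] .
qed

text \<open>One constant \<open>c\<close> with two properties: the L^1 or L^2 norm controls its
  size, and ||\<phi>|| differs from |c| \<tau>^2 by at most 4tA/\<tau>. The latter is the Cauchy
  estimate at radius \<tau>/4, the width of the band covered by the pointwise bound.\<close>

lemma pullback_mean:
  obtains c where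
    "\<And>j L. j \<le> 1 \<Longrightarrow> norm_integral F \<phi> (Suc j) \<le> ennreal L \<Longrightarrow>
       (\<integral>\<^sup>+y\<in>I. ennreal (t * cmod c ^ Suc j) * ennreal ((\<tau> y)\<^sup>2 ^ j) \<partial>lborel) \<le> ennreal L"
    "\<And>\<zeta> A. Im \<zeta> \<in> J \<Longrightarrow> 2 * s \<le> \<tau> (Im \<zeta>) \<Longrightarrow>
       (\<And>\<xi>. \<bar>Im \<xi> - Im \<zeta>\<bar> \<le> \<tau> (Im \<zeta>) / 4 \<Longrightarrow> cmod (pullback \<xi>) * (\<tau> (Im \<zeta>))\<^sup>2 \<le> A) \<Longrightarrow>
       pt_norm \<phi> (p \<zeta>) \<le> cmod c * (\<tau> (Im \<zeta>))\<^sup>2 + 4 * t * A / \<tau> (Im \<zeta>)"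
proof -
  have hI: "pullback holomorphic_on {\<zeta>. Im \<zeta> \<in> I}"
    by (rule holomorphic_on_subset[OF pullback_holomorphic]) (use I_sub in auto)
  obtain c where c: "\<And>x y. y \<in> I \<Longrightarrow> ((\<lambda>u. pullback (Complex u y)) has_integral of_real t * c) {x..x + t}"
    using periodic_strip_mean[OF hI open_I convex_I t_pos] pullback_periodic I_sub by blast
  show ?thesis
  proof (rule that)
    fix j :: nat and L
    assume j: "j \<le> 1" and L: "norm_integral F \<phi> (Suc j) \<le> ennreal L"
    have "(\<integral>\<^sup>+y\<in>I. ennreal (t * cmod c ^ Suc j) * ennreal ((\<tau> y)\<^sup>2 ^ j) \<partial>lborel) \<le> 
      (\<integral>\<^sup>+\<zeta>\<in>(period_box 0 t I).
        ennreal ((cmod (pullback \<zeta>) * (\<tau> (Im \<zeta>))\<^sup>2) ^ Suc j) * ennreal (1 / (\<tau> (Im \<zeta>))\<^sup>2) \<partial>lborel)"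
      by (rule periodic_strip_mean_le[OF hI open_I \<tau>_measurable _ t_pos c])
         (use \<tau>_pos I_sub j in auto)
    also have "\<dots> \<le> ennreal L" by (rule pullback_integral_le[OF L])
    finally show "(\<integral>\<^sup>+y\<in>I. ennreal (t * cmod c ^ Suc j) * ennreal ((\<tau> y)\<^sup>2 ^ j) \<partial>lborel) \<le> ennreal L" .
  next
    fix \<zeta> A assume \<zeta>: "Im \<zeta> \<in> J" "2 * s \<le> \<tau> (Im \<zeta>)"
      and A: "\<And>\<xi>. \<bar>Im \<xi> - Im \<zeta>\<bar> \<le> \<tau> (Im \<zeta>) / 4 \<Longrightarrow> cmod (pullback \<xi>) * (\<tau> (Im \<zeta>))\<^sup>2 \<le> A"
    define T where "T = \<tau> (Im \<zeta>)"
    have T: "T > 0" using \<tau>_pos[OF \<zeta>(1)] by (simp add: T_def)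
    have nI: "y \<in> I" if "\<bar>y - Im \<zeta>\<bar> \<le> T / 4" for y
      using near[OF \<zeta>, of y] that T by (simp add: T_def)
    have "cmod (pullback \<zeta> - c) \<le> t * (A / T\<^sup>2) / (T / 4)"
    proof (rule periodic_strip_deviation[OF hI t_pos c])
      show "cmod (pullback \<xi>) \<le> A / T\<^sup>2" if "\<bar>Im \<xi> - Im \<zeta>\<bar> \<le> T / 4" for \<xi>
        using A[of \<xi>] that T by (simp add: T_def field_simps)
    qed (use T nI in auto)
    then have "cmod (pullback \<zeta> - c) * T\<^sup>2 \<le> t * (A / T\<^sup>2) / (T / 4) * T\<^sup>2"
      by (rule mult_right_mono) simp
    also have "\<dots> = 4 * t * A / T" using T by (simp add: field_simps)
    finally have 1: "cmod (pullback \<zeta> - c) * T\<^sup>2 \<le> 4 * t * A / T" .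
    have "pullback \<zeta> = c + (pullback \<zeta> - c)" by simp
    then have "cmod (pullback \<zeta>) \<le> cmod c + cmod (pullback \<zeta> - c)" by (metis norm_triangle_ineq)
    then have "cmod (pullback \<zeta>) * T\<^sup>2 \<le> (cmod c + cmod (pullback \<zeta> - c)) * T\<^sup>2"
      by (rule mult_right_mono) simp
    with 1 show "pt_norm \<phi> (p \<zeta>) \<le> cmod c * (\<tau> (Im \<zeta>))\<^sup>2 + 4 * t * A / \<tau> (Im \<zeta>)"
      by (simp add: pt_norm_pullback[OF \<zeta>(1)] distrib_right flip: T_def)
  qed
qed

end

end

subsection \<open>Collars and cusps\<close>

lemma mob_conj_transfer:
  assumes G: "fuchsian G" and m: "m \<in> SL2" and w: "w \<in> uhp"
  shows "k \<in> conj_group m G \<Longrightarrow>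
      \<exists>g\<in>G. \<forall>w\<in>uhp. mob g (mob (mat_inv m) w) = mob (mat_inv m) (mob k w)"
    and "\<lbrakk>h \<in> G; mob h (mob (mat_inv m) w) = mob (mat_inv m) w'; w' \<in> uhp\<rbrakk> \<Longrightarrow>
      \<exists>k\<in>conj_group m G. mob k w = w'"
proof -
  note mi = SL2_mat_inv[OF m]
  assume k: "k \<in> conj_group m G"
  have kS: "k \<in> SL2" using fuchsianD(1)[OF fuchsian_conj_group[OF G m] k] .
  define g where "g = mat_mult (mat_mult (mat_inv m) k) m"
  have gG: "g \<in> G" unfolding g_def by (rule conj_group_inverse[OF m k])
  have "mob g (mob (mat_inv m) w) = mob (mat_inv m) (mob k w)" if w: "w \<in> uhp" for w
  proof -
    have "mob g (mob (mat_inv m) w) = mob (mat_mult (mat_inv m) k) (mob m (mob (mat_inv m) w))"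
      unfolding g_def by (rule mob_mat_mult[OF m mob_uhp[OF mi w]])
    also have "\<dots> = mob (mat_inv m) (mob k w)"
      using mob_mat_inv(2)[OF m w] mob_mat_mult[OF kS w] by simp
    finally show ?thesis .
  qed
  with gG show "\<exists>g\<in>G. \<forall>w\<in>uhp. mob g (mob (mat_inv m) w) = mob (mat_inv m) (mob k w)" by blast
next
  note mi = SL2_mat_inv[OF m]
  assume h: "h \<in> G" "mob h (mob (mat_inv m) w) = mob (mat_inv m) w'" "w' \<in> uhp"
  have hS: "h \<in> SL2" using fuchsianD(1)[OF G h(1)] .
  have "mob (mat_conj m h) w = mob m (mob h (mob (mat_inv m) w))"
    using mob_mat_mult[OF mi w] mob_mat_mult[OF hS mob_uhp[OF mi w]] by simp
  also have "\<dots> = w'" using h mob_mat_inv(2)[OF m] by simp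
  finally show "\<exists>k\<in>conj_group m G. mob k w = w'" using conj_groupI[OF h(1), of m] by blast
qed

section \<open>Logarithmic charts of collars and half-plane charts of cusps\<close>

lemma abs_sin_diff_le: "\<bar>sin x - sin y\<bar> \<le> \<bar>x - y :: real\<bar>"
proof -
  have "\<bar>sin x - sin y\<bar> = 2 * (\<bar>sin ((x - y) / 2)\<bar> * \<bar>cos ((x + y) / 2)\<bar>)"
    by (simp add: sin_diff_sin abs_mult)
  also have "\<dots> \<le> 2 * (\<bar>(x - y) / 2\<bar> * 1)"
    by (intro mult_left_mono mult_mono abs_sin_x_le_abs_x abs_cos_le_one) auto
  finally show ?thesis by simp
qed

text \<open>The collar is naturally given by s < sin y, while the chart needs an open convex set of
  heights.\<close>

lemma sin_superlevel_interval:
  assumes s: "0 < s" "s < 1"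
  shows "y \<in> {arcsin s<..<pi - arcsin s} \<longleftrightarrow> 0 < y \<and> y < pi \<and> s < sin y"
proof
  have a: "0 < arcsin s" "arcsin s < pi / 2" "sin (arcsin s) = s"
    using s arcsin_less_mono[of 0 s] arcsin_less_mono[of s 1] by auto
  have half: "s < sin x" if "arcsin s < x" "x \<le> pi / 2" for x
    using sin_monotone_2pi[of "arcsin s" x] that a by auto
  { assume y: "y \<in> {arcsin s<..<pi - arcsin s}"
    have "s < sin y"
    proof (cases "y \<le> pi / 2")
      case False
      then show ?thesis using half[of "pi - y"] y by simp
    qed (use half y in auto)
    with y a show "0 < y \<and> y < pi \<and> s < sin y" by auto }
  have half': "arcsin s < x" if "0 < x" "x \<le> pi / 2" "s < sin x" for x
    using arcsin_less_mono[of s "sin x"] that s arcsin_sin[of x] by auto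
  { assume y: "0 < y \<and> y < pi \<and> s < sin y"
    have "arcsin s < y \<and> arcsin s < pi - y"
    proof (cases "y \<le> pi / 2")
      case True
      then show ?thesis using half'[of y] y a(2) by auto
    next
      case False
      then show ?thesis using half'[of "pi - y"] y a(2) by auto
    qed
    then show "y \<in> {arcsin s<..<pi - arcsin s}" by auto }
qed

text \<open>In logarithmic coordinates w \<mapsto> l^2 w becomes translation by
  \<open>2 * ln \<bar>l\<bar>\<close>, the length of the geodesic, and \<open>s\<close> is sinh of
  half that length. A non-diagonal element satisfies |bc| s^2 \<ge> 1 by the trace inequality, which
  the angle inequality forbids when both sines exceed \<open>s\<close>; a diagonal one is excluded
  by minimality of \<open>l\<close>.\<close>

lemma collar_chart:
  assumes G: "fuchsian G" "torsion_free G" and m: "m \<in> SL2"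
    and l: "(l, 0, 0, 1 / l) \<in> conj_group m G" "1 < \<bar>l\<bar>"
    and l_min: "\<And>\<mu>. (\<mu>, 0, 0, 1 / \<mu>) \<in> conj_group m G \<Longrightarrow> 1 < \<bar>\<mu>\<bar> \<Longrightarrow> \<bar>l\<bar> \<le> \<bar>\<mu>\<bar>"
    and s: "s = (\<bar>l\<bar> - 1 / \<bar>l\<bar>) / 2" "s < 1"
  shows "strip_chart G (\<lambda>\<zeta>. mob (mat_inv m) (exp \<zeta>)) {0<..<pi} {arcsin s<..<pi - arcsin s} sin s (2 * ln \<bar>l\<bar>)"
proof
  note mi = SL2_mat_inv[OF m]
  have l0: "l \<noteq> 0" using l by auto
  have "1 / \<bar>l\<bar> < 1" using l by simp
  then have "1 / \<bar>l\<bar> < \<bar>l\<bar>" using l(2) by (rule less_trans)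
  then have s0: "0 < s" by (simp add: s(1))
  have "\<bar>l - 1 / l\<bar> = \<bar>\<bar>l\<bar> - 1 / \<bar>l\<bar>\<bar>" by (cases "l > 0") (auto simp: abs_minus_commute)
  then have "(l - 1 / l)\<^sup>2 = (\<bar>l\<bar> - 1 / \<bar>l\<bar>)\<^sup>2" by (metis power2_abs)
  then have sD: "(l - 1 / l)\<^sup>2 = 4 * s\<^sup>2" unfolding s(1) by (simp only: power_divide) simp
  have G': "fuchsian (conj_group m G)" "torsion_free (conj_group m G)"
    using fuchsian_conj_group[OF G(1) m] torsion_free_conj_group[OF G(2) m] by auto
  have eu: "exp \<zeta> \<in> uhp" if "Im \<zeta> \<in> {0<..<pi}" for \<zeta>
    using that by (simp add: uhp_def Im_exp sin_gt_zero)
  have pd: "((\<lambda>\<zeta>. mob (mat_inv m) (exp \<zeta>)) has_field_derivative mob_deriv (mat_inv m) (exp \<zeta>) * exp \<zeta>) (at \<zeta>)"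
    if "Im \<zeta> \<in> {0<..<pi}" for \<zeta>
    by (rule DERIV_chain2[OF mob_has_field_derivative[OF mi eu[OF that]] DERIV_exp])
  note I = sin_superlevel_interval[OF s0 s(2)]
  show "fuchsian G" by fact
  show "open {0<..<pi}" "open {arcsin s<..<pi - arcsin s}" "convex {arcsin s<..<pi - arcsin s}"
    by auto
  show "{arcsin s<..<pi - arcsin s} \<subseteq> {0<..<pi}"
    using I by (meson greaterThanLessThan_iff subsetI)
  show "(\<lambda>\<zeta>. mob (mat_inv m) (exp \<zeta>)) holomorphic_on {\<zeta>. Im \<zeta> \<in> {0<..<pi}}"
    using holomorphic_on_compose_gen[OF holomorphic_on_exp holomorphic_mob[OF mi]] eu
    by (simp add: o_def image_subset_iff)
  show "inj_on (\<lambda>\<zeta>. mob (mat_inv m) (exp \<zeta>)) {\<zeta>. Im \<zeta> \<in> {0<..<pi}}"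
  proof (rule inj_onI)
    fix x y assume xy: "x \<in> {\<zeta>. Im \<zeta> \<in> {0<..<pi}}" "y \<in> {\<zeta>. Im \<zeta> \<in> {0<..<pi}}"
      "mob (mat_inv m) (exp x) = mob (mat_inv m) (exp y)"
    have "exp x = exp y" by (rule inj_onD[OF inj_on_mob[OF mi] xy(3)]) (use xy eu in auto)
    then show "x = y" by (rule exp_complex_eqI[rotated]) (use xy in auto)
  qed
  show "mob (mat_inv m) (exp \<zeta>) \<in> uhp" if "Im \<zeta> \<in> {0<..<pi}" for \<zeta>
    by (rule mob_uhp[OF mi eu[OF that]])
  show "(sin :: real \<Rightarrow> real) \<in> borel_measurable borel"
    by (rule borel_measurable_continuous_onI[OF continuous_on_sin[OF continuous_on_id]])
  show "0 < sin y" if "y \<in> {0<..<pi}" for y :: real using that by (simp add: sin_gt_zero)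
  show "Im (mob (mat_inv m) (exp \<zeta>)) = sin (Im \<zeta>) * cmod (deriv (\<lambda>\<zeta>. mob (mat_inv m) (exp \<zeta>)) \<zeta>)"
    if "Im \<zeta> \<in> {0<..<pi}" for \<zeta>
    unfolding DERIV_imp_deriv[OF pd[OF that]] Im_mob[OF mi eu[OF that]]
    by (simp add: norm_mult Im_exp)
  show "0 < 2 * ln \<bar>l\<bar>" using l by simp
  show "\<exists>g\<in>G. \<forall>\<zeta>. Im \<zeta> \<in> {0<..<pi} \<longrightarrow>
      mob (mat_inv m) (exp (\<zeta> + complex_of_real (2 * ln \<bar>l\<bar>))) = mob g (mob (mat_inv m) (exp \<zeta>))"
  proof -
    obtain g where g: "g \<in> G" "\<And>w. w \<in> uhp \<Longrightarrow> mob g (mob (mat_inv m) w) = mob (mat_inv m) (mob (l, 0, 0, 1 / l) w)"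
      using mob_conj_transfer(1)[OF G(1) m _ l(1), of \<i>] by (auto simp: uhp_def)
    have "exp (complex_of_real (2 * ln \<bar>l\<bar>)) = of_real (\<bar>l\<bar>\<^sup>2)"
      using l0 by (simp only: exp_of_real exp_double exp_ln zero_less_abs_iff simp_thms)
    moreover have "mob (l, 0, 0, 1 / l) w = w * of_real (\<bar>l\<bar>\<^sup>2)" for w
      using l0 by (simp add: power2_eq_square)
    ultimately have "mob (l, 0, 0, 1 / l) (exp \<zeta>) = exp (\<zeta> + complex_of_real (2 * ln \<bar>l\<bar>))" for \<zeta>
      by (simp only: exp_add)
    then have "mob (mat_inv m) (exp (\<zeta> + complex_of_real (2 * ln \<bar>l\<bar>))) = mob g (mob (mat_inv m) (exp \<zeta>))"
      if "Im \<zeta> \<in> {0<..<pi}" for \<zeta> using g(2)[OF eu[OF that]] by (simp only:)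
    with g(1) show ?thesis by blast
  qed
  show "\<zeta> = \<zeta>'" if \<zeta>: "Im \<zeta> \<in> {arcsin s<..<pi - arcsin s}" "Im \<zeta>' \<in> {arcsin s<..<pi - arcsin s}"
      "\<bar>Re \<zeta> - Re \<zeta>'\<bar> < 2 * ln \<bar>l\<bar>" "h \<in> G" "mob h (mob (mat_inv m) (exp \<zeta>)) = mob (mat_inv m) (exp \<zeta>')"
    for \<zeta> \<zeta>' h
  proof -
    have J: "Im \<zeta> \<in> {0<..<pi}" "Im \<zeta>' \<in> {0<..<pi}" and sn: "s < sin (Im \<zeta>)" "s < sin (Im \<zeta>')"
      using \<zeta>(1,2) I by auto
    obtain k where k: "k \<in> conj_group m G" "mob k (exp \<zeta>) = exp \<zeta>'"
      using mob_conj_transfer(2)[OF G(1) m eu[OF J(1)] \<zeta>(4,5) eu[OF J(2)]] by blast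
    obtain a b c d where k': "k = (a, b, c, d)" by (cases k)
    have kS: "(a, b, c, d) \<in> SL2" using fuchsianD(1)[OF G'(1)] k k' by blast
    have D: "(l - 1 / l)\<^sup>2 < 4" unfolding sD using s(2) s0 by (simp add: abs_square_less_1)
    from torsion_free_collar[OF G' l D] k k'
    consider "b = 0" "c = 0" | "4 \<le> \<bar>b * c\<bar> * (l - 1 / l)\<^sup>2" by blast
    then show ?thesis
    proof cases
      case 2
      have "(Im (exp \<zeta>) / cmod (exp \<zeta>)) * (Im (mob k (exp \<zeta>)) / cmod (mob k (exp \<zeta>))) * \<bar>b * c\<bar> \<le> 1"
        unfolding k' by (rule mob_angle_product_le[OF kS eu[OF J(1)]])
      then have "sin (Im \<zeta>) * sin (Im \<zeta>') * \<bar>b * c\<bar> \<le> 1" unfolding k(2) by (simp add: Im_exp)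
      moreover have ss: "1 \<le> \<bar>b * c\<bar> * (s * s)" using 2 unfolding sD by (simp add: power2_eq_square)
      moreover have "0 < \<bar>b * c\<bar>" using ss by (cases "b * c = 0") auto
      moreover have "s * s < sin (Im \<zeta>) * sin (Im \<zeta>')" using sn s0 by (intro mult_strict_mono) auto
      ultimately have "s * s * \<bar>b * c\<bar> < sin (Im \<zeta>) * sin (Im \<zeta>') * \<bar>b * c\<bar>"
        by (intro mult_strict_right_mono)
      then show ?thesis using ss \<open>sin (Im \<zeta>) * sin (Im \<zeta>') * \<bar>b * c\<bar> \<le> 1\<close> by (simp add: mult.commute)
    next
      case 1
      then have ad: "a * d = 1" using kS by (simp add: SL2_def)
      then have a0: "a \<noteq> 0" by auto
      with ad have d: "d = 1 / a" by (simp add: eq_divide_eq mult.commute)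
      have kd: "(a, 0, 0, 1 / a) \<in> conj_group m G" using k 1 d by (simp add: k')
      have "exp (complex_of_real (2 * ln \<bar>a\<bar>)) = of_real (\<bar>a\<bar>\<^sup>2)"
        using a0 by (simp only: exp_of_real exp_double exp_ln zero_less_abs_iff simp_thms)
      moreover have "mob k w = w * of_real (\<bar>a\<bar>\<^sup>2)" for w
        using a0 by (simp add: k' 1 d power2_eq_square)
      ultimately have "exp (\<zeta> + complex_of_real (2 * ln \<bar>a\<bar>)) = mob k (exp \<zeta>)"
        by (simp only: exp_add)
      then have "exp (\<zeta> + complex_of_real (2 * ln \<bar>a\<bar>)) = exp \<zeta>'" using k by simp
      then have eq: "\<zeta> + complex_of_real (2 * ln \<bar>a\<bar>) = \<zeta>'"
        by (rule exp_complex_eqI[rotated]) (use J in auto)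
      then have "\<bar>2 * ln \<bar>a\<bar>\<bar> < 2 * ln \<bar>l\<bar>" using \<zeta>(3) by auto
      then have lt: "\<bar>ln \<bar>a\<bar>\<bar> < ln \<bar>l\<bar>" by simp
      \<comment> \<open>A diagonal element translates by 2 ln|a|, which is shorter than the period 2
        ln|l|. Minimality, applied to the element or to its inverse, leaves only the trivial
        translation.\<close>
      have "\<bar>a\<bar> = 1"
      proof (rule ccontr)
        assume "\<bar>a\<bar> \<noteq> 1"
        then consider "1 < \<bar>a\<bar>" | "\<bar>a\<bar> < 1" by linarith
        then show False
        proof cases
          case 1
          then have "ln \<bar>l\<bar> \<le> ln \<bar>a\<bar>" using l_min[OF kd] l by simp
          then show False using lt by simp
        next
          case 2
          have "(1 / a, 0, 0, 1 / (1 / a)) \<in> conj_group m G"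
            using fuchsianD(4)[OF G'(1) kd] by simp
          then have "\<bar>l\<bar> \<le> \<bar>1 / a\<bar>" using 2 a0 by (intro l_min) auto
          then have "ln \<bar>l\<bar> \<le> ln (1 / \<bar>a\<bar>)" using l a0 by simp
          then show False using lt a0 by (simp add: ln_div)
        qed
      qed
      then show ?thesis using eq by simp
    qed
  qed
  show "y \<in> {arcsin s<..<pi - arcsin s} \<and> sin y0 / 2 \<le> sin y"
    if y: "y0 \<in> {0<..<pi}" "2 * s \<le> sin y0" "\<bar>y - y0\<bar> < sin y0 / 2" for y0 y
  proof -
    \<comment> \<open>The sine is 1-Lipschitz, so it at most halves within distance sin(y0)/2. The
      same distance keeps \<open>y\<close> in (0, pi), because sin y0 is at most y0 and at most pi -
      y0.\<close>
    have "\<bar>sin y - sin y0\<bar> \<le> \<bar>y - y0\<bar>" by (rule abs_sin_diff_le)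
    then have 1: "sin y0 / 2 < sin y" using y(3) by linarith
    have p: "sin y0 > 0" using y by (simp add: sin_gt_zero)
    have "sin y0 \<le> y0" using y by (intro sin_x_le_x) auto
    moreover have "sin (pi - y0) \<le> pi - y0" using y by (intro sin_x_le_x) auto
    then have "sin y0 \<le> pi - y0" by simp
    ultimately have "0 < y" "y < pi" using y(3) p by linarith+
    then show ?thesis using I[of y] 1 y(2) by auto
  qed
qed

text \<open>Above height \<open>s\<close>, elements with nonzero \<open>c\<close> cannot identify
  points since |c s| \<ge> 1, and the remaining ones are translations by at least |b0| or trivial.
  Allowing s = 0 covers groups in which every element fixes the cusp, which is how they are shown to
  have infinite area.\<close>

lemma cusp_chart:
  assumes G: "fuchsian G" and m: "m \<in> SL2"
    and b: "(a0, b0, 0, d0) \<in> conj_group m G" "b0 \<noteq> 0"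
    and b_min: "\<And>a b d. (a, b, 0, d) \<in> conj_group m G \<Longrightarrow> b \<noteq> 0 \<Longrightarrow> \<bar>b0\<bar> \<le> \<bar>b\<bar>"
    and a: "\<And>a b d. (a, b, 0, d) \<in> conj_group m G \<Longrightarrow> \<bar>a\<bar> = 1"
    and s: "0 \<le> s" "\<And>a b c d. (a, b, c, d) \<in> conj_group m G \<Longrightarrow> c \<noteq> 0 \<Longrightarrow> 1 \<le> (c * s)\<^sup>2"
  shows "strip_chart G (mob (mat_inv m)) {0<..} {s<..} (\<lambda>y. y) s \<bar>b0\<bar>"
proof
  note mi = SL2_mat_inv[OF m]
  have G': "fuchsian (conj_group m G)" using fuchsian_conj_group[OF G(1) m] by auto
  have ad: "d = a" if "(a, b, 0, d) \<in> conj_group m G" for a b d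
  proof -
    have "a * d = 1" using fuchsianD(1)[OF G' that] by (simp add: SL2_def)
    moreover have "a = 1 \<or> a = -1" using a[OF that] by linarith
    ultimately show ?thesis by auto
  qed
  show "fuchsian G" by fact
  show "open {0::real<..}" "open {s<..}" "convex {s<..}" "{s<..} \<subseteq> {0<..}" using s by auto
  have uhp: "{\<zeta>. Im \<zeta> \<in> {0<..}} = uhp" by (auto simp: uhp_def)
  show "mob (mat_inv m) holomorphic_on {\<zeta>. Im \<zeta> \<in> {0<..}}" "inj_on (mob (mat_inv m)) {\<zeta>. Im \<zeta> \<in> {0<..}}"
    unfolding uhp by (rule holomorphic_mob[OF mi], rule inj_on_mob[OF mi])
  show "mob (mat_inv m) \<zeta> \<in> uhp" if "Im \<zeta> \<in> {0<..}" for \<zeta>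
    using that mob_uhp[OF mi] by (simp add: uhp_def)
  show "Im (mob (mat_inv m) \<zeta>) = Im \<zeta> * cmod (deriv (mob (mat_inv m)) \<zeta>)" if "Im \<zeta> \<in> {0<..}" for \<zeta>
    using that Im_mob[OF mi] deriv_mob[OF mi] by (simp add: uhp_def)
  show "(\<lambda>y. y) \<in> borel_measurable borel" by simp
  show "0 < y" if "y \<in> {0<..}" for y :: real using that by simp
  show "0 < \<bar>b0\<bar>" using b by simp
  show "\<exists>g\<in>G. \<forall>\<zeta>. Im \<zeta> \<in> {0<..} \<longrightarrow> mob (mat_inv m) (\<zeta> + complex_of_real \<bar>b0\<bar>) = mob g (mob (mat_inv m) \<zeta>)"
  proof -
    have a0: "d0 = a0" "a0 = 1 \<or> a0 = -1" using ad[OF b(1)] a[OF b(1)] by linarith+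
    have "\<exists>k\<in>conj_group m G. \<forall>\<zeta>. mob k \<zeta> = \<zeta> + complex_of_real \<bar>b0\<bar>"
    \<comment> \<open>The matrix acts as translation by b0 a0 with a0 = 1 or -1; its inverse is
      taken when that translation is negative.\<close>
    proof (cases "b0 * a0 > 0")
      case True
      then have "\<forall>\<zeta>. mob (a0, b0, 0, d0) \<zeta> = \<zeta> + complex_of_real \<bar>b0\<bar>" using a0 by auto
      then show ?thesis using b by blast
    next
      case False
      then have "\<forall>\<zeta>. mob (mat_inv (a0, b0, 0, d0)) \<zeta> = \<zeta> + complex_of_real \<bar>b0\<bar>" using a0 b(2) by auto
      then show ?thesis using fuchsianD(4)[OF G' b(1)] by blast
    qed
    then obtain k where k: "k \<in> conj_group m G" "\<And>\<zeta>. mob k \<zeta> = \<zeta> + complex_of_real \<bar>b0\<bar>" by blast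
    obtain g where "g \<in> G" "\<And>w. w \<in> uhp \<Longrightarrow> mob g (mob (mat_inv m) w) = mob (mat_inv m) (mob k w)"
      using mob_conj_transfer(1)[OF G(1) m _ k(1), of \<i>] by (auto simp: uhp_def)
    then show ?thesis using k(2) by (auto simp: uhp_def intro!: bexI[of _ g])
  qed
  show "\<zeta> = \<zeta>'" if \<zeta>: "Im \<zeta> \<in> {s<..}" "Im \<zeta>' \<in> {s<..}" "\<bar>Re \<zeta> - Re \<zeta>'\<bar> < \<bar>b0\<bar>" "h \<in> G"
      "mob h (mob (mat_inv m) \<zeta>) = mob (mat_inv m) \<zeta>'" for \<zeta> \<zeta>' h
  proof -
    have u: "\<zeta> \<in> uhp" "\<zeta>' \<in> uhp" using \<zeta> s by (auto simp: uhp_def)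
    obtain k where k: "k \<in> conj_group m G" "mob k \<zeta> = \<zeta>'"
      using mob_conj_transfer(2)[OF G(1) m u(1) \<zeta>(4,5) u(2)] by blast
    obtain a' b' c' d' where k': "k = (a', b', c', d')" by (cases k)
    have kS: "(a', b', c', d') \<in> SL2" using fuchsianD(1)[OF G'] k k' by blast
    show ?thesis
    proof (cases "c' = 0")
      case False
      have "Im \<zeta> * Im \<zeta>' * c'\<^sup>2 \<le> 1" using mob_Im_product_le[OF kS u(1)] k k' by simp
      moreover have "s * s < Im \<zeta> * Im \<zeta>'" using \<zeta> s by (intro mult_strict_mono') auto
      then have "s * s * c'\<^sup>2 < Im \<zeta> * Im \<zeta>' * c'\<^sup>2" using False by (intro mult_strict_right_mono) auto
      moreover have "1 \<le> s * s * c'\<^sup>2" using s(2)[of a' b' c' d'] k k' False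
        by (simp add: power_mult_distrib power2_eq_square mult_ac)
      ultimately show ?thesis by linarith
    next
      case True
      then have kG: "(a', b', 0, d') \<in> conj_group m G" using k k' by simp
      have a': "d' = a'" "a' = 1 \<or> a' = -1" using ad[OF kG] a[OF kG] by linarith+
      have eq: "\<zeta>' = \<zeta> + of_real (b' * a')" using k(2) a' by (auto simp: k' True)
      then have "\<bar>b' * a'\<bar> < \<bar>b0\<bar>" using \<zeta>(3) by simp
      then have "\<bar>b'\<bar> < \<bar>b0\<bar>" using a' by auto
      then have "b' = 0" using b_min[OF kG] by linarith
      then show ?thesis using eq by simp
    qed
  qed
  show "y \<in> {s<..} \<and> y0 / 2 \<le> y" if "y0 \<in> {0<..}" "2 * s \<le> y0" "\<bar>y - y0\<bar> < y0 / 2" for y0 y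
  proof -
    have "y0 / 2 < y" using that(3) by arith
    then show ?thesis using that(2) by simp
  qed
qed

subsection \<open>The thick-thin decomposition\<close>

lemma mob_conj:
  assumes "m \<in> SL2" "g \<in> SL2" "w \<in> uhp"
  shows "mob (mat_conj m g) (mob m w) = mob m (mob g w)"
proof -
  have "mob (mat_conj m g) (mob m w) = mob (mat_mult m g) (mob (mat_inv m) (mob m w))"
    by (rule mob_mat_mult[OF SL2_mat_inv[OF assms(1)] mob_uhp[OF assms(1,3)]])
  then show ?thesis by (simp only: mob_mat_inv(1)[OF assms(1,3)] mob_mat_mult[OF assms(2,3)])
qed

lemma dsq_conj:
  assumes "m \<in> SL2" "g \<in> SL2" "w \<in> uhp"
  shows "dsq (mob m w) (mob (mat_conj m g) (mob m w)) = dsq w (mob g w)"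
  by (simp only: mob_conj[OF assms] dsq_mob[OF assms(1,3) mob_uhp[OF assms(2,3)]])

text \<open>Displacement grows away from the axis: 2 sinh(\<rho>/2) sin \<theta> = |l - 1/l| for the
  displacement \<rho> at a point with argument \<theta>. A small displacement thus bounds the
  translation length by the angle.\<close>

lemma dsq_diagonal:
  assumes "l \<noteq> 0" "w \<in> uhp"
  shows "dsq w (mob (l, 0, 0, 1 / l) w) * (Im w / cmod w)\<^sup>2 = (l - 1 / l)\<^sup>2"
proof -
  have m: "mob (l, 0, 0, 1 / l) w = of_real (l\<^sup>2) * w" using assms by (simp add: power2_eq_square)
  have "w - of_real (l\<^sup>2) * w = of_real (1 - l\<^sup>2) * w" by (simp add: algebra_simps)
  then have "(cmod (w - of_real (l\<^sup>2) * w))\<^sup>2 = (1 - l\<^sup>2)\<^sup>2 * (cmod w)\<^sup>2"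
    by (simp only: norm_mult norm_of_real power_mult_distrib power2_abs)
  moreover have "(1 - l\<^sup>2)\<^sup>2 = l\<^sup>2 * (l - 1 / l)\<^sup>2"
    using assms by (simp add: power2_eq_square field_simps)
  moreover have "cmod w \<noteq> 0" "Im w \<noteq> 0" using assms by (auto simp: uhp_def)
  ultimately show ?thesis using assms unfolding dsq_def m
    by (simp add: power2_eq_square field_simps)
qed

lemma dsq_translation:
  assumes "e * e = 1" "w \<in> uhp"
  shows "dsq w (mob (e, t, 0, e) w) * (Im w)\<^sup>2 = t\<^sup>2"
proof -
  have e: "e = 1 \<or> e = -1" using assms by (metis square_eq_1_iff)
  then have "mob (e, t, 0, e) w = w + of_real (t * e)" by auto
  moreover have "Im w \<noteq> 0" using assms by (auto simp: uhp_def)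
  ultimately show ?thesis using e by (auto simp: dsq_def power2_eq_square)
qed

lemma dsq_le_Im_ge:
  assumes z: "z \<in> uhp" and w: "w \<in> uhp" and d: "dsq z w \<le> 1 / 90"
  shows "4 / 5 * Im w \<le> Im z"
proof (rule ccontr)
  define y v where "y = Im z" and "v = Im w"
  have p: "y > 0" "v > 0" using z w by (auto simp: uhp_def y_def v_def)
  have "(cmod (z - w))\<^sup>2 \<le> y * v / 90" using d p by (simp add: dsq_def y_def v_def field_simps)
  moreover have "(y - v)\<^sup>2 \<le> (cmod (z - w))\<^sup>2" by (simp add: cmod_power2 y_def v_def)
  ultimately have 1: "(y - v)\<^sup>2 \<le> y * v / 90" by linarith
  assume "\<not> 4 / 5 * Im w \<le> Im z"
  then have lt: "y < 4 / 5 * v" by (simp add: y_def v_def)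
  then have "(v / 5)\<^sup>2 \<le> (v - y)\<^sup>2" using p by (intro power_mono) auto
  moreover have "y * v \<le> 4 / 5 * v * v" using lt p by (intro mult_right_mono) auto
  moreover have "0 < v * v" using p by simp
  ultimately show False using 1 by (simp add: power2_eq_square algebra_simps)
qed

text \<open>Transfers an angle estimate from a nearby point. Im z is at least 4/5 of Im w and |z| at
  most 9/8 of |w|, so the ratio drops at most to 32/45 of its value, which exceeds one half.\<close>

lemma dsq_le_angle_ge:
  assumes z: "z \<in> uhp" and w: "w \<in> uhp" and d: "dsq z w \<le> 1 / 90"
  shows "Im w / cmod w / 2 \<le> Im z / cmod z"
proof -
  define y v where "y = Im z" and "v = Im w"
  have p: "y > 0" "v > 0" using z w by (auto simp: uhp_def y_def v_def)
  have y1: "4 / 5 * v \<le> y" using dsq_le_Im_ge[OF z w d] by (simp add: y_def v_def)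
  have y2: "4 / 5 * y \<le> v" using dsq_le_Im_ge[OF w z] d by (simp add: dsq_commute y_def v_def)
  have "(cmod (z - w))\<^sup>2 \<le> y * v / 90" using d p by (simp add: dsq_def y_def v_def field_simps)
  also have "y * v \<le> (5 / 4 * v) * v" using y2 p by (intro mult_right_mono) auto
  finally have "(cmod (z - w))\<^sup>2 \<le> (5 / 4 * v) * v / 90" by simp
  also have "\<dots> \<le> (v / 8)\<^sup>2" using p by (simp add: power2_eq_square)
  finally have "cmod (z - w) \<le> v / 8" by (rule power2_le_imp_le) (use p in simp)
  also have vw: "v \<le> cmod w" using abs_Im_le_cmod[of w] p by (simp add: v_def)
  finally have "cmod (z - w) \<le> cmod w / 8" by simp
  moreover have "cmod z \<le> cmod w + cmod (z - w)" using norm_triangle_ineq[of w "z - w"] by simp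
  ultimately have zw: "cmod z \<le> 9 / 8 * cmod w" by simp
  have pos: "0 < cmod z" "0 < cmod w" using p vw abs_Im_le_cmod[of z] by (auto simp: y_def)
  have "v / 2 * cmod z \<le> v / 2 * (9 / 8 * cmod w)" using p zw by (intro mult_left_mono) auto
  also have "\<dots> \<le> (4 / 5 * v) * cmod w" using p pos by simp
  also have "\<dots> \<le> y * cmod w" using y1 by (rule mult_right_mono) simp
  finally show ?thesis using pos by (simp add: y_def v_def field_simps)
qed

text \<open>This is u \<le> sinh u at u = ln x. It bounds the period \<open>t\<close> of a collar
  chart by 2s.\<close>

lemma ln_le_half_diff_inverse:
  fixes x :: real
  assumes "1 \<le> x"
  shows "ln x \<le> (x - 1 / x) / 2"
proof -
  define h where "h x = (x - 1 / x) / 2 - ln x" for x :: real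
  have "h 1 \<le> h x"
  proof (rule DERIV_nonneg_imp_nondecreasing[OF assms])
    fix y :: real assume y: "1 \<le> y"
    have "(h has_real_derivative ((1 + 1 / (y * y)) / 2 - 1 / y)) (at y)"
      unfolding h_def using y by (auto intro!: derivative_eq_intros simp: power2_eq_square)
    moreover have "(1 + 1 / (y * y)) / 2 - 1 / y = (1 - 1 / y)\<^sup>2 / 2"
      using y by (simp add: power2_eq_square field_simps)
    ultimately show "\<exists>d. (h has_real_derivative d) (at y) \<and> 0 \<le> d" by fastforce
  qed
  then show ?thesis by (simp add: h_def)
qed

lemma add_inverse_mono:
  fixes x y :: real
  assumes "1 \<le> x" "x \<le> y"
  shows "x + 1 / x \<le> y + 1 / y" "x - 1 / x \<le> y - 1 / y"
proof -
  have xy: "1 * 1 \<le> x * y" using assms by (intro mult_mono) auto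
  have "0 \<le> (y - x) * (x * y - 1)" using assms xy by simp
  then show "x + 1 / x \<le> y + 1 / y" using assms by (simp add: field_simps)
  have "1 / y \<le> 1 / x" using assms by (simp add: frac_le)
  then show "x - 1 / x \<le> y - 1 / y" using assms by linarith
qed

lemma arcosh_add_inverse:
  fixes x :: real
  assumes "1 \<le> x"
  shows "arcosh ((x + 1 / x) / 2) = ln x"
proof -
  have "cosh (ln x) = (x + 1 / x) / 2" using assms by (simp add: cosh_ln_real inverse_eq_divide)
  then show ?thesis using arcosh_cosh_real[of "ln x"] assms by (metis ln_ge_zero)
qed

text \<open>One conjugation \<open>m\<close> diagonalizes both \<open>h\<close> and a primitive
  element \<open>g0\<close> with the same axis. The displacement is measured with \<open>h\<close>,
  whereas the embedded collar belongs to \<open>g0\<close>; the trace comparison links the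
  two.\<close>

lemma primitive_hyperbolic_conj:
  assumes G: "fuchsian G" and h: "h \<in> G" "2 < \<bar>tr h\<bar>"
  obtains m l l0 g0 where "m \<in> SL2" "mat_conj m h = (l, 0, 0, 1 / l)" "1 < \<bar>l\<bar>"
    "1 < \<bar>l0\<bar>" "\<bar>l0\<bar> \<le> \<bar>l\<bar>" "(l0, 0, 0, 1 / l0) \<in> conj_group m G"
    "\<And>\<mu>. (\<mu>, 0, 0, 1 / \<mu>) \<in> conj_group m G \<Longrightarrow> 1 < \<bar>\<mu>\<bar> \<Longrightarrow> \<bar>l0\<bar> \<le> \<bar>\<mu>\<bar>"
    "g0 \<in> G" "mat_conj m g0 = (l0, 0, 0, 1 / l0)"
    "\<bar>tr g0\<bar> = \<bar>l0\<bar> + 1 / \<bar>l0\<bar>" "\<bar>tr g0\<bar> \<le> \<bar>tr h\<bar>"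
proof -
  have hS: "h \<in> SL2" using fuchsianD(1)[OF G h(1)] .
  obtain m l where ml: "m \<in> SL2" "1 < \<bar>l\<bar>" "mat_conj m h = (l, 0, 0, 1 / l)"
    using hyperbolic_normal_form[OF hS h(2)] by blast
  have lG: "(l, 0, 0, 1 / l) \<in> conj_group m G" using conj_groupI[OF h(1), of m] ml by simp
  obtain l0 where l0: "(l0, 0, 0, 1 / l0) \<in> conj_group m G" "1 < \<bar>l0\<bar>" "\<bar>l0\<bar> \<le> \<bar>l\<bar>"
    "\<And>\<mu>. (\<mu>, 0, 0, 1 / \<mu>) \<in> conj_group m G \<Longrightarrow> 1 < \<bar>\<mu>\<bar> \<Longrightarrow> \<bar>l0\<bar> \<le> \<bar>\<mu>\<bar>"
    using hyperbolic_primitive[OF fuchsian_conj_group[OF G ml(1)] lG ml(2)] by blast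
  obtain g0 where g0: "g0 \<in> G" "mat_conj m g0 = (l0, 0, 0, 1 / l0)"
    using l0(1) unfolding conj_group_def by force
  have ab: "\<bar>x + 1 / x\<bar> = \<bar>x\<bar> + 1 / \<bar>x\<bar>" if "1 < \<bar>x\<bar>" for x :: real
  proof (cases "x > 0")
    case False
    then have "x < 0" "1 / x < 0" using that by auto
    then have "x + 1 / x < 0" by linarith
    then show ?thesis using \<open>x < 0\<close> by simp
  qed simp
  have "tr g0 = l0 + 1 / l0" "tr h = l + 1 / l"
    using tr_conj[OF ml(1), of g0] tr_conj[OF ml(1), of h] by (simp_all add: g0(2) ml(3))
  then have tr: "\<bar>tr g0\<bar> = \<bar>l0\<bar> + 1 / \<bar>l0\<bar>" "\<bar>tr h\<bar> = \<bar>l\<bar> + 1 / \<bar>l\<bar>" using ab l0(2) ml(2) by simp_all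
  then have "\<bar>tr g0\<bar> \<le> \<bar>tr h\<bar>" using add_inverse_mono(1)[of "\<bar>l0\<bar>" "\<bar>l\<bar>"] l0 by simp
  then show ?thesis using that ml l0 g0 tr by blast
qed

text \<open>For the primitive translation length t0 the Shimizu-type bound reads |c| t0 \<ge> 2, so
  the region above height t0/2 embeds.\<close>

lemma parabolic_cusp_chart:
  assumes G: "fuchsian G" "torsion_free G" and m: "m \<in> SL2"
    and k: "(e, t, 0, e) \<in> conj_group m G" "t \<noteq> 0"
  obtains t0 where "0 < t0" "t0 \<le> \<bar>t\<bar>" "strip_chart G (mob (mat_inv m)) {0<..} {t0 / 2<..} (\<lambda>y. y) (t0 / 2) t0"
proof -
  have G': "fuchsian (conj_group m G)" "torsion_free (conj_group m G)"
    using fuchsian_conj_group[OF G(1) m] torsion_free_conj_group[OF G(2) m] by auto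
  obtain a0 b0 d0 where b: "(a0, b0, 0, d0) \<in> conj_group m G" "b0 \<noteq> 0" "\<bar>b0\<bar> \<le> \<bar>t\<bar>"
    "\<And>a b d. (a, b, 0, d) \<in> conj_group m G \<Longrightarrow> b \<noteq> 0 \<Longrightarrow> \<bar>b0\<bar> \<le> \<bar>b\<bar>"
    using parabolic_primitive[OF G'(1) k] by blast
  have a: "\<bar>a\<bar> = 1" if "(a, b, 0, d) \<in> conj_group m G" for a b d
    using fuchsian_parabolic_stabilizer[OF G'(1) k that] .
  have "a0 * d0 = 1" using fuchsianD(1)[OF G'(1) b(1)] by (simp add: SL2_def)
  moreover have "a0 = 1 \<or> a0 = -1" using a[OF b(1)] by linarith
  ultimately have d0: "d0 = a0" by auto
  have "strip_chart G (mob (mat_inv m)) {0<..} {\<bar>b0\<bar> / 2<..} (\<lambda>y. y) (\<bar>b0\<bar> / 2) \<bar>b0\<bar>"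
  proof (rule cusp_chart[OF G(1) m b(1,2,4) a])
    fix a b c d assume "(a, b, c, d) \<in> conj_group m G" "c \<noteq> 0"
    then have "4 \<le> (c * b0)\<^sup>2"
      using torsion_free_parabolic_lower_left(1)[OF G' b(1)[unfolded d0]] b(2) by simp
    then show "1 \<le> (c * (\<bar>b0\<bar> / 2))\<^sup>2" by (simp add: power_mult_distrib power_divide)
  qed simp_all
  then show ?thesis using that[of "\<bar>b0\<bar>"] b by simp
qed

text \<open>If a Euclidean disc about \<open>z\<close> does not embed, some \<open>h\<close> moves a
  nearby point only slightly, and \<open>h\<close> is parabolic or hyperbolic. The radius Im z / 10
  is small enough that \<open>z\<close> then lies at depth \<tau> \<ge> 2s and \<tau> \<ge> 2t in
  the corresponding chart, as its estimates demand.\<close>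

lemma thick_thin:
  assumes G: "fuchsian G" "torsion_free G" and z: "z \<in> uhp"
  obtains
    (thick) "\<And>w h. w \<in> ball z (Im z / 10) \<Longrightarrow> h \<in> G \<Longrightarrow> mob h w \<in> ball z (Im z / 10) \<Longrightarrow> mob h w = w"
  | (collar) p s t l g \<zeta> where
      "strip_chart G p {0<..<pi} {arcsin s<..<pi - arcsin s} sin s t" "p \<zeta> = z" "Im \<zeta> \<in> {0<..<pi}"
      "2 * s \<le> sin (Im \<zeta>)" "2 * t \<le> sin (Im \<zeta>)" "0 < s" "s < 1" "1 < l" "t = 2 * ln l" "s = (l - 1 / l) / 2"
      "g \<in> G" "\<bar>tr g\<bar> = l + 1 / l"
  | (cusp) p s t \<zeta> where
      "strip_chart G p {0<..} {s<..} (\<lambda>y. y) s t" "p \<zeta> = z" "Im \<zeta> \<in> {0<..}" "2 * s \<le> Im \<zeta>" "2 * t \<le> Im \<zeta>"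
proof (cases "\<forall>w h. w \<in> ball z (Im z / 10) \<longrightarrow> h \<in> G \<longrightarrow> mob h w \<in> ball z (Im z / 10) \<longrightarrow> mob h w = w")
  case True
  then show ?thesis using thick by blast
next
  case False
  then obtain w h where wh: "w \<in> ball z (Im z / 10)" "h \<in> G" "mob h w \<in> ball z (Im z / 10)" "mob h w \<noteq> w" by blast
  have hS: "h \<in> SL2" using fuchsianD(1)[OF G(1) wh(2)] .
  define y where "y = Im z"
  have y: "0 < y" using z by (simp add: uhp_def y_def)
  have ball: "9 / 10 * y \<le> Im v \<and> cmod (z - v) \<le> y / 10" if "v \<in> ball z (Im z / 10)" for v
  proof -
    have 1: "cmod (z - v) < y / 10" using that by (simp add: dist_norm y_def)
    then have "Im z - Im v < y / 10" using abs_Im_le_cmod[of "z - v"] abs_ge_self[of "Im (z - v)"] by simp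
    then have "9 / 10 * y \<le> Im v" unfolding y_def by linarith
    with 1 show ?thesis by simp
  qed
  note bw = ball[OF wh(1)] and bh = ball[OF wh(3)]
  have w: "w \<in> uhp" using bw y by (auto simp: uhp_def)
  \<comment> \<open>On the disc Im w \<ge> 9/10 Im z, and (1/10)^2 / (9/10) = 1/90.\<close>
  have zw: "dsq z w \<le> 1 / 90"
  proof -
    have "(cmod (z - w))\<^sup>2 \<le> (y / 10)\<^sup>2" using bw by (intro power_mono) auto
    also have "\<dots> = 1 / 90 * (y * (9 / 10 * y))" by (simp add: power2_eq_square)
    also have "\<dots> \<le> 1 / 90 * (Im z * Im w)" using bw y by (intro mult_left_mono) (auto simp: y_def)
    finally show ?thesis using bw y z w by (simp add: dsq_def uhp_def divide_le_eq)
  qed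
  \<comment> \<open>Two points of the disc are at most Im z / 5 apart, and (1/5)^2 / (9/10)^2 = 4/81
    < 1/20.\<close>
  have wd: "dsq w (mob h w) < 1 / 20"
  proof -
    have "cmod (w - mob h w) \<le> cmod (z - w) + cmod (z - mob h w)"
      using norm_triangle_ineq4[of "z - mob h w" "z - w"] by (simp add: norm_minus_commute)
    also have "\<dots> \<le> y / 5" using bw bh by simp
    finally have "(cmod (w - mob h w))\<^sup>2 \<le> (y / 5)\<^sup>2" by (intro power_mono) auto
    also have "\<dots> < 1 / 20 * ((9 / 10 * y) * (9 / 10 * y))" using y by (simp add: power2_eq_square)
    also have "\<dots> \<le> 1 / 20 * (Im w * Im (mob h w))" using bw bh y by (intro mult_left_mono mult_mono) auto
    finally show ?thesis using w mob_uhp[OF hS w] by (simp add: dsq_def uhp_def divide_less_eq)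
  qed
  have tr2: "2 \<le> \<bar>tr h\<bar>" by (rule torsion_free_abs_tr_ge[OF G(2) wh(2)])
  show ?thesis
  proof (cases "\<bar>tr h\<bar> = 2")
    case True
    have "h \<noteq> mat_id" "h \<noteq> mat_negid" using wh(4) by (auto simp: mat_id_def mat_negid_def)
    then obtain m e t where m: "m \<in> SL2" "e * e = 1" "t \<noteq> 0" "mat_conj m h = (e, t, 0, e)"
      using parabolic_normal_form[OF hS True] by blast
    have k: "(e, t, 0, e) \<in> conj_group m G" using conj_groupI[OF wh(2), of m] m by simp
    obtain t0 where t0: "0 < t0" "t0 \<le> \<bar>t\<bar>" "strip_chart G (mob (mat_inv m)) {0<..} {t0 / 2<..} (\<lambda>y. y) (t0 / 2) t0"
      using parabolic_cusp_chart[OF G m(1) k m(3)] by blast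
    define z' w' where "z' = mob m z" and "w' = mob m w"
    have u: "z' \<in> uhp" "w' \<in> uhp" using mob_uhp[OF m(1)] z w by (auto simp: z'_def w'_def)
    have "dsq w' (mob (e, t, 0, e) w') < 1 / 20"
      using wd dsq_conj[OF m(1) hS w] by (simp only: m(4) w'_def)
    then have "dsq w' (mob (e, t, 0, e) w') * (Im w')\<^sup>2 < 1 / 20 * (Im w')\<^sup>2"
      using u by (intro mult_strict_right_mono) (auto simp: uhp_def)
    then have "\<bar>t\<bar>\<^sup>2 < 1 / 20 * (Im w')\<^sup>2" using dsq_translation[OF m(2) u(2)] by simp
    also have "\<dots> \<le> (2 / 5 * Im w')\<^sup>2" by (simp add: power_mult_distrib power_divide)
    finally have "\<bar>t\<bar> < 2 / 5 * Im w'" by (rule power2_less_imp_less) (use u in \<open>simp add: uhp_def\<close>)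
    moreover have "4 / 5 * Im w' \<le> Im z'"
      using dsq_le_Im_ge[OF u] zw dsq_mob[OF m(1) z w] by (simp add: z'_def w'_def)
    ultimately have "2 * t0 \<le> Im z'" using t0 by linarith
    then show ?thesis
      using u t0(1) mob_mat_inv(1)[OF m(1) z] by (intro cusp[OF t0(3), of z']) (auto simp: uhp_def z'_def)
  next
    case False
    then have "2 < \<bar>tr h\<bar>" using tr2 by simp
    then obtain m l l0 g0 where ml: "m \<in> SL2" "mat_conj m h = (l, 0, 0, 1 / l)" "1 < \<bar>l\<bar>"
      and l0: "1 < \<bar>l0\<bar>" "\<bar>l0\<bar> \<le> \<bar>l\<bar>" "(l0, 0, 0, 1 / l0) \<in> conj_group m G"
        "\<And>\<mu>. (\<mu>, 0, 0, 1 / \<mu>) \<in> conj_group m G \<Longrightarrow> 1 < \<bar>\<mu>\<bar> \<Longrightarrow> \<bar>l0\<bar> \<le> \<bar>\<mu>\<bar>"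
      and g0: "g0 \<in> G" "\<bar>tr g0\<bar> = \<bar>l0\<bar> + 1 / \<bar>l0\<bar>"
      using primitive_hyperbolic_conj[OF G(1) wh(2)] by metis
    define z' w' where "z' = mob m z" and "w' = mob m w"
    have u: "z' \<in> uhp" "w' \<in> uhp" using mob_uhp[OF ml(1)] z w by (auto simp: z'_def w'_def)
    define S where "S = Im w' / cmod w'"
    have "0 < Im w'" "Im w' \<le> cmod w'" using u abs_Im_le_cmod[of w'] by (auto simp: uhp_def)
    then have S: "0 < S" "S \<le> 1" unfolding S_def zero_less_divide_iff by (linarith, simp add: divide_le_eq)
    have "dsq w' (mob (l, 0, 0, 1 / l) w') < 1 / 20"
      using wd dsq_conj[OF ml(1) hS w] by (simp only: ml(2) w'_def)
    then have "dsq w' (mob (l, 0, 0, 1 / l) w') * S\<^sup>2 < 1 / 20 * S\<^sup>2"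
      using S by (intro mult_strict_right_mono) auto
    then have "(l - 1 / l)\<^sup>2 < 1 / 20 * S\<^sup>2" using dsq_diagonal[of l w'] u ml(3) by (auto simp: S_def)
    also have "\<dots> \<le> (S / 4)\<^sup>2" by (simp add: power_divide)
    finally have "\<bar>l - 1 / l\<bar> < S / 4" using power2_less_imp_less[of "\<bar>l - 1 / l\<bar>" "S / 4"] S by simp
    moreover have "\<bar>l - 1 / l\<bar> = \<bar>\<bar>l\<bar> - 1 / \<bar>l\<bar>\<bar>" by (cases "l > 0") (auto simp: abs_minus_commute)
    ultimately have "\<bar>l\<bar> - 1 / \<bar>l\<bar> < S / 4" by linarith
    define s where "s = (\<bar>l0\<bar> - 1 / \<bar>l0\<bar>) / 2"
    have "\<bar>l0\<bar> - 1 / \<bar>l0\<bar> \<le> \<bar>l\<bar> - 1 / \<bar>l\<bar>"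
      by (rule add_inverse_mono(2)) (use l0 in auto)
    then have "\<bar>l0\<bar> - 1 / \<bar>l0\<bar> < S / 4" using \<open>\<bar>l\<bar> - 1 / \<bar>l\<bar> < S / 4\<close> by (rule le_less_trans)
    then have sS: "8 * s < S" by (simp add: s_def)
    have "1 / \<bar>l0\<bar> < 1" using l0(1) by simp
    then have "1 / \<bar>l0\<bar> < \<bar>l0\<bar>" using l0(1) by (rule less_trans)
    then have s0: "0 < s" by (simp add: s_def)
    have s1: "s < 1" using sS S by linarith
    have ch: "strip_chart G (\<lambda>\<zeta>. mob (mat_inv m) (exp \<zeta>)) {0<..<pi} {arcsin s<..<pi - arcsin s} sin s (2 * ln \<bar>l0\<bar>)"
      by (rule collar_chart[OF G ml(1) l0(3,1,4) s_def s1])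
    have z'0: "z' \<noteq> 0" "0 < Im z'" using u by (auto simp: uhp_def)
    have "Im z' = cmod z' * sin (Im (Ln z'))" using Im_exp[of "Ln z'"] z'0 by (simp add: exp_Ln)
    then have sz: "sin (Im (Ln z')) = Im z' / cmod z'" using z'0 by (simp add: field_simps)
    have "S / 2 \<le> Im z' / cmod z'" unfolding S_def
      by (rule dsq_le_angle_ge[OF u]) (use zw dsq_mob[OF ml(1) z w] in \<open>simp add: z'_def w'_def\<close>)
    \<comment> \<open>The displacement bound gives 8s < S at the nearby point, and passing to
      \<open>z\<close> loses at most a factor 2. With t = 2 ln|l0| \<le> 2s, both depth conditions
      follow from 4s.\<close>
    then have s4: "4 * s \<le> sin (Im (Ln z'))" using sS sz by linarith
    have "ln \<bar>l0\<bar> \<le> s" unfolding s_def by (rule ln_le_half_diff_inverse) (use l0 in simp)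
    then have t: "2 * (2 * ln \<bar>l0\<bar>) \<le> sin (Im (Ln z'))" "2 * s \<le> sin (Im (Ln z'))" using s4 s0 by linarith+
    have eq: "mob (mat_inv m) (exp (Ln z')) = z" using z'0(1) mob_mat_inv(1)[OF ml(1) z] by (simp add: z'_def)
    have "Im (Ln z') \<in> {0<..<pi}" using Im_Ln_pos_lt_imp[OF z'0(2)] by simp
    then show ?thesis using collar[OF ch eq _ t(2,1) s0 s1 l0(1) refl s_def g0] by blast
  qed
qed

subsection \<open>Positivity of the systole\<close>

lemma nn_integral_strip_ge_rectangle:
  assumes ab: "a < b" "{a<..<b} \<subseteq> I" and \<tau>: "\<And>y. y \<in> {a<..<b} \<Longrightarrow> 0 < \<tau> y \<and> \<tau> y \<le> M" and t: "0 < t"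
    and I: "open I" and P: "\<And>\<zeta>. Im \<zeta> \<in> {a<..<b} \<Longrightarrow> \<kappa> \<zeta> = 1"
  shows "ennreal (t * (b - a) / M\<^sup>2) \<le>
    (\<integral>\<^sup>+\<zeta>\<in>(period_box x t I). \<kappa> \<zeta> * ennreal (1 / (\<tau> (Im \<zeta>))\<^sup>2) \<partial>lborel)"
proof -
  define B where "B = box (Complex x a) (Complex (x + t) b)"
  have B: "\<zeta> \<in> B \<longleftrightarrow> x < Re \<zeta> \<and> Re \<zeta> < x + t \<and> Im \<zeta> \<in> {a<..<b}" for \<zeta>
    by (auto simp: B_def box_def Basis_complex_def inner_complex_def)
  have le: "i \<in> Basis \<Longrightarrow> Complex x a \<bullet> i \<le> Complex (x + t) b \<bullet> i" for i
    using ab t by (auto simp: Basis_complex_def inner_complex_def)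
  have "emeasure lborel B = ennreal (t * (b - a))"
    unfolding B_def using emeasure_lborel_box[OF le] emeasure_lborel_complex_box(1)[OF le] by simp
  then have "ennreal (t * (b - a) / M\<^sup>2) = ennreal (1 / M\<^sup>2) * emeasure lborel B"
    using ab t by (simp flip: ennreal_mult)
  also have "\<dots> = (\<integral>\<^sup>+\<zeta>. ennreal (1 / M\<^sup>2) * indicator B \<zeta> \<partial>lborel)"
    by (subst nn_integral_cmult_indicator) (auto simp: B_def)
  also have "\<dots> \<le> (\<integral>\<^sup>+\<zeta>\<in>(period_box x t I). \<kappa> \<zeta> * ennreal (1 / (\<tau> (Im \<zeta>))\<^sup>2) \<partial>lborel)"
  proof (rule nn_integral_mono)
    fix \<zeta>
    show "ennreal (1 / M\<^sup>2) * indicator B \<zeta> \<le> \<kappa> \<zeta> * ennreal (1 / (\<tau> (Im \<zeta>))\<^sup>2) *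
        indicator (period_box x t I) \<zeta>"
    proof (cases "\<zeta> \<in> B")
      case True
      then have y: "Im \<zeta> \<in> {a<..<b}" by (simp add: B)
      have "(\<tau> (Im \<zeta>))\<^sup>2 \<le> M\<^sup>2" using \<tau>[OF y] by (intro power_mono) auto
      then have "1 / M\<^sup>2 \<le> 1 / (\<tau> (Im \<zeta>))\<^sup>2" using \<tau>[OF y] by (intro divide_left_mono mult_pos_pos) auto
      moreover have "Im \<zeta> \<in> I" using y ab by blast
      ultimately show ?thesis using True P[OF y] by (simp add: B ennreal_leI)
    qed simp
  qed
  finally show ?thesis .
qed

lemma hyp_area_eq: "hyp_area F = (\<integral>\<^sup>+z\<in>F. 1 * ennreal (1 / (Im z)\<^sup>2) \<partial>lborel)"
  by (simp add: hyp_area_def)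

text \<open>A vertical half strip reaching down to the real axis has infinite area: the rectangle at
  heights between 1/n and 2/n alone contributes at least tn/4.\<close>

lemma cusp_rectangle_unbounded:
  assumes t: "0 < t" and bd: "(\<integral>\<^sup>+\<zeta>\<in>(period_box 0 t {0<..}). 1 * ennreal (1 / (Im \<zeta>)\<^sup>2) \<partial>lborel) \<le> A"
  shows "A = \<infinity>"
proof (rule ccontr)
  assume "A \<noteq> \<infinity>"
  then obtain r where r: "A = ennreal r" "0 \<le> r" by (cases A) auto
  obtain n :: nat where n: "4 * r / t + 1 < real n" using reals_Archimedean2 by blast
  have "0 \<le> 4 * r / t" using r t by simp
  then have n0: "0 < real n" using n by linarith
  have "ennreal (t * (2 / n - 1 / n) / (2 / n)\<^sup>2) \<le> A"
    by (rule order_trans[OF nn_integral_strip_ge_rectangle bd])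
       (use n0 t in \<open>auto simp: divide_strict_right_mono\<close>)
  also have "t * (2 / n - 1 / n) / (2 / n)\<^sup>2 = t * n / 4" using n0
    by (simp add: power2_eq_square field_simps)
  finally have "t * n / 4 \<le> r" using r by simp
  moreover have "4 * r < (real n - 1) * t" using n t by (simp add: field_simps)
  ultimately show False using t by (simp add: algebra_simps)
qed

text \<open>Makes the set in \<open>systole\<close> nonempty. Without hyperbolic elements the group
  either acts trivially, so that the whole half plane embeds, or all its elements fix one cusp, so
  that a vertical half strip embeds down to the real axis. Both contradict finite area.\<close>

lemma finite_area_has_hyperbolic:
  assumes G: "fuchsian G" "torsion_free G" and F: "fundamental_set G F" "hyp_area F < \<infinity>"
  shows "\<exists>g\<in>G. 2 < \<bar>tr g\<bar>"
proof (rule ccontr)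
  assume "\<not> (\<exists>g\<in>G. 2 < \<bar>tr g\<bar>)"
  then have tr2: "\<bar>tr g\<bar> = 2" if "g \<in> G" for g using torsion_free_abs_tr_ge[OF G(2) that] that by (meson antisym not_le)
  show False
  proof (cases "\<exists>h\<in>G. h \<noteq> mat_id \<and> h \<noteq> mat_negid")
    case False
    have "(\<integral>\<^sup>+z\<in>uhp. 1 * ennreal (1 / (Im z)\<^sup>2) \<partial>lborel) \<le> (\<integral>\<^sup>+z\<in>F. 1 * ennreal (1 / (Im z)\<^sup>2) \<partial>lborel)"
    proof (rule nn_integral_le_fundamental_set[OF G(1) F(1)])
      show "mob g z = z" if "g \<in> G" for g z using False that by (auto simp: mat_id_def mat_negid_def)
    qed (use open_uhp in auto)
    then have "(\<integral>\<^sup>+z\<in>uhp. 1 * ennreal (1 / (Im z)\<^sup>2) \<partial>lborel) \<le> hyp_area F" by (simp only: hyp_area_eq)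
    moreover have "(\<integral>\<^sup>+\<zeta>\<in>(period_box 0 1 {0<..}). 1 * ennreal (1 / (Im \<zeta>)\<^sup>2) \<partial>lborel) \<le>
        (\<integral>\<^sup>+z\<in>uhp. 1 * ennreal (1 / (Im z)\<^sup>2) \<partial>lborel)"
      by (intro nn_integral_mono) (auto simp: uhp_def indicator_def)
    ultimately have "hyp_area F = \<infinity>" by (intro cusp_rectangle_unbounded[of 1] order_trans[OF _ \<open>(\<integral>\<^sup>+z\<in>uhp. 1 * ennreal (1 / (Im z)\<^sup>2) \<partial>lborel) \<le> hyp_area F\<close>]) simp_all
    then show False using F(2) by simp
  next
    case True
    then obtain h where h: "h \<in> G" "h \<noteq> mat_id" "h \<noteq> mat_negid" by blast
    obtain m e t where m: "m \<in> SL2" "e * e = 1" "t \<noteq> 0" "mat_conj m h = (e, t, 0, e)"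
      using parabolic_normal_form[OF fuchsianD(1)[OF G(1) h(1)] tr2[OF h(1)] h(2,3)] by blast
    have k: "(e, t, 0, e) \<in> conj_group m G" using conj_groupI[OF h(1), of m] m by simp
    have G': "fuchsian (conj_group m G)" "torsion_free (conj_group m G)"
      using fuchsian_conj_group[OF G(1) m(1)] torsion_free_conj_group[OF G(2) m(1)] by auto
    have tr2': "\<bar>tr k\<bar> = 2" if "k \<in> conj_group m G" for k
      using that tr2 tr_conj[OF m(1)] by (auto simp: conj_group_def)
    have c0: "c = 0" if kk: "(a, b, c, d) \<in> conj_group m G" for a b c d
    proof (rule ccontr)
      assume c: "c \<noteq> 0"
      \<comment> \<open>The square of the translation is used. For the translation itself ct = 2 or
        -2 would give the admissible trace -2; after doubling, (ct)^2 becomes at least 16 and the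
        trace at most -14.\<close>
      have k2: "(1, 2 * e * t, 0, 1) \<in> conj_group m G"
        using fuchsianD(3)[OF G'(1) k k] m(2) by (simp add: algebra_simps)
      have "4 \<le> (c * t)\<^sup>2" by (rule torsion_free_parabolic_lower_left(1)[OF G' k kk]) (use c m in simp)
      moreover have "(c * (2 * e * t))\<^sup>2 = 4 * (e * e) * (c * t)\<^sup>2" by (simp add: power2_eq_square)
      ultimately have big: "16 \<le> (c * (2 * e * t))\<^sup>2" using m(2) by simp
      let ?w = "mat_mult (mat_mult (1, 2 * e * t, 0, 1) (a, b, c, d)) (mat_mult (1, 2 * e * t, 0, 1) (mat_inv (a, b, c, d)))"
      have "?w \<in> conj_group m G" by (intro fuchsianD(3)[OF G'(1)] fuchsianD(4)[OF G'(1)] k2 kk)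
      then have "\<bar>tr ?w\<bar> = 2" by (rule tr2')
      moreover have "c * (2 * e * t) \<noteq> 0" using big by auto
      ultimately have "\<bar>2 - (c * (2 * e * t))\<^sup>2\<bar> = 2"
        using torsion_free_parabolic_lower_left(2)[OF G' k2 kk] by (simp only: simp_thms)
      then show False using big by linarith
    qed
    obtain a0 b0 d0 where b: "(a0, b0, 0, d0) \<in> conj_group m G" "b0 \<noteq> 0" "\<bar>b0\<bar> \<le> \<bar>t\<bar>"
      "\<And>a b d. (a, b, 0, d) \<in> conj_group m G \<Longrightarrow> b \<noteq> 0 \<Longrightarrow> \<bar>b0\<bar> \<le> \<bar>b\<bar>"
      using parabolic_primitive[OF G'(1) k m(3)] by blast
    interpret strip_chart G "mob (mat_inv m)" "{0<..}" "{0<..}" "\<lambda>y. y" 0 "\<bar>b0\<bar>"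
    proof (rule cusp_chart[OF G(1) m(1) b(1,2,4) fuchsian_parabolic_stabilizer[OF G'(1) k m(3)]])
      fix a b c d assume "(a, b, c, d) \<in> conj_group m G" "c \<noteq> 0"
      then show "1 \<le> (c * 0)\<^sup>2" using c0 by blast
    qed simp_all
    have "(\<integral>\<^sup>+\<zeta>\<in>(period_box 0 \<bar>b0\<bar> {0<..}). 1 * ennreal (1 / (Im \<zeta>)\<^sup>2) \<partial>lborel) \<le> hyp_area F"
      unfolding hyp_area_eq by (rule nn_integral_strip_le[OF F(1)]) auto
    then have "hyp_area F = \<infinity>" by (rule cusp_rectangle_unbounded[rotated]) (use b(2) in simp)
    then show False using F(2) by simp
  qed
qed

text \<open>A small displacement keeps the height of the image between y/2 and 2y and the image
  within a bounded Euclidean distance. This bounds |cz + d| and |az + b|, hence all entries, and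
  discreteness applies.\<close>

lemma finite_small_displacement:
  assumes G: "fuchsian G" and z: "z \<in> uhp"
  shows "finite {g\<in>G. dsq z (mob g z) < 1 / 4}"
proof -
  define y Z where "y = Im z" and "Z = cmod z"
  have y: "0 < y" "y \<le> Z" using z abs_Im_le_cmod[of z] by (auto simp: uhp_def y_def Z_def)
  \<comment> \<open>The four summands bound |c|, |d|, |a| and |b|, in this order.\<close>
  define R where "R = 2 / y + (2 + 2 * Z / y) + 4 * Z / y + (4 * Z + 4 * Z / y * Z)"
  have "{g\<in>G. dsq z (mob g z) < 1 / 4} \<subseteq> {g\<in>G. mat_bound g \<le> R}"
  proof safe
    fix a b c d assume g: "(a, b, c, d) \<in> G" and d: "dsq z (mob (a, b, c, d) z) < 1 / 4"
    have gS: "(a, b, c, d) \<in> SL2" using fuchsianD(1)[OF G g] .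
    define n v N where "n = of_real a * z + of_real b" and "v = Im (mob (a, b, c, d) z)" and "N = cmod (of_real c * z + of_real d)"
    have N0: "0 < N" using uhp_denom_nonzero[OF gS z] by (simp add: N_def)
    have v: "v * N\<^sup>2 = y" using Im_mob[OF gS z] N0
      by (simp add: v_def y_def N_def norm_divide norm_power)
    have v0: "0 < v" using mob_uhp[OF gS z] by (simp add: v_def uhp_def)
    have dd: "(cmod (z - mob (a, b, c, d) z))\<^sup>2 < y * v / 4"
      using d y(1) v0 by (simp add: dsq_def v_def y_def divide_less_eq)
    moreover have "(y - v)\<^sup>2 \<le> (cmod (z - mob (a, b, c, d) z))\<^sup>2" by (simp only: cmod_power2) (simp add: y_def v_def)
    ultimately have yv: "(y - v)\<^sup>2 < y * v / 4" by linarith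
    have v1: "y / 2 \<le> v"
    proof (rule ccontr)
      assume "\<not> y / 2 \<le> v"
      then have lt: "v < y / 2" by simp
      then have "(y / 2)\<^sup>2 \<le> (y - v)\<^sup>2" using y by (intro power_mono) auto
      moreover have "y * v \<le> y * (y / 2)" using lt y by (intro mult_left_mono) auto
      moreover have "0 < y * y" using y by simp
      ultimately show False using yv by (simp add: power2_eq_square)
    qed
    have v2: "v \<le> 2 * y"
    proof (rule ccontr)
      assume "\<not> v \<le> 2 * y"
      then have lt: "2 * y < v" by simp
      then have "(v / 2)\<^sup>2 \<le> (v - y)\<^sup>2" using y v0 by (intro power_mono) auto
      moreover have "y * v \<le> (v / 2) * v" using lt v0 by (intro mult_right_mono) auto
      moreover have "0 < v * v" using v0 by simp
      ultimately show False using yv by (simp add: power2_eq_square algebra_simps)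
    qed
    have "y / 2 * N\<^sup>2 \<le> v * N\<^sup>2" using v1 by (rule mult_right_mono) simp
    then have "N\<^sup>2 \<le> 2\<^sup>2" using v y by simp
    then have N2: "N \<le> 2" by (rule power2_le_imp_le) simp
    have "\<bar>c\<bar> * y \<le> N" using abs_Im_le_cmod[of "of_real c * z + of_real d"] y by (simp add: N_def y_def abs_mult)
    then have cb: "\<bar>c\<bar> \<le> 2 / y" using N2 y by (simp add: field_simps)
    have "cmod (of_real d) \<le> N + cmod (of_real c * z)"
      unfolding N_def using norm_triangle_ineq4[of "of_real c * z + of_real d" "of_real c * z"] by simp
    then have "\<bar>d\<bar> \<le> 2 + \<bar>c\<bar> * Z" using N2 by (simp add: norm_mult Z_def)
    also have "\<bar>c\<bar> * Z \<le> 2 / y * Z" using cb y by (intro mult_right_mono) auto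
    finally have db: "\<bar>d\<bar> \<le> 2 + 2 * Z / y" by simp
    have "y * v / 4 \<le> y * (2 * y) / 4" using v2 y by (intro divide_right_mono mult_left_mono) auto
    also have "\<dots> \<le> Z\<^sup>2"
    proof -
      have "y * y \<le> Z * Z" "0 \<le> y * y" using y by (auto intro: mult_mono)
      then show ?thesis unfolding power2_eq_square by linarith
    qed
    finally have "(cmod (z - mob (a, b, c, d) z))\<^sup>2 \<le> Z\<^sup>2" using dd by linarith
    then have "cmod (z - mob (a, b, c, d) z) \<le> Z" by (rule power2_le_imp_le) (use y in linarith)
    then have mZ: "cmod (mob (a, b, c, d) z) \<le> 2 * Z"
      using norm_triangle_ineq4[of z "z - mob (a, b, c, d) z"] by (simp add: Z_def)
    have "cmod n = cmod (mob (a, b, c, d) z) * N"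
      using N0 by (simp add: n_def N_def norm_divide)
    also have "\<dots> \<le> (2 * Z) * 2" using mZ N2 N0 y by (intro mult_mono) auto
    finally have nZ: "cmod n \<le> 4 * Z" by simp
    have "\<bar>a\<bar> * y \<le> cmod n" using abs_Im_le_cmod[of n] y by (simp add: n_def y_def abs_mult)
    then have ab: "\<bar>a\<bar> \<le> 4 * Z / y" using nZ y by (simp add: field_simps)
    have "cmod (of_real b) \<le> cmod n + cmod (of_real a * z)"
      unfolding n_def using norm_triangle_ineq4[of "of_real a * z + of_real b" "of_real a * z"] by simp
    then have "\<bar>b\<bar> \<le> 4 * Z + \<bar>a\<bar> * Z" using nZ by (simp add: norm_mult Z_def)
    also have "\<bar>a\<bar> * Z \<le> 4 * Z / y * Z" using ab y by (intro mult_right_mono) auto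
    finally have bb: "\<bar>b\<bar> \<le> 4 * Z + 4 * Z / y * Z" by simp
    have "0 \<le> 2 / y" "0 \<le> 2 * Z / y" "0 \<le> 4 * Z / y" "0 \<le> 4 * Z / y * Z" "0 \<le> Z" using y by auto
    then have "\<bar>a\<bar> \<le> R" "\<bar>b\<bar> \<le> R" "\<bar>c\<bar> \<le> R" "\<bar>d\<bar> \<le> R" unfolding R_def using ab bb cb db by linarith+
    then show "mat_bound (a, b, c, d) \<le> R" by simp
  qed
  then show ?thesis using fuchsianD(5)[OF G] finite_subset by blast
qed

text \<open>The set is invariant under \<open>G\<close>, since conjugation preserves both trace and
  displacement, so its area can be measured inside a fundamental set.\<close>

definition short_set :: "mat2 set \<Rightarrow> nat \<Rightarrow> complex set" where
  "short_set G n = {z \<in> uhp. \<exists>g\<in>G. 2 < \<bar>tr g\<bar> \<and> \<bar>tr g\<bar> < 2 + 1 / (real n + 1) \<and> dsq z (mob g z) < 1 / 4}"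

lemma short_set_measurable:
  assumes "fuchsian G"
  shows "short_set G n \<in> sets borel"
proof -
  have [measurable]: "uhp \<in> sets borel" using open_uhp by simp
  have "short_set G n = (\<Union>g\<in>{g\<in>G. 2 < \<bar>tr g\<bar> \<and> \<bar>tr g\<bar> < 2 + 1 / (real n + 1)}. {z. z \<in> uhp \<and> dsq z (mob g z) < 1 / 4})"
    by (auto simp: short_set_def)
  also have "\<dots> \<in> sets borel"
  proof (rule sets.countable_UN'')
    show "countable {g\<in>G. 2 < \<bar>tr g\<bar> \<and> \<bar>tr g\<bar> < 2 + 1 / (real n + 1)}"
      by (rule countable_subset[OF _ fuchsian_countable[OF assms]]) auto
    show "{z. z \<in> uhp \<and> dsq z (mob g z) < 1 / 4} \<in> sets borel" for g
      unfolding dsq_def by measurable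
  qed
  finally show ?thesis .
qed

lemma short_set_invariant:
  assumes G: "fuchsian G" and h: "h \<in> G" and z: "z \<in> uhp"
  shows "mob h z \<in> short_set G n \<longleftrightarrow> z \<in> short_set G n"
proof -
  have *: "mob h z \<in> short_set G n" if h: "h \<in> G" and z: "z \<in> short_set G n" for h z
  proof -
    have hS: "h \<in> SL2" using fuchsianD(1)[OF G h] .
    obtain g where g: "g \<in> G" "2 < \<bar>tr g\<bar>" "\<bar>tr g\<bar> < 2 + 1 / (real n + 1)" "dsq z (mob g z) < 1 / 4" "z \<in> uhp"
      using z by (auto simp: short_set_def)
    have "mat_conj h g \<in> G" by (intro fuchsianD(3)[OF G] fuchsianD(4)[OF G] h g)
    moreover have "dsq (mob h z) (mob (mat_conj h g) (mob h z)) < 1 / 4"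
      using dsq_conj[OF hS fuchsianD(1)[OF G g(1)] g(5)] g(4) by simp
    ultimately show ?thesis using g tr_conj[OF hS, of g] mob_uhp[OF hS g(5)] unfolding short_set_def
      by (intro CollectI conjI bexI[of _ "mat_conj h g"]) simp_all
  qed
  have "mob (mat_inv h) (mob h z) = z" using mob_mat_inv(1)[OF fuchsianD(1)[OF G h] z] .
  then show ?thesis using *[OF h] *[OF fuchsianD(4)[OF G h], of "mob h z"] by auto
qed

text \<open>Only finitely many group elements move a given point that little. The hyperbolic ones
  among them have a least absolute trace above 2, so the point drops out as soon as the threshold
  falls below it.\<close>

lemma short_set_empty_Inter:
  assumes G: "fuchsian G"
  shows "(\<Inter>n. short_set G n) = {}"
proof (rule ccontr)
  assume "(\<Inter>n. short_set G n) \<noteq> {}"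
  then obtain z where z: "\<And>n. z \<in> short_set G n" by blast
  then have u: "z \<in> uhp" by (auto simp: short_set_def)
  define Q where "Q = {g\<in>G. dsq z (mob g z) < 1 / 4 \<and> 2 < \<bar>tr g\<bar>}"
  have "finite Q" by (rule finite_subset[OF _ finite_small_displacement[OF G u]]) (auto simp: Q_def)
  moreover obtain g0 where "g0 \<in> Q" using z[of 0] unfolding short_set_def Q_def by blast
  then have "Q \<noteq> {}" by blast
  ultimately obtain g where g: "g \<in> Q" "\<And>h. h \<in> Q \<Longrightarrow> \<bar>tr g\<bar> \<le> \<bar>tr h\<bar>"
    using finite_attains_min_real[of Q "\<lambda>g. \<bar>tr g\<bar>"] by blast
  then have "0 < \<bar>tr g\<bar> - 2" by (simp add: Q_def)
  then obtain n where n: "1 / (real n + 1) < \<bar>tr g\<bar> - 2" using nat_approx_posE[of "\<bar>tr g\<bar> - 2"] by (metis of_nat_Suc add.commute)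
  obtain h where "h \<in> Q" "\<bar>tr h\<bar> < 2 + 1 / (real n + 1)" using z[of n] unfolding short_set_def Q_def by blast
  then show False using g(2)[of h] n by linarith
qed

text \<open>The part 8s < sin y < 16s of the collar has area bounded below independently of the
  length of the geodesic. There the primitive element has \<open>dsq\<close> equal to 4s^2/sin^2 y <
  1/16, well below 1/4.\<close>

lemma short_set_area_ge:
  assumes G: "fuchsian G" "torsion_free G" and F: "fundamental_set G F"
    and h: "h \<in> G" "2 < \<bar>tr h\<bar>" "\<bar>tr h\<bar> < 2 + 1 / (real n + 1)" and n: "400 \<le> n"
  shows "ennreal (1 / 32) \<le> (\<integral>\<^sup>+z\<in>F. indicator (short_set G n) z * ennreal (1 / (Im z)\<^sup>2) \<partial>lborel)"
proof -
  obtain m l l0 g0 where m: "m \<in> SL2"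
    and l0: "1 < \<bar>l0\<bar>" "\<bar>l0\<bar> \<le> \<bar>l\<bar>" "(l0, 0, 0, 1 / l0) \<in> conj_group m G"
      "\<And>\<mu>. (\<mu>, 0, 0, 1 / \<mu>) \<in> conj_group m G \<Longrightarrow> 1 < \<bar>\<mu>\<bar> \<Longrightarrow> \<bar>l0\<bar> \<le> \<bar>\<mu>\<bar>"
    and g0: "g0 \<in> G" "mat_conj m g0 = (l0, 0, 0, 1 / l0)"
      "\<bar>tr g0\<bar> = \<bar>l0\<bar> + 1 / \<bar>l0\<bar>" "\<bar>tr g0\<bar> \<le> \<bar>tr h\<bar>"
    using primitive_hyperbolic_conj[OF G(1) h(1,2)] by metis
  define L where "L = \<bar>l0\<bar>"
  have L: "1 < L" using l0 by (simp add: L_def)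
  define s where "s = (L - 1 / L) / 2"
  have "1 / L < 1" using L by simp
  then have "1 / L < L" using L by linarith
  then have s0: "0 < s" by (simp add: s_def)
  have trb: "L + 1 / L < 2 + 1 / 401"
  proof -
    have "1 / (real n + 1) \<le> 1 / 401" using n by (intro divide_left_mono) auto
    then have "\<bar>tr h\<bar> < 2 + 1 / 401" using h(3) by linarith
    with g0(4) have "\<bar>tr g0\<bar> < 2 + 1 / 401" by (rule le_less_trans)
    then show ?thesis unfolding g0(3) L_def .
  qed
  have s4: "4 * s\<^sup>2 = (L + 1 / L)\<^sup>2 - 4" using L by (simp add: s_def power2_eq_square field_simps)
  \<comment> \<open>From n \<ge> 400: 4s^2 = (L + 1/L)^2 - 4 is then small enough for 16s \<le> 1,
    so that the arcsine of 16s makes sense.\<close>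
  have "(L + 1 / L)\<^sup>2 \<le> (2 + 1 / 401)\<^sup>2" using trb L by (intro power_mono) auto
  then have "s\<^sup>2 \<le> (1 / 16)\<^sup>2" using s4 by (simp add: power2_eq_square)
  then have s16: "16 * s \<le> 1" using power2_le_imp_le[of s "1 / 16"] by simp
  have ch: "strip_chart G (\<lambda>\<zeta>. mob (mat_inv m) (exp \<zeta>)) {0<..<pi} {arcsin s<..<pi - arcsin s} sin s (2 * ln \<bar>l0\<bar>)"
    by (rule collar_chart[OF G m l0(3,1,4)]) (use s16 s0 in \<open>auto simp: s_def L_def\<close>)
  interpret strip_chart G "\<lambda>\<zeta>. mob (mat_inv m) (exp \<zeta>)" "{0<..<pi}" "{arcsin s<..<pi - arcsin s}" sin s "2 * ln L"
    using ch by (simp add: L_def)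
  define a b where "a = arcsin (8 * s)" and "b = arcsin (16 * s)"
  have sab: "sin a = 8 * s" "sin b = 16 * s" using s0 s16 by (auto simp: a_def b_def)
  have ab0: "0 \<le> a" "b \<le> pi / 2" "a < b" using s0 s16 arcsin_le_arcsin[of 0 "8 * s"] arcsin_less_arcsin[of "8 * s" "16 * s"]
      arcsin_bounded[of "16 * s"] by (auto simp: a_def b_def)
  have sy: "8 * s < sin y" "sin y \<le> 16 * s" if "y \<in> {a<..<b}" for y
  proof -
    show "8 * s < sin y" unfolding sab(1)[symmetric] by (rule sin_monotone_2pi) (use that ab0 in auto)
    show "sin y \<le> 16 * s" unfolding sab(2)[symmetric] by (rule sin_monotone_2pi_le) (use that ab0 in auto)
  qed
  have "8 * s \<le> b - a" using abs_sin_diff_le[of b a] ab0 s0 by (simp add: sab)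
  have sub: "{a<..<b} \<subseteq> {arcsin s<..<pi - arcsin s}"
  proof
    fix y assume y: "y \<in> {a<..<b}"
    have "0 < y \<and> y < pi \<and> s < sin y" using sy(1)[OF y] y ab0 s0 pi_gt_zero by auto
    then show "y \<in> {arcsin s<..<pi - arcsin s}" using sin_superlevel_interval[of s y] s0 s16 by simp
  qed
  have mem: "mob (mat_inv m) (exp \<zeta>) \<in> short_set G n" if y: "Im \<zeta> \<in> {a<..<b}" for \<zeta>
  proof -
    have J: "Im \<zeta> \<in> {0<..<pi}" using y sub I_sub by blast
    then have eu: "exp \<zeta> \<in> uhp" by (simp add: uhp_def Im_exp sin_gt_zero)
    define w where "w = mob (mat_inv m) (exp \<zeta>)"
    have wu: "w \<in> uhp" unfolding w_def by (rule p_uhp[OF J])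
    have mw: "mob m w = exp \<zeta>" unfolding w_def by (rule mob_mat_inv(2)[OF m eu])
    have "dsq w (mob g0 w) = dsq (exp \<zeta>) (mob (l0, 0, 0, 1 / l0) (exp \<zeta>))"
      using dsq_conj[OF m fuchsianD(1)[OF G(1) g0(1)] wu] by (simp only: g0(2) mw)
    moreover have "dsq (exp \<zeta>) (mob (l0, 0, 0, 1 / l0) (exp \<zeta>)) * (sin (Im \<zeta>))\<^sup>2 = (l0 - 1 / l0)\<^sup>2"
      using dsq_diagonal[OF _ eu, of l0] l0(1) by (auto simp: Im_exp)
    moreover have "(l0 - 1 / l0)\<^sup>2 = 4 * s\<^sup>2"
    proof -
      have "\<bar>l0 - 1 / l0\<bar> = \<bar>L - 1 / L\<bar>" unfolding L_def by (cases "l0 > 0") (auto simp: abs_minus_commute)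
      then have "(l0 - 1 / l0)\<^sup>2 = (L - 1 / L)\<^sup>2" by (metis power2_abs)
      then show ?thesis by (simp add: s_def power_divide)
    qed
    ultimately have d: "dsq w (mob g0 w) * (sin (Im \<zeta>))\<^sup>2 = 4 * s\<^sup>2" by simp
    have "(8 * s)\<^sup>2 < (sin (Im \<zeta>))\<^sup>2" using sy(1)[OF y] s0 by (intro power_strict_mono) auto
    then have "64 * s\<^sup>2 < (sin (Im \<zeta>))\<^sup>2" by (simp add: power_mult_distrib)
    then have "4 * s\<^sup>2 < 1 / 4 * (sin (Im \<zeta>))\<^sup>2" using zero_le_power2[of s] by linarith
    then have "dsq w (mob g0 w) < 1 / 4" unfolding d[symmetric]
      by (rule mult_right_less_imp_less) simp
    moreover have "2 < \<bar>tr g0\<bar>"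
    proof -
      have "0 < s\<^sup>2" using s0 by simp
      then have "4 < (L + 1 / L)\<^sup>2" using s4 by linarith
      then have "2\<^sup>2 < (L + 1 / L)\<^sup>2" by simp
      then have "2 < L + 1 / L" by (rule power2_less_imp_less) (use L in simp)
      then show ?thesis by (simp add: g0(3) L_def)
    qed
    ultimately show ?thesis using wu g0 h(3) unfolding short_set_def w_def[symmetric] by fastforce
  qed
  have L2: "L \<le> 2"
  proof (rule ccontr)
    assume "\<not> L \<le> 2"
    then have "2 - 1 / 2 \<le> L - 1 / L" by (intro add_inverse_mono(2)) auto
    then show False using s16 by (simp add: s_def)
  qed
  have "s \<le> 2 * ln L"
  proof -
    have "ln (1 / L) \<le> 1 / L - 1" using L by (intro ln_le_minus_one) auto
    then have "1 - 1 / L \<le> ln L" using L by (simp add: ln_div)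
    moreover have "s \<le> L - 1" using add_inverse_mono(1)[of 1 L] L by (simp add: s_def)
    moreover have "(L - 1) / 2 \<le> (L - 1) / L" using L L2 by (intro divide_left_mono) auto
    then have "(L - 1) / 2 \<le> 1 - 1 / L" using L by (simp add: diff_divide_distrib)
    then have "(L - 1) / 2 \<le> ln L" using \<open>1 - 1 / L \<le> ln L\<close> by (rule order_trans)
    ultimately show ?thesis using \<open>s \<le> L - 1\<close> by argo
  qed
  \<comment> \<open>Period at least s, height difference at least 8s, density at least 1/(16s)^2:
    the quotient 8s^2/(256 s^2) = 1/32 is free of s.\<close>
  then have "s * (8 * s) \<le> 2 * ln L * (b - a)" using \<open>8 * s \<le> b - a\<close> s0 by (intro mult_mono) auto
  then have "s * (8 * s) / (16 * s)\<^sup>2 \<le> 2 * ln L * (b - a) / (16 * s)\<^sup>2" by (rule divide_right_mono) simp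
  moreover have "s * (8 * s) / (16 * s)\<^sup>2 = 1 / 32" using s0 by (simp add: power2_eq_square)
  ultimately have "ennreal (1 / 32) \<le> ennreal (2 * ln L * (b - a) / (16 * s)\<^sup>2)" by (intro ennreal_leI) simp
  also have "\<dots> \<le> (\<integral>\<^sup>+\<zeta>\<in>(period_box 0 (2 * ln L) {arcsin s<..<pi - arcsin s}).
      indicator (short_set G n) (mob (mat_inv m) (exp \<zeta>)) * ennreal (1 / (sin (Im \<zeta>))\<^sup>2) \<partial>lborel)"
  proof (rule nn_integral_strip_ge_rectangle[OF ab0(3) sub _ t_pos open_I])
    show "0 < sin y \<and> sin y \<le> 16 * s" if "y \<in> {a<..<b}" for y
      using sy[OF that] s0 by auto
  qed (use mem in simp)
  also have "\<dots> \<le> (\<integral>\<^sup>+z\<in>F. indicator (short_set G n) z * ennreal (1 / (Im z)\<^sup>2) \<partial>lborel)"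
  proof (rule nn_integral_strip_le[OF F])
    show "indicator (short_set G n) \<in> borel_measurable borel"
      using short_set_measurable[OF G(1)] by simp
  qed (use short_set_invariant[OF G(1)] in \<open>auto simp: indicator_def\<close>)
  finally show ?thesis .
qed

lemma trace_gap:
  assumes G: "fuchsian G" "torsion_free G" and F: "fundamental_set G F" "hyp_area F < \<infinity>"
  obtains \<eta> where "0 < \<eta>" "\<And>g. g \<in> G \<Longrightarrow> 2 < \<bar>tr g\<bar> \<Longrightarrow> 2 + \<eta> \<le> \<bar>tr g\<bar>"
proof (rule ccontr)
  assume no: "\<not> thesis"
  have ex: "\<exists>g\<in>G. 2 < \<bar>tr g\<bar> \<and> \<bar>tr g\<bar> < 2 + 1 / (real n + 1)" for n
    using that[of "1 / (real n + 1)"] no by (metis not_le of_nat_0_le_iff zero_less_divide_1_iff add_nonneg_pos zero_less_one)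
  have [measurable]: "F \<in> sets borel" using F by (simp add: fundamental_set_def)
  define \<nu> where "\<nu> = density lborel (\<lambda>z. ennreal (1 / (Im z)\<^sup>2))"
  define A where "A n = F \<inter> short_set G n" for n
  have Am: "A n \<in> sets borel" for n unfolding A_def using short_set_measurable[OF G(1)] by measurable
  have em: "emeasure \<nu> B = (\<integral>\<^sup>+z\<in>B. ennreal (1 / (Im z)\<^sup>2) \<partial>lborel)" if "B \<in> sets borel" for B
    unfolding \<nu>_def by (rule emeasure_density) (use that in auto)
  have "decseq A"
  proof (rule decseq_SucI)
    fix n
    have "1 / (real (Suc n) + 1) \<le> 1 / (real n + 1)" by (intro divide_left_mono) auto
    then show "A (Suc n) \<subseteq> A n" unfolding A_def short_set_def by force
  qed
  moreover have "emeasure \<nu> (A n) \<noteq> \<infinity>" for n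
  proof -
    have "emeasure \<nu> (A n) \<le> emeasure \<nu> F" by (rule emeasure_mono) (auto simp: A_def \<nu>_def)
    also have "\<dots> = hyp_area F" by (simp add: em hyp_area_def)
    finally show ?thesis using F(2) by auto
  qed
  \<comment> \<open>Continuity from above, legitimate because \<open>F\<close> has finite area. The
    limit 0 will contradict the uniform lower bound 1/32.\<close>
  ultimately have "(\<lambda>n. emeasure \<nu> (A n)) \<longlonglongrightarrow> emeasure \<nu> (\<Inter>n. A n)"
    using Am by (intro Lim_emeasure_decseq) (auto simp: \<nu>_def)
  moreover have "(\<Inter>n. A n) = {}" using short_set_empty_Inter[OF G(1)] by (auto simp: A_def)
  ultimately have lim: "(\<lambda>n. emeasure \<nu> (A n)) \<longlonglongrightarrow> 0" by simp
  have "ennreal (1 / 32) \<le> emeasure \<nu> (A n)" if "400 \<le> n" for n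
  proof -
    obtain g where "g \<in> G" "2 < \<bar>tr g\<bar>" "\<bar>tr g\<bar> < 2 + 1 / (real n + 1)" using ex by blast
    then have "ennreal (1 / 32) \<le> (\<integral>\<^sup>+z\<in>F. indicator (short_set G n) z * ennreal (1 / (Im z)\<^sup>2) \<partial>lborel)"
      by (rule short_set_area_ge[OF G F(1)]) fact
    also have "\<dots> = emeasure \<nu> (A n)" unfolding em[OF Am]
      by (intro nn_integral_cong) (auto simp: A_def indicator_def)
    finally show ?thesis .
  qed
  then have "ennreal (1 / 32) \<le> 0"
    by (intro tendsto_lowerbound[OF lim]) (auto simp: eventually_sequentially)
  then show False by simp
qed

text \<open>The trace gap bounds all lengths away from 0, which also makes the infimum a genuine
  lower bound. The second part allows the period of a collar chart to be compared with the systole: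
  trace l + 1/l belongs to length 2 ln l.\<close>

lemma systole_pos:
  assumes G: "fuchsian G" "torsion_free G" and F: "fundamental_set G F" "hyp_area F < \<infinity>"
  shows "0 < systole G"
    and "\<And>g l. g \<in> G \<Longrightarrow> 1 < l \<Longrightarrow> \<bar>tr g\<bar> = l + 1 / l \<Longrightarrow> systole G \<le> 2 * ln l"
proof -
  define X where "X = {2 * arcosh (\<bar>tr g\<bar> / 2) | g. g \<in> G \<and> hyperbolic g}"
  obtain \<eta> where \<eta>: "0 < \<eta>" "\<And>g. g \<in> G \<Longrightarrow> 2 < \<bar>tr g\<bar> \<Longrightarrow> 2 + \<eta> \<le> \<bar>tr g\<bar>"
    using trace_gap[OF G F] by blast
  have lb: "2 * arcosh (1 + \<eta> / 2) \<le> x" if x: "x \<in> X" for x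
  proof -
    obtain g where g: "g \<in> G" "2 < \<bar>tr g\<bar>" "x = 2 * arcosh (\<bar>tr g\<bar> / 2)" using x unfolding X_def hyperbolic_def by blast
    then have "1 + \<eta> / 2 \<le> \<bar>tr g\<bar> / 2" using \<eta>(2)[of g] by simp
    then have "arcosh (1 + \<eta> / 2) \<le> arcosh (\<bar>tr g\<bar> / 2)"
    proof (cases "1 + \<eta> / 2 = \<bar>tr g\<bar> / 2")
      case False
      with \<open>1 + \<eta> / 2 \<le> \<bar>tr g\<bar> / 2\<close> have "1 + \<eta> / 2 < \<bar>tr g\<bar> / 2" by linarith
      with \<eta>(1) show ?thesis by (intro less_imp_le arcosh_real_strict_mono) auto
    qed (simp only: order_refl)
    then show ?thesis using g by simp
  qed
  have "X \<noteq> {}" using finite_area_has_hyperbolic[OF G F] unfolding X_def hyperbolic_def by blast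
  then have "2 * arcosh (1 + \<eta> / 2) \<le> Inf X" using lb by (rule cInf_greatest)
  moreover have "0 < arcosh (1 + \<eta> / 2)" using \<eta>(1) by simp
  ultimately show "0 < systole G" by (simp add: systole_def X_def)
  fix g l assume g: "g \<in> G" "1 < l" "\<bar>tr g\<bar> = l + 1 / l"
  have "0 < (l - 1) * (l - 1)" using g by simp
  then have "2 < l + 1 / l" using g by (simp add: field_simps)
  then have "hyperbolic g" using g by (simp add: hyperbolic_def)
  then have "2 * arcosh (\<bar>tr g\<bar> / 2) \<in> X" using g(1) unfolding X_def by blast
  then have "Inf X \<le> 2 * arcosh (\<bar>tr g\<bar> / 2)" using lb by (intro cInf_lower bdd_belowI)
  then show "systole G \<le> 2 * ln l" using arcosh_add_inverse[of l] g by (simp add: systole_def X_def)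
qed

subsection \<open>Pointwise bounds\<close>

text \<open>The mean value property on an embedded disc of radius Im z / 10. With Im w \<ge> 9/10 Im
  z on the disc, the constant is (100/pi)(100/81)^j, less than 50 for j \<le> 1.\<close>

lemma thick_pointwise:
  assumes G: "fuchsian G" and F: "fundamental_set G F" and \<phi>: "fin_area_hqd G F \<phi>" and z: "z \<in> uhp"
    and emb: "\<And>w h. w \<in> ball z (Im z / 10) \<Longrightarrow> h \<in> G \<Longrightarrow> mob h w \<in> ball z (Im z / 10) \<Longrightarrow> mob h w = w"
    and L: "0 \<le> L" "norm_integral F \<phi> (Suc j) \<le> ennreal L" and j: "j \<le> 1"
  shows "pt_norm \<phi> z ^ Suc j \<le> 50 * L"
proof -
  define y where "y = Im z"
  have y: "0 < y" using z by (simp add: uhp_def y_def)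
  define B where "B = ball z (y / 10)"
  have Bi: "w \<in> uhp \<and> 9 / 10 * y \<le> Im w" if "w \<in> B" for w
  proof -
    have "Im z - Im w < y / 10" using that abs_Im_le_cmod[of "z - w"] abs_ge_self[of "Im (z - w)"]
      by (simp add: B_def dist_norm)
    then have "9 / 10 * y \<le> Im w" unfolding y_def by linarith
    then show ?thesis using y by (simp add: uhp_def)
  qed
  obtain \<kappa> where \<kappa>: "\<kappa> \<in> borel_measurable borel" "\<And>g z. g \<in> G \<Longrightarrow> z \<in> uhp \<Longrightarrow> \<kappa> (mob g z) = \<kappa> z"
    and \<kappa>_eq: "\<And>z. z \<in> uhp \<Longrightarrow> \<kappa> z = ennreal (pt_norm \<phi> z ^ Suc j)"
    and eq: "hyp_integral \<kappa> F = norm_integral F \<phi> (Suc j)"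
    by (rule norm_integral_density[OF G F \<phi>, of "Suc j"]) (rule that)
  define M where "M = ((9 / 10 * y)\<^sup>2) ^ j"
  have M: "0 < M" using y by (simp add: M_def)
  have "ennreal (M * (pi * (y / 10)\<^sup>2 * cmod (\<phi> z) ^ Suc j)) \<le>
      ennreal M * (\<integral>\<^sup>+w\<in>B. ennreal (cmod (\<phi> w) ^ Suc j) \<partial>lborel)"
  proof -
    have "\<phi> holomorphic_on ball z (y / 10)"
      by (rule holomorphic_on_subset[of \<phi> uhp]) (use \<phi> Bi in \<open>auto simp: fin_area_hqd_def B_def\<close>)
    then have "ennreal (pi * (y / 10)\<^sup>2 * cmod (\<phi> z) ^ Suc j) \<le> (\<integral>\<^sup>+w\<in>B. ennreal (cmod (\<phi> w) ^ Suc j) \<partial>lborel)"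
      unfolding B_def by (rule holomorphic_power_area_mean_le) (use y in simp)
    then show ?thesis using M by (subst ennreal_mult) (auto intro: mult_left_mono)
  qed
  also have "\<dots> = (\<integral>\<^sup>+w. ennreal M * (ennreal (cmod (\<phi> w) ^ Suc j) * indicator B w) \<partial>lborel)"
  proof (rule nn_integral_cmult[symmetric])
    define \<psi> where "\<psi> z = (if z \<in> uhp then \<phi> z else 0)" for z
    have [measurable]: "\<psi> \<in> borel_measurable borel" unfolding \<psi>_def
      by (rule borel_measurable_holomorphic_extension[OF _ open_uhp]) (use \<phi> in \<open>simp add: fin_area_hqd_def\<close>)
    have [measurable]: "B \<in> sets borel" by (simp add: B_def)
    have "(\<lambda>w. ennreal (cmod (\<psi> w) ^ Suc j) * indicator B w) \<in> borel_measurable lborel"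
      by measurable
    also have "(\<lambda>w. ennreal (cmod (\<psi> w) ^ Suc j) * indicator B w) =
        (\<lambda>w. ennreal (cmod (\<phi> w) ^ Suc j) * indicator B w)"
      using Bi by (auto simp: fun_eq_iff indicator_def \<psi>_def)
    finally show "(\<lambda>w. ennreal (cmod (\<phi> w) ^ Suc j) * indicator B w) \<in> borel_measurable lborel" .
  qed
  also have "\<dots> \<le> (\<integral>\<^sup>+w\<in>B. \<kappa> w * ennreal (1 / (Im w)\<^sup>2) \<partial>lborel)"
  proof (rule nn_integral_mono)
    fix w
    show "ennreal M * (ennreal (cmod (\<phi> w) ^ Suc j) * indicator B w) \<le> \<kappa> w * ennreal (1 / (Im w)\<^sup>2) * indicator B w"
    proof (cases "w \<in> B")
      case True
      note w = Bi[OF True]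
      have "M \<le> ((Im w)\<^sup>2) ^ j" unfolding M_def using w y by (intro power_mono) auto
      then have "M * cmod (\<phi> w) ^ Suc j \<le> ((Im w)\<^sup>2) ^ j * cmod (\<phi> w) ^ Suc j" by (rule mult_right_mono) simp
      also have "\<dots> = pt_norm \<phi> w ^ Suc j * (1 / (Im w)\<^sup>2)"
        using w y by (simp add: pt_norm_def power_mult_distrib)
      finally have "ennreal (M * cmod (\<phi> w) ^ Suc j) \<le> ennreal (pt_norm \<phi> w ^ Suc j * (1 / (Im w)\<^sup>2))"
        by (rule ennreal_leI)
      moreover have "ennreal (M * cmod (\<phi> w) ^ Suc j) = ennreal M * ennreal (cmod (\<phi> w) ^ Suc j)"
        by (rule ennreal_mult) (use M in auto)
      moreover have "ennreal (pt_norm \<phi> w ^ Suc j * (1 / (Im w)\<^sup>2)) = ennreal (pt_norm \<phi> w ^ Suc j) * ennreal (1 / (Im w)\<^sup>2)"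
        by (rule ennreal_mult) (auto simp: pt_norm_def)
      ultimately show ?thesis using True w by (simp only: \<kappa>_eq indicator_simps mult_1_right)
    qed simp
  qed
  also have "\<dots> \<le> hyp_integral \<kappa> F"
    by (rule nn_integral_le_fundamental_set[OF G F \<kappa>]) (use Bi emb in \<open>auto simp: B_def y_def\<close>)
  also have "\<dots> \<le> ennreal L" using eq L(2) by simp
  finally have main: "M * (pi * (y / 10)\<^sup>2 * cmod (\<phi> z) ^ Suc j) \<le> L" using L by simp
  have "pt_norm \<phi> z ^ Suc j = cmod (\<phi> z) ^ Suc j * (y\<^sup>2 * (y\<^sup>2) ^ j)"
    by (simp add: pt_norm_def y_def power_mult_distrib)
  also have "\<dots> = (100 / pi) * (100 / 81) ^ j * (M * (pi * (y / 10)\<^sup>2 * cmod (\<phi> z) ^ Suc j))"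
    using y by (simp add: M_def power_mult_distrib power_divide)
  also have "\<dots> \<le> (100 / pi) * (100 / 81) ^ j * L"
    by (intro mult_left_mono main) auto
  also have "\<dots> \<le> 50 * L"
  proof (rule mult_right_mono[OF _ L(1)])
    have "(100 / pi) * (100 / 81 :: real) ^ j \<le> (100 / 3) * (100 / 81)"
      using j pi_gt3 by (intro mult_mono) (auto simp: le_Suc_eq divide_le_eq)
    then show "(100 / pi) * (100 / 81 :: real) ^ j \<le> 50" by simp
  qed
  finally show ?thesis .
qed

text \<open>The pointwise bound has a factor \<tau>/t in L^1 and its square root in L^2, whereas the
  deviation 4tA/\<tau> carries t/\<tau>. The remainders 24 L and 14 N are therefore independent of
  the period.\<close>

lemma strip_mean_bound:
  assumes ch: "strip_chart G p J I \<tau> s t" and F: "fundamental_set G F" and \<phi>: "fin_area_hqd G F \<phi>"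
  obtains c where
    "\<And>j L. j \<le> 1 \<Longrightarrow> norm_integral F \<phi> (Suc j) \<le> ennreal L \<Longrightarrow>
       (\<integral>\<^sup>+y\<in>I. ennreal (t * cmod c ^ Suc j) * ennreal ((\<tau> y)\<^sup>2 ^ j) \<partial>lborel) \<le> ennreal L"
    "\<And>\<zeta> L. Im \<zeta> \<in> J \<Longrightarrow> 2 * s \<le> \<tau> (Im \<zeta>) \<Longrightarrow> 2 * t \<le> \<tau> (Im \<zeta>) \<Longrightarrow> 0 \<le> L \<Longrightarrow>
       norm_integral F \<phi> 1 \<le> ennreal L \<Longrightarrow> pt_norm \<phi> (p \<zeta>) \<le> cmod c * (\<tau> (Im \<zeta>))\<^sup>2 + 24 * L"
    "\<And>\<zeta> N. Im \<zeta> \<in> J \<Longrightarrow> 2 * s \<le> \<tau> (Im \<zeta>) \<Longrightarrow> 2 * t \<le> \<tau> (Im \<zeta>) \<Longrightarrow> 0 \<le> N \<Longrightarrow>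
       norm_integral F \<phi> 2 \<le> ennreal (N\<^sup>2) \<Longrightarrow> pt_norm \<phi> (p \<zeta>) \<le> cmod c * (\<tau> (Im \<zeta>))\<^sup>2 + 14 * N"
proof -
  interpret strip_chart G p J I \<tau> s t by (rule ch)
  obtain c where c: "\<And>j L. j \<le> 1 \<Longrightarrow> norm_integral F \<phi> (Suc j) \<le> ennreal L \<Longrightarrow>
       (\<integral>\<^sup>+y\<in>I. ennreal (t * cmod c ^ Suc j) * ennreal ((\<tau> y)\<^sup>2 ^ j) \<partial>lborel) \<le> ennreal L"
    and dev: "\<And>\<zeta> A. Im \<zeta> \<in> J \<Longrightarrow> 2 * s \<le> \<tau> (Im \<zeta>) \<Longrightarrow>
       (\<And>\<xi>. \<bar>Im \<xi> - Im \<zeta>\<bar> \<le> \<tau> (Im \<zeta>) / 4 \<Longrightarrow> cmod (pullback \<phi> \<xi>) * (\<tau> (Im \<zeta>))\<^sup>2 \<le> A) \<Longrightarrow>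
       pt_norm \<phi> (p \<zeta>) \<le> cmod c * (\<tau> (Im \<zeta>))\<^sup>2 + 4 * t * A / \<tau> (Im \<zeta>)"
  proof (rule pullback_mean[OF F \<phi>], goal_cases)
    case (1 c)
    show ?case by (rule 1(1)[OF 1(2,3)])
  qed
  show ?thesis
  proof (rule that[OF c])
    fix \<zeta> and L :: real
    assume \<zeta>: "Im \<zeta> \<in> J" "2 * s \<le> \<tau> (Im \<zeta>)" "2 * t \<le> \<tau> (Im \<zeta>)"
    have T: "0 < \<tau> (Im \<zeta>)" by (rule \<tau>_pos[OF \<zeta>(1)])
    { assume L: "0 \<le> L" "norm_integral F \<phi> 1 \<le> ennreal L"
      have "pt_norm \<phi> (p \<zeta>) \<le> cmod c * (\<tau> (Im \<zeta>))\<^sup>2 + 4 * t * (6 * (\<tau> (Im \<zeta>) / t) * L) / \<tau> (Im \<zeta>)"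
      proof (rule dev[OF \<zeta>(1,2)])
        fix \<xi> assume "\<bar>Im \<xi> - Im \<zeta>\<bar> \<le> \<tau> (Im \<zeta>) / 4"
        from pullback_pointwise[OF F \<phi> L(1) _ \<zeta> this, of 0] L(2)
        show "cmod (pullback \<phi> \<xi>) * (\<tau> (Im \<zeta>))\<^sup>2 \<le> 6 * (\<tau> (Im \<zeta>) / t) * L" by simp
      qed
      also have "4 * t * (6 * (\<tau> (Im \<zeta>) / t) * L) / \<tau> (Im \<zeta>) = 24 * L" using T t_pos by simp
      finally show "pt_norm \<phi> (p \<zeta>) \<le> cmod c * (\<tau> (Im \<zeta>))\<^sup>2 + 24 * L" . }
    { assume L: "0 \<le> L" "norm_integral F \<phi> 2 \<le> ennreal (L\<^sup>2)"
      define A where "A = sqrt (24 * (\<tau> (Im \<zeta>) / t)) * L"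
      have A0: "0 \<le> A" using L T t_pos by (simp add: A_def)
      have A2: "A\<^sup>2 = 24 * (\<tau> (Im \<zeta>) / t) * L\<^sup>2" using T t_pos by (simp add: A_def power_mult_distrib)
      have "pt_norm \<phi> (p \<zeta>) \<le> cmod c * (\<tau> (Im \<zeta>))\<^sup>2 + 4 * t * A / \<tau> (Im \<zeta>)"
      proof (rule dev[OF \<zeta>(1,2)])
        fix \<xi> assume "\<bar>Im \<xi> - Im \<zeta>\<bar> \<le> \<tau> (Im \<zeta>) / 4"
        then have "(cmod (pullback \<phi> \<xi>) * (\<tau> (Im \<zeta>))\<^sup>2) ^ Suc 1 \<le> 6 * 4 ^ 1 * (\<tau> (Im \<zeta>) / t) * L\<^sup>2"
          by (intro pullback_pointwise[OF F \<phi> _ _ \<zeta>]) (use L(2) in \<open>simp_all only: Suc_1 zero_le_power2\<close>)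
        also have "\<dots> = A\<^sup>2" by (simp add: A2)
        finally have "(cmod (pullback \<phi> \<xi>) * (\<tau> (Im \<zeta>))\<^sup>2)\<^sup>2 \<le> A\<^sup>2" by (simp only: Suc_1)
        then show "cmod (pullback \<phi> \<xi>) * (\<tau> (Im \<zeta>))\<^sup>2 \<le> A" by (rule power2_le_imp_le[OF _ A0])
      qed
      also have "4 * t * A / \<tau> (Im \<zeta>) \<le> 14 * L"
      \<comment> \<open>The squared remainder is 384 (t/\<tau>) N^2, at most 192 N^2 because 2t
        \<le> \<tau>, and 192 \<le> 14^2.\<close>
      proof (rule power2_le_imp_le)
        have "(4 * t * A / \<tau> (Im \<zeta>))\<^sup>2 = 384 * (t / \<tau> (Im \<zeta>)) * L\<^sup>2"
          using T t_pos by (simp add: power_divide power_mult_distrib A2) (simp add: power2_eq_square)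
        also have "\<dots> \<le> 384 * (1 / 2) * L\<^sup>2"
          using \<zeta>(3) T by (intro mult_right_mono mult_left_mono) (auto simp: divide_le_eq)
        also have "\<dots> \<le> (14 * L)\<^sup>2" by (simp add: power_mult_distrib)
        finally show "(4 * t * A / \<tau> (Im \<zeta>))\<^sup>2 \<le> (14 * L)\<^sup>2" .
      qed (use L in simp)
      finally show "pt_norm \<phi> (p \<zeta>) \<le> cmod c * (\<tau> (Im \<zeta>))\<^sup>2 + 14 * L" by simp }
  qed
qed

text \<open>Integrability of \<open>\<phi>\<close> forces the constant term of its expansion at a cusp to vanish.\<close>

lemma cusp_bound:
  assumes ch: "strip_chart G p {0<..} {s<..} (\<lambda>y. y) s t" and F: "fundamental_set G F" and \<phi>: "fin_area_hqd G F \<phi>"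
    and \<zeta>: "Im \<zeta> \<in> {0<..}" "2 * s \<le> Im \<zeta>" "2 * t \<le> Im \<zeta>"
    and L: "0 \<le> L" "norm_integral F \<phi> 1 \<le> ennreal L"
  shows "pt_norm \<phi> (p \<zeta>) \<le> 24 * L"
    and "\<And>N. 0 \<le> N \<Longrightarrow> norm_integral F \<phi> 2 \<le> ennreal (N\<^sup>2) \<Longrightarrow> pt_norm \<phi> (p \<zeta>) \<le> 14 * N"
proof -
  have t: "0 < t" using ch by (simp add: strip_chart_def)
  obtain c where c: "\<And>j L. j \<le> 1 \<Longrightarrow> norm_integral F \<phi> (Suc j) \<le> ennreal L \<Longrightarrow>
       (\<integral>\<^sup>+y\<in>{s<..}. ennreal (t * cmod c ^ Suc j) * ennreal (y\<^sup>2 ^ j) \<partial>lborel) \<le> ennreal L"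
    and b: "\<And>\<zeta> L. Im \<zeta> \<in> {0<..} \<Longrightarrow> 2 * s \<le> Im \<zeta> \<Longrightarrow> 2 * t \<le> Im \<zeta> \<Longrightarrow> 0 \<le> L \<Longrightarrow>
       norm_integral F \<phi> 1 \<le> ennreal L \<Longrightarrow> pt_norm \<phi> (p \<zeta>) \<le> cmod c * (Im \<zeta>)\<^sup>2 + 24 * L"
      "\<And>\<zeta> N. Im \<zeta> \<in> {0<..} \<Longrightarrow> 2 * s \<le> Im \<zeta> \<Longrightarrow> 2 * t \<le> Im \<zeta> \<Longrightarrow> 0 \<le> N \<Longrightarrow>
       norm_integral F \<phi> 2 \<le> ennreal (N\<^sup>2) \<Longrightarrow> pt_norm \<phi> (p \<zeta>) \<le> cmod c * (Im \<zeta>)\<^sup>2 + 14 * N"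
    by (rule strip_mean_bound[OF ch F \<phi>]) (rule that)
  have c1: "(\<integral>\<^sup>+y\<in>{s<..}. ennreal (t * cmod c) \<partial>lborel) \<le> ennreal L" using c[of 0 L] L by simp
  have "c = 0"
  proof (rule ccontr)
    assume "c \<noteq> 0"
    then have tc: "0 < t * cmod c" using t by simp
    \<comment> \<open>The cusp strip has infinite height: its part of height \<open>n\<close>
      already contributes t |c| n, which exceeds \<open>L\<close> for this \<open>n\<close>.\<close>
    obtain n :: nat where n: "L / (t * cmod c) < real n" using reals_Archimedean2 by blast
    have "ennreal (t * cmod c * real n) = (\<integral>\<^sup>+y\<in>{s<..<s + real n}. ennreal (t * cmod c) \<partial>lborel)"
      using tc by (subst nn_integral_cmult_indicator) (auto simp: ennreal_mult)
    also have "\<dots> \<le> (\<integral>\<^sup>+y\<in>{s<..}. ennreal (t * cmod c) \<partial>lborel)"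
      by (intro nn_integral_mono) (auto simp: indicator_def)
    also note c1
    finally have "t * cmod c * real n \<le> L" using L by simp
    then show False using n tc by (simp add: field_simps)
  qed
  then show "pt_norm \<phi> (p \<zeta>) \<le> 24 * L"
    and "\<And>N. 0 \<le> N \<Longrightarrow> norm_integral F \<phi> 2 \<le> ennreal (N\<^sup>2) \<Longrightarrow> pt_norm \<phi> (p \<zeta>) \<le> 14 * N"
    using b(1)[OF \<zeta> L] b(2)[OF \<zeta>] by simp_all
qed

text \<open>The exact value is pi/2 - \<beta> + sin \<beta> cos \<beta>; the last term is
  nonnegative and is dropped.\<close>

lemma sin_squared_integral_ge:
  assumes \<beta>: "0 < \<beta>" "\<beta> < pi / 2"
  shows "ennreal (pi / 2 - \<beta>) \<le> (\<integral>\<^sup>+y\<in>{\<beta>..pi - \<beta>}. ennreal ((sin y)\<^sup>2) \<partial>lborel)"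
proof -
  define Q where "Q y = (y - sin y * cos y) / 2" for y :: real
  have "((\<lambda>y. (sin y)\<^sup>2) has_integral (Q (pi - \<beta>) - Q \<beta>)) {\<beta>..pi - \<beta>}"
  proof (rule fundamental_theorem_of_calculus)
    fix y assume "y \<in> {\<beta>..pi - \<beta>}"
    have "(Q has_real_derivative (1 - (cos y * cos y - sin y * sin y)) / 2) (at y within {\<beta>..pi - \<beta>})"
      unfolding Q_def by (auto intro!: derivative_eq_intros)
    also have "(1 - (cos y * cos y - sin y * sin y)) / 2 = (sin y)\<^sup>2"
      using sin_cos_squared_add[of y] by (simp add: power2_eq_square algebra_simps)
    finally show "(Q has_vector_derivative (sin y)\<^sup>2) (at y within {\<beta>..pi - \<beta>})"
      by (simp add: has_real_derivative_iff_has_vector_derivative)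
  qed (use \<beta> in simp)
  then have "(\<integral>\<^sup>+y\<in>{\<beta>..pi - \<beta>}. ennreal ((sin y)\<^sup>2) \<partial>lborel) = ennreal (Q (pi - \<beta>) - Q \<beta>)"
    by (rule nn_integral_has_integral_lebesgue'[rotated]) simp
  moreover have "0 \<le> sin \<beta> * cos \<beta>" using \<beta> by (intro mult_nonneg_nonneg sin_ge_zero cos_ge_zero) auto
  then have "pi / 2 - \<beta> \<le> Q (pi - \<beta>) - Q \<beta>" by (simp add: Q_def field_simps)
  ultimately show ?thesis by (simp add: ennreal_leI)
qed

text \<open>The first bound serves to show that ||\<phi>|| is bounded, the second handles periods
  that are not small, and the third is the sharp one. In it \<beta> truncates the collar to heights
  between \<beta> and pi - \<beta>, which lie in the embedded range as soon as s < sin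
  \<beta>.\<close>

lemma collar_bound:
  assumes ch: "strip_chart G p {0<..<pi} {arcsin s<..<pi - arcsin s} sin s t"
    and F: "fundamental_set G F" and \<phi>: "fin_area_hqd G F \<phi>"
    and \<zeta>: "Im \<zeta> \<in> {0<..<pi}" "2 * s \<le> sin (Im \<zeta>)" "2 * t \<le> sin (Im \<zeta>)" and s: "0 < s" "s < 1"
  shows "\<And>L. 0 \<le> L \<Longrightarrow> norm_integral F \<phi> 1 \<le> ennreal L \<Longrightarrow> pt_norm \<phi> (p \<zeta>) \<le> 6 / t * L"
    and "\<And>N. 0 \<le> N \<Longrightarrow> norm_integral F \<phi> 2 \<le> ennreal (N\<^sup>2) \<Longrightarrow> pt_norm \<phi> (p \<zeta>) \<le> sqrt (24 / t) * N"
    and "\<And>N \<beta>. 0 \<le> N \<Longrightarrow> norm_integral F \<phi> 2 \<le> ennreal (N\<^sup>2) \<Longrightarrow> 0 < \<beta> \<Longrightarrow> \<beta> < pi / 2 \<Longrightarrow> s < sin \<beta> \<Longrightarrow>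
      pt_norm \<phi> (p \<zeta>) \<le> N / sqrt (t * (pi / 2 - \<beta>)) + 14 * N"
proof -
  interpret strip_chart G p "{0<..<pi}" "{arcsin s<..<pi - arcsin s}" sin s t by (rule ch)
  define T where "T = sin (Im \<zeta>)"
  have T: "0 < T" "T \<le> 1" using \<zeta> by (auto simp: T_def sin_gt_zero)
  note pp = pullback_pointwise[OF F \<phi> _ _ \<zeta>, of _ _ \<zeta>, folded T_def]
  have pn: "pt_norm \<phi> (p \<zeta>) = cmod (pullback \<phi> \<zeta>) * T\<^sup>2"
    using pt_norm_pullback[OF F \<phi> \<zeta>(1)] by (simp add: T_def)
  have Tt: "T / t \<le> 1 / t" using T t_pos by (intro divide_right_mono) auto
  { fix L assume L: "0 \<le> L" "norm_integral F \<phi> 1 \<le> ennreal L"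
    have "pt_norm \<phi> (p \<zeta>) \<le> 6 * (T / t) * L" using pp[of L 0] L T by (simp add: pn)
    also have "\<dots> \<le> 6 * (1 / t) * L" using Tt L by (intro mult_right_mono mult_left_mono) auto
    finally show "pt_norm \<phi> (p \<zeta>) \<le> 6 / t * L" by simp }
  { fix N assume N: "0 \<le> N" "norm_integral F \<phi> 2 \<le> ennreal (N\<^sup>2)"
    have "(pt_norm \<phi> (p \<zeta>))\<^sup>2 \<le> 24 * (T / t) * N\<^sup>2" using pp[of "N\<^sup>2" 1] N T by (simp add: pn numeral_2_eq_2)
    also have "\<dots> \<le> 24 * (1 / t) * N\<^sup>2" using Tt by (intro mult_right_mono mult_left_mono) auto
    also have "\<dots> = (sqrt (24 / t) * N)\<^sup>2" using t_pos by (simp add: power_mult_distrib)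
    finally show "pt_norm \<phi> (p \<zeta>) \<le> sqrt (24 / t) * N"
      by (rule power2_le_imp_le) (use N t_pos in simp) }
  fix N \<beta> assume N: "0 \<le> N" "norm_integral F \<phi> 2 \<le> ennreal (N\<^sup>2)" and \<beta>: "0 < \<beta>" "\<beta> < pi / 2" "s < sin \<beta>"
  obtain c where c: "\<And>j L. j \<le> 1 \<Longrightarrow> norm_integral F \<phi> (Suc j) \<le> ennreal L \<Longrightarrow>
       (\<integral>\<^sup>+y\<in>{arcsin s<..<pi - arcsin s}. ennreal (t * cmod c ^ Suc j) * ennreal ((sin y)\<^sup>2 ^ j) \<partial>lborel) \<le> ennreal L"
    and b: "\<And>\<zeta> N. Im \<zeta> \<in> {0<..<pi} \<Longrightarrow> 2 * s \<le> sin (Im \<zeta>) \<Longrightarrow> 2 * t \<le> sin (Im \<zeta>) \<Longrightarrow> 0 \<le> N \<Longrightarrow>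
       norm_integral F \<phi> 2 \<le> ennreal (N\<^sup>2) \<Longrightarrow> pt_norm \<phi> (p \<zeta>) \<le> cmod c * (sin (Im \<zeta>))\<^sup>2 + 14 * N"
    by (rule strip_mean_bound[OF ch F \<phi>]) (rule that)
  have sub: "{\<beta>..pi - \<beta>} \<subseteq> {arcsin s<..<pi - arcsin s}"
  proof -
    have "\<beta> \<in> {arcsin s<..<pi - arcsin s}"
      using sin_superlevel_interval[OF s, of \<beta>] \<beta> by auto
    then show ?thesis by auto
  qed
  have "ennreal (t * (cmod c)\<^sup>2 * (pi / 2 - \<beta>)) = ennreal (t * (cmod c)\<^sup>2) * ennreal (pi / 2 - \<beta>)"
    using t_pos \<beta> by (simp add: ennreal_mult)
  also have "\<dots> \<le> ennreal (t * (cmod c)\<^sup>2) * (\<integral>\<^sup>+y\<in>{\<beta>..pi - \<beta>}. ennreal ((sin y)\<^sup>2) \<partial>lborel)"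
    by (intro mult_left_mono sin_squared_integral_ge \<beta>) auto
  also have "\<dots> = (\<integral>\<^sup>+y. ennreal (t * (cmod c)\<^sup>2) * (ennreal ((sin y)\<^sup>2) * indicator {\<beta>..pi - \<beta>} y) \<partial>lborel)"
    by (rule nn_integral_cmult[symmetric]) measurable
  also have "\<dots> \<le> (\<integral>\<^sup>+y\<in>{arcsin s<..<pi - arcsin s}. ennreal (t * cmod c ^ Suc 1) * ennreal ((sin y)\<^sup>2 ^ 1) \<partial>lborel)"
    using sub by (intro nn_integral_mono) (auto simp: indicator_def numeral_2_eq_2)
  also have "\<dots> \<le> ennreal (N\<^sup>2)" by (rule c) (use N in \<open>simp_all add: numeral_2_eq_2\<close>)
  finally have "t * (cmod c)\<^sup>2 * (pi / 2 - \<beta>) \<le> N\<^sup>2" by simp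
  then have "(cmod c)\<^sup>2 \<le> N\<^sup>2 / (t * (pi / 2 - \<beta>))" using t_pos \<beta> by (simp add: field_simps)
  also have "\<dots> = (N / sqrt (t * (pi / 2 - \<beta>)))\<^sup>2" using t_pos \<beta> by (simp add: power_divide)
  finally have "cmod c \<le> N / sqrt (t * (pi / 2 - \<beta>))"
    by (rule power2_le_imp_le) (use N t_pos \<beta> in simp)
  moreover have "cmod c * T\<^sup>2 \<le> cmod c * 1" using T by (intro mult_left_mono) (auto simp: power_le_one)
  ultimately show "pt_norm \<phi> (p \<zeta>) \<le> N / sqrt (t * (pi / 2 - \<beta>)) + 14 * N"
    using b[OF \<zeta> N] by (simp add: T_def)
qed

text \<open>Since \<open>enn2real\<close> sends infinity to 0, the first equation contains the
  finiteness of the L^2 norm. It follows from ||\<phi>||^2 \<le> M ||\<phi>|| with a uniform bound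
  \<open>M\<close>.\<close>

lemma L2_norm_squared:
  assumes G: "fuchsian G" "torsion_free G" and F: "fundamental_set G F" "hyp_area F < \<infinity>"
    and \<phi>: "fin_area_hqd G F \<phi>"
  shows "norm_integral F \<phi> 2 = ennreal ((L2_norm F \<phi>)\<^sup>2)" "norm_integral F \<phi> 1 < \<infinity>"
proof -
  have Fu: "z \<in> F \<Longrightarrow> 0 < Im z" for z using F(1) by (auto simp: fundamental_set_def uhp_def)
  have "norm_integral F \<phi> 1 = (\<integral>\<^sup>+z\<in>F. ennreal (cmod (\<phi> z)) \<partial>lborel)"
    unfolding norm_integral_def using Fu
    by (intro nn_integral_cong) (force simp: indicator_def pt_norm_def simp flip: ennreal_mult)
  then show fin1: "norm_integral F \<phi> 1 < \<infinity>" using \<phi> by (simp add: fin_area_hqd_def)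
  then obtain L where L: "0 \<le> L" "norm_integral F \<phi> 1 = ennreal L" by (cases "norm_integral F \<phi> 1") auto
  have sys: "0 < systole G" by (rule systole_pos(1)[OF G F])
  \<comment> \<open>\<open>M\<close> may depend on the surface through its systole, as only
    finiteness is at stake: 50 covers the thick part and the cusps, and 6/systole the collars, whose
    period is at least the systole.\<close>
  define M where "M = max 50 (6 / systole G) * L"
  have M50: "50 * L \<le> M" "6 / systole G * L \<le> M" unfolding M_def by (rule mult_right_mono; simp add: L)+
  have sup: "pt_norm \<phi> z \<le> M" if z: "z \<in> uhp" for z
  proof (rule thick_thin[OF G z])
    assume "\<And>w h. w \<in> ball z (Im z / 10) \<Longrightarrow> h \<in> G \<Longrightarrow> mob h w \<in> ball z (Im z / 10) \<Longrightarrow> mob h w = w"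
    then have "pt_norm \<phi> z ^ Suc 0 \<le> 50 * L"
      by (rule thick_pointwise[OF G(1) F(1) \<phi> z]) (use L in auto)
    then show ?thesis using M50 by simp
  next
    fix p s t l g \<zeta>
    assume ch: "strip_chart G p {0<..<pi} {arcsin s<..<pi - arcsin s} sin s t" and p: "p \<zeta> = z"
      and \<zeta>: "Im \<zeta> \<in> {0<..<pi}" "2 * s \<le> sin (Im \<zeta>)" "2 * t \<le> sin (Im \<zeta>)" and s: "0 < s" "s < 1"
      and l: "1 < l" "t = 2 * ln l" and g: "g \<in> G" "\<bar>tr g\<bar> = l + 1 / l"
    have st: "systole G \<le> t" unfolding l(2) by (rule systole_pos(2)[OF G F g(1) l(1) g(2)])
    have "pt_norm \<phi> z \<le> 6 / t * L" using collar_bound(1)[OF ch F(1) \<phi> \<zeta> s L(1)] L(2) p by simp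
    also have "\<dots> \<le> 6 / systole G * L" using st sys L by (intro mult_right_mono divide_left_mono) auto
    finally show ?thesis using M50 by simp
  next
    fix p s t \<zeta>
    assume ch: "strip_chart G p {0<..} {s<..} (\<lambda>y. y) s t" and p: "p \<zeta> = z"
      and \<zeta>: "Im \<zeta> \<in> {0<..}" "2 * s \<le> Im \<zeta>" "2 * t \<le> Im \<zeta>"
    have "pt_norm \<phi> z \<le> 24 * L" using cusp_bound(1)[OF ch F(1) \<phi> \<zeta> L(1)] L(2) p by simp
    then show ?thesis using M50 L by simp
  qed
  have "0 \<le> M" using M50 L by linarith
  obtain \<kappa> where \<kappa>: "\<kappa> \<in> borel_measurable borel"
    and \<kappa>_eq: "\<And>z. z \<in> uhp \<Longrightarrow> \<kappa> z = ennreal (pt_norm \<phi> z ^ 1)"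
    and eq: "hyp_integral \<kappa> F = norm_integral F \<phi> 1"
    by (rule norm_integral_density[OF G(1) F(1) \<phi>, of 1]) (rule that)
  have [measurable]: "F \<in> sets borel" "\<kappa> \<in> borel_measurable borel" using F(1) \<kappa> by (auto simp: fundamental_set_def)
  have "norm_integral F \<phi> 2 \<le> (\<integral>\<^sup>+z. ennreal M * (\<kappa> z * ennreal (1 / (Im z)\<^sup>2) * indicator F z) \<partial>lborel)"
    unfolding norm_integral_def
  proof (rule nn_integral_mono)
    fix z
    show "ennreal ((pt_norm \<phi> z)\<^sup>2) * ennreal (1 / (Im z)\<^sup>2) * indicator F z \<le>
        ennreal M * (\<kappa> z * ennreal (1 / (Im z)\<^sup>2) * indicator F z)"
    proof (cases "z \<in> F")
      case True
      then have z: "z \<in> uhp" using Fu by (simp add: uhp_def)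
      have "0 \<le> pt_norm \<phi> z" by (simp add: pt_norm_def)
      then have "ennreal ((pt_norm \<phi> z)\<^sup>2) \<le> ennreal (M * pt_norm \<phi> z)"
        using sup[OF z] by (intro ennreal_leI) (simp add: power2_eq_square mult_right_mono)
      also have "\<dots> = ennreal M * \<kappa> z" using \<open>0 \<le> M\<close> by (simp add: \<kappa>_eq[OF z] ennreal_mult')
      finally show ?thesis using True by (simp add: mult_right_mono flip: mult.assoc)
    qed simp
  qed
  also have "\<dots> = ennreal M * norm_integral F \<phi> 1" unfolding eq[symmetric]
    by (rule nn_integral_cmult) measurable
  also have "\<dots> < \<infinity>" using L by (simp add: ennreal_mult_less_top)
  finally have fin: "norm_integral F \<phi> 2 < \<infinity>" .
  have "L2_norm F \<phi> = sqrt (enn2real (norm_integral F \<phi> 2))"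
    unfolding L2_norm_def norm_integral_def by (simp add: ennreal_mult'[symmetric])
  then show "norm_integral F \<phi> 2 = ennreal ((L2_norm F \<phi>)\<^sup>2)" using fin by simp
qed

text \<open>The threshold \<open>t0\<close> separates collars by period. Above it the crude bound
  sqrt(24/t0) suffices, which depends only on \<beta>; below it the truncated collar is available
  and the sharp bound applies, with \<open>t\<close> replaced by the smaller systole.\<close>

lemma pointwise_bound:
  assumes G: "fuchsian G" "torsion_free G" and F: "fundamental_set G F" "hyp_area F < \<infinity>"
    and \<phi>: "fin_area_hqd G F \<phi>" and z: "z \<in> uhp" and \<beta>: "0 < \<beta>" "\<beta> < pi / 2"
  defines "t0 \<equiv> 2 * ln (1 + sin \<beta>)" and "N \<equiv> L2_norm F \<phi>"
  shows "pt_norm \<phi> z \<le> max 14 (sqrt (24 / t0)) * N \<or>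
    pt_norm \<phi> z \<le> N / sqrt (systole G * (pi / 2 - \<beta>)) + 14 * N"
proof -
  have sin\<beta>: "0 < sin \<beta>" using \<beta> by (simp add: sin_gt_zero)
  then have t0: "0 < t0" by (simp add: t0_def)
  have N: "0 \<le> N" "norm_integral F \<phi> 2 \<le> ennreal (N\<^sup>2)"
    using L2_norm_squared(1)[OF G F \<phi>] by (auto simp: N_def L2_norm_def)
  obtain L where L: "0 \<le> L" "norm_integral F \<phi> 1 \<le> ennreal L"
    using L2_norm_squared(2)[OF G F \<phi>] by (cases "norm_integral F \<phi> 1") auto
  have sys: "0 < systole G" by (rule systole_pos(1)[OF G F])
  show ?thesis
  proof (rule thick_thin[OF G z])
    assume "\<And>w h. w \<in> ball z (Im z / 10) \<Longrightarrow> h \<in> G \<Longrightarrow> mob h w \<in> ball z (Im z / 10) \<Longrightarrow> mob h w = w"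
    then have "pt_norm \<phi> z ^ Suc 1 \<le> 50 * N\<^sup>2"
      by (rule thick_pointwise[OF G(1) F(1) \<phi> z]) (use N in \<open>auto simp: numeral_2_eq_2\<close>)
    also have "\<dots> \<le> (14 * N)\<^sup>2" by (simp add: power_mult_distrib)
    finally have "(pt_norm \<phi> z)\<^sup>2 \<le> (14 * N)\<^sup>2" by (simp add: numeral_2_eq_2)
    then have "pt_norm \<phi> z \<le> 14 * N" by (rule power2_le_imp_le) (use N in simp)
    also have "\<dots> \<le> max 14 (sqrt (24 / t0)) * N" using N by (intro mult_right_mono) auto
    finally show ?thesis by simp
  next
    fix p s t \<zeta>
    assume ch: "strip_chart G p {0<..} {s<..} (\<lambda>y. y) s t" and p: "p \<zeta> = z"
      and \<zeta>: "Im \<zeta> \<in> {0<..}" "2 * s \<le> Im \<zeta>" "2 * t \<le> Im \<zeta>"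
    have "pt_norm \<phi> z \<le> 14 * N" using cusp_bound(2)[OF ch F(1) \<phi> \<zeta> L N] p by simp
    also have "\<dots> \<le> max 14 (sqrt (24 / t0)) * N" using N by (intro mult_right_mono) auto
    finally show ?thesis by simp
  next
    fix p s t l g \<zeta>
    assume ch: "strip_chart G p {0<..<pi} {arcsin s<..<pi - arcsin s} sin s t" and p: "p \<zeta> = z"
      and \<zeta>: "Im \<zeta> \<in> {0<..<pi}" "2 * s \<le> sin (Im \<zeta>)" "2 * t \<le> sin (Im \<zeta>)" and s: "0 < s" "s < 1"
      and l: "1 < l" "t = 2 * ln l" and sl: "s = (l - 1 / l) / 2" and g: "g \<in> G" "\<bar>tr g\<bar> = l + 1 / l"
    have st: "systole G \<le> t" unfolding l(2) by (rule systole_pos(2)[OF G F g(1) l(1) g(2)])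
    show ?thesis
    proof (cases "t < t0")
      case False
      have "pt_norm \<phi> z \<le> sqrt (24 / t) * N" using collar_bound(2)[OF ch F(1) \<phi> \<zeta> s N] p by simp
      also have "\<dots> \<le> sqrt (24 / t0) * N" using False t0 N
        by (intro mult_right_mono real_sqrt_le_mono divide_left_mono) auto
      also have "\<dots> \<le> max 14 (sqrt (24 / t0)) * N" using N by (intro mult_right_mono) auto
      finally show ?thesis by simp
    next
      case True
      \<comment> \<open>This is what \<open>t0\<close> was chosen for: t < t0 means l < 1 + sin
        \<beta>, and s \<le> l - 1 because l + 1/l \<ge> 2.\<close>
      then have "ln l < ln (1 + sin \<beta>)" by (simp add: l(2) t0_def)
      then have "l < 1 + sin \<beta>" using l(1) sin\<beta> by simp
      moreover have "s \<le> l - 1" using add_inverse_mono(1)[of 1 l] l(1) by (simp add: sl)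
      ultimately have sb: "s < sin \<beta>" by linarith
      have "pt_norm \<phi> z \<le> N / sqrt (t * (pi / 2 - \<beta>)) + 14 * N"
        using collar_bound(3)[OF ch F(1) \<phi> \<zeta> s N \<beta> sb] p by simp
      also have "N / sqrt (t * (pi / 2 - \<beta>)) \<le> N / sqrt (systole G * (pi / 2 - \<beta>))"
        using st sys \<beta> N by (intro divide_left_mono real_sqrt_le_mono mult_right_mono mult_pos_pos) auto
      finally show ?thesis by simp
    qed
  qed
qed

theorem theorem3p6:
  shows "\<forall>\<epsilon>>0. \<exists>\<delta>>0. \<forall>(g::nat) (n::nat) G F \<phi> z.
     3 * g + n \<ge> 5 \<and> in_moduli g n G F \<and> systole G \<le> \<delta> \<and>
     fin_area_hqd G F \<phi> \<and> z \<in> uhp \<longrightarrow>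
     pt_norm \<phi> z \<le> (1 + \<epsilon>) * sqrt (2 / pi) * L2_norm F \<phi> / sqrt (systole G)"
proof (intro allI impI)
  fix \<epsilon> :: real assume \<epsilon>: "0 < \<epsilon>"
  \<comment> \<open>Solves pi/2 - \<beta> = (pi/2)/(1 + \<epsilon>/2)^2, so that truncating the
    collar costs exactly a factor 1 + \<epsilon>/2 in the main term.\<close>
  define \<beta> where "\<beta> = pi / 2 - (pi / 2) / (1 + \<epsilon> / 2)\<^sup>2"
  have e2: "1 < (1 + \<epsilon> / 2)\<^sup>2" using \<epsilon> by (intro one_less_power) auto
  have "0 < (pi / 2) / (1 + \<epsilon> / 2)\<^sup>2" using e2 by (intro divide_pos_pos) auto
  moreover have "(pi / 2) / (1 + \<epsilon> / 2)\<^sup>2 < (pi / 2) / 1" using e2 by (intro divide_strict_left_mono) auto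
  ultimately have \<beta>: "0 < \<beta>" "\<beta> < pi / 2" by (simp_all add: \<beta>_def)
  define K where "K = max 14 (sqrt (24 / (2 * ln (1 + sin \<beta>))))"
  have K: "14 \<le> K" by (simp add: K_def)
  define c where "c = \<epsilon> / 2 * sqrt (2 / pi)"
  have c: "0 < c" using \<epsilon> by (simp add: c_def)
  show "\<exists>\<delta>>0. \<forall>(g::nat) (n::nat) G F \<phi> z.
     3 * g + n \<ge> 5 \<and> in_moduli g n G F \<and> systole G \<le> \<delta> \<and>
     fin_area_hqd G F \<phi> \<and> z \<in> uhp \<longrightarrow>
     pt_norm \<phi> z \<le> (1 + \<epsilon>) * sqrt (2 / pi) * L2_norm F \<phi> / sqrt (systole G)"
  \<comment> \<open>The other half of \<epsilon> absorbs the bounded terms: a systole of at most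
    (c/K)^2 means K \<le> c/sqrt(systole), where \<open>c\<close> is \<epsilon>/2 times
    sqrt(2/pi).\<close>
  proof (intro exI[of _ "(c / K)\<^sup>2"] conjI allI impI)
    show "0 < (c / K)\<^sup>2" using c K by simp
    fix g n :: nat and G F \<phi> z
    assume A: "3 * g + n \<ge> 5 \<and> in_moduli g n G F \<and> systole G \<le> (c / K)\<^sup>2 \<and> fin_area_hqd G F \<phi> \<and> z \<in> uhp"
    then have G: "fuchsian G" "torsion_free G" and F: "fundamental_set G F" "hyp_area F < \<infinity>"
      and \<phi>: "fin_area_hqd G F \<phi>" and z: "z \<in> uhp" and le: "systole G \<le> (c / K)\<^sup>2"
      by (auto simp: in_moduli_def)
    define N r where "N = L2_norm F \<phi>" and "r = sqrt (systole G)"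
    have N: "0 \<le> N" by (simp add: N_def L2_norm_def)
    have sys: "0 < systole G" by (rule systole_pos(1)[OF G F])
    have r: "0 < r" using sys by (simp add: r_def)
    have "r \<le> sqrt ((c / K)\<^sup>2)" unfolding r_def using le by (rule real_sqrt_le_mono)
    then have "r \<le> c / K" using c K by simp
    then have "K \<le> c / r" using r K by (simp add: field_simps)
    then have KN: "K * N \<le> c / r * N" using N by (rule mult_right_mono)
    have main: "N / sqrt (systole G * (pi / 2 - \<beta>)) = (1 + \<epsilon> / 2) * sqrt (2 / pi) / r * N"
    proof -
      have "sqrt (systole G * (pi / 2 - \<beta>)) = r * (sqrt (pi / 2) / (1 + \<epsilon> / 2))"
        using \<epsilon> by (simp add: \<beta>_def r_def real_sqrt_mult real_sqrt_divide)
      moreover have "sqrt (2 / pi) = 1 / sqrt (pi / 2)" by (simp add: real_sqrt_divide)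
      ultimately show ?thesis using r \<epsilon> by (simp add: mult_ac)
    qed
    have "pt_norm \<phi> z \<le> (1 + \<epsilon> / 2) * sqrt (2 / pi) / r * N + c / r * N"
      using pointwise_bound[OF G F \<phi> z \<beta>] unfolding K_def[symmetric] N_def[symmetric]
    proof
      assume "pt_norm \<phi> z \<le> K * N"
      moreover have "0 \<le> (1 + \<epsilon> / 2) * sqrt (2 / pi) / r * N" using \<epsilon> r N by simp
      ultimately show ?thesis using KN by linarith
    next
      assume "pt_norm \<phi> z \<le> N / sqrt (systole G * (pi / 2 - \<beta>)) + 14 * N"
      moreover have "14 * N \<le> K * N" using K N by (rule mult_right_mono)
      ultimately show ?thesis using KN unfolding main by linarith
    qed
    also have "\<dots> = (1 + \<epsilon>) * sqrt (2 / pi) * N / r"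
      using r by (simp add: c_def field_simps)
    finally show "pt_norm \<phi> z \<le> (1 + \<epsilon>) * sqrt (2 / pi) * L2_norm F \<phi> / sqrt (systole G)"
      by (simp add: N_def r_def)
  qed
qed

end
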